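(* Let $0\le k\le n$, let $\Omega\subset\mathbb{R}^n$ be a bounded domain and let $\sigma_0\ge1$. There is a constant $C$, depending only on $n$, $k$, $\Omega$ and $\sigma_0$, such that for every cubical mesh $\mathcal{G}_h$ of $\Omega$ with shape regularity constant at most $\sigma_0$: for every $\omega\in H\Lambda^k(\Omega)$, $$\inf_{\mu_h\in W^{\rm def}_h\Lambda^k}\|\omega-\mu_h\|_{d^k_h}\le C\Big(\inf_{\eta_h\in V^{\mathcal{Q}}_h\Lambda^k}\|\omega-\eta_h\|_{d^k}+\inf_{\mu_h\in\mathcal{P}^-_1\Lambda^k(\mathcal{G}_h)}\|\omega-\mu_h\|_{d^k_h}\Big),$$ and for every $\omega\in H_0\Lambda^k(\Omega)$, $$\inf_{\mu_h\in W^{\rm def}_{h0}\Lambda^k}\|\omega-\mu_h\|_{d^k_h}\le C\Big(\inf_{\eta_h\in V^{\mathcal{Q}}_{h0}\Lambda^k}\|\omega-\eta_h\|_{d^k}+\inf_{\mu_h\in\mathcal{P}^-_1\Lambda^k(\mathcal{G}_h)}\|\omega-\mu_h\|_{d^k_h}\Big).$$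
   Context: Forms. For a domain $\Xi\subset\mathbb{R}^n$, $L^2\Lambda^k(\Xi)$ is the Hilbert space of differential $k$-forms with $L^2(\Xi)$ coefficients, with the componentwise inner product $\langle\cdot,\cdot\rangle_{L^2\Lambda^k(\Xi)}$; $d^k$ is the exterior derivative on $k$-forms (weak sense; $d^n=0$); $\star$ is the Euclidean Hodge star; the codifferential is $\delta_k=(-1)^{n(k+1)+1}\star d^{n-k}\star$ on $k$-forms, i.e. the formal $L^2$-adjoint of $d^{k-1}$. $H\Lambda^k(\Xi)=\{\omega\in L^2\Lambda^k(\Xi): d^k\omega\in L^2\Lambda^{k+1}(\Xi)\}$ (with $H\Lambda^n=L^2\Lambda^n$), $H^*\Lambda^k(\Xi)=\{\mu\in L^2\Lambda^k(\Xi):\delta_k\mu\in L^2\Lambda^{k-1}(\Xi)\}$, and $H_0\Lambda^k(\Xi)$, $H^*_0\Lambda^k(\Xi)$ are the closures of $\mathcal{C}^\infty_0\Lambda^k(\Xi)$ in $H\Lambda^k(\Xi)$, $H^*\Lambda^k(\Xi)$ in the graph norms. Mesh. A cubical mesh $\mathcal{G}_h$ of $\Omega$ is a finite (face-to-face) subdivision of $\Omega$ into $n$-dimensional boxes $K$ (products of intervals, edges parallel to the coordinate axes). Its shape regularity constant is the maximum over $K$ of the ratio of the longest to the shortest edge of $K$. Norms. $\|\omega\|_{d^k}^2=\|\omega\|_{L^2}^2+\|d^k\omega\|_{L^2}^2$ on $\Omega$, and $\|\omega\|_{d^k_h}^2=\sum_{K\in\mathcal{G}_h}\big(\|\omega\|_{L^2(K)}^2+\|d^k(\omega|_K)\|_{L^2(K)}^2\big)$.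 Local spaces. $\mathcal{P}_0\Lambda^k$ is the space of constant-coefficient $k$-forms. The Koszul operator is $\kappa(dx^{\alpha_1}\wedge\dots\wedge dx^{\alpha_k})=\sum_{j=1}^k(-1)^{j+1}x_{\alpha_j}dx^{\alpha_1}\wedge\dots\widehat{dx^{\alpha_j}}\dots\wedge dx^{\alpha_k}$ (linear over functions). Whitney forms: $\mathcal{P}^-_1\Lambda^k=\mathcal{P}_0\Lambda^k+\kappa(\mathcal{P}_0\Lambda^{k+1})$ (so $\mathcal{P}^-_1\Lambda^n=\mathcal{P}_0\Lambda^n$). For a box $K=I_1\times\dots\times I_n$, $\mathcal{Q}^-_1\Lambda^k(K)=\bigoplus_{\alpha}\big[\bigotimes_{i=1}^n\mathcal{P}_{1-\delta_{i,\alpha}}(I_i)\big]dx^{\alpha_1}\wedge\dots\wedge dx^{\alpha_k}$, the sum over $1\le\alpha_1<\dots<\alpha_k\le n$, where $\delta_{i,\alpha}=1$ if $i\in\{\alpha_1,\dots,\alpha_k\}$ and $0$ otherwise, and $\mathcal{P}_r(I)$ denotes univariate polynomials of degree at most $r$. $\mathcal{Q}^{*,-}_1\Lambda^k(K)=\star(\mathcal{Q}^-_1\Lambda^{n-k}(K))$. Global spaces. $\mathcal{P}^-_1\Lambda^k(\mathcal{G}_h)=\prod_{K\in\mathcal{G}_h}\mathcal{P}^-_1\Lambda^k(K)$. $V^{\mathcal{Q}}_h\Lambda^k$ (resp. $V^{\mathcal{Q}}_{h0}\Lambda^k$) is the set of $\omega\in H\Lambda^k(\Omega)$ (resp. $H_0\Lambda^k(\Omega)$)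 with $\omega|_K\in\mathcal{Q}^-_1\Lambda^k(K)$ for all $K\in\mathcal{G}_h$. $V^{\mathcal{Q},*}_{h}\Lambda^{k}$ (resp. $V^{\mathcal{Q},*}_{h0}\Lambda^{k}$) is the set of $\mu\in H^*\Lambda^{k}(\Omega)$ (resp. $H^*_0\Lambda^{k}(\Omega)$) with $\mu|_K\in\mathcal{Q}^{*,-}_1\Lambda^{k}(K)$ for all $K\in\mathcal{G}_h$. Define $$W^{\rm def}_h\Lambda^k=\Big\{\omega_h\in\mathcal{P}^-_1\Lambda^k(\mathcal{G}_h):\sum_{K\in\mathcal{G}_h}\langle d^k\omega_h,\mu_h\rangle_{L^2\Lambda^{k+1}(K)}-\langle\omega_h,\delta_{k+1}\mu_h\rangle_{L^2\Lambda^k(K)}=0\ \ \forall\mu_h\in V^{\mathcal{Q},*}_{h0}\Lambda^{k+1}\Big\},$$ and $W^{\rm def}_{h0}\Lambda^k$ by the same formula with $V^{\mathcal{Q},*}_{h0}\Lambda^{k+1}$ replaced by $V^{\mathcal{Q},*}_{h}\Lambda^{k+1}$. For $k=n$ the condition is void (there are no nonzero $(n+1)$-forms), so $W^{\rm def}_h\Lambda^n=W^{\rm def}_{h0}\Lambda^n=\mathcal{P}_0\Lambda^n(\mathcal{G}_h)$, the piecewise constant $n$-forms. *)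

theory Defs
  imports "HOL-Analysis.Analysis" "HOL-Computational_Algebra.Polynomial"
begin

text \<open>
  The coordinates of \<open>\<real>\<^sup>n\<close> are indexed by a finite linearly ordered type \<open>'n\<close>, so \<open>n = CARD('n)\<close>.
  An increasing multi-index \<open>\<alpha>\<^sub>1 < \<dots> < \<alpha>\<^sub>k\<close> is encoded by the set of its entries, and
  the whole exterior algebra by \<open>real ^ 'n set\<close>: the component \<open>c $ \<alpha>\<close> is the coefficient of
  \<open>dx\<^sup>\<alpha>\<close>. The inner product and norm of this Euclidean space are the componentwise ones.
  Forms on a domain are functions on all of \<open>\<real>\<^sup>n\<close> of which only the values almost everywhere
  on the domain matter. The operators are defined on forms of mixed degree; \<open>covectors k\<close> selects
  the degree. In particular \<open>d\<close> vanishes on forms of degree \<open>n\<close>, and the only form of degree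
  \<open>n + 1\<close> is \<open>0\<close>.
\<close>

type_synonym 'n covector = "real ^ 'n set"
type_synonym 'n form = "real ^ 'n \<Rightarrow> 'n covector"

definition covectors :: "nat \<Rightarrow> ('n::finite) covector set" where
  "covectors k = {c. \<forall>\<alpha>. card \<alpha> \<noteq> k \<longrightarrow> c $ \<alpha> = 0}"

definition dx :: "('n::finite) set \<Rightarrow> 'n covector" where
  "dx \<alpha> = axis \<alpha> 1"

text \<open>For disjoint \<open>\<alpha>\<close>, \<open>\<beta>\<close>: \<open>dx\<^sup>\<alpha> \<and> dx\<^sup>\<beta> = wedge_sign \<alpha> \<beta> dx\<^bsup>\<alpha> \<union> \<beta>\<^esup>\<close>.\<close>

definition wedge_sign :: "('n::{finite,linorder}) set \<Rightarrow> 'n set \<Rightarrow> real" where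
  "wedge_sign \<alpha> \<beta> = (-1) ^ card {(i, j). i \<in> \<alpha> \<and> j \<in> \<beta> \<and> j < i}"

text \<open>\<open>dx\<^sup>\<alpha> \<and> \<star>dx\<^sup>\<alpha>\<close> is the volume form.\<close>

definition hodge :: "('n::{finite,linorder}) covector \<Rightarrow> 'n covector" where
  "hodge c = (\<Sum>\<alpha>\<in>UNIV. (wedge_sign \<alpha> (- \<alpha>) * c $ \<alpha>) *\<^sub>R dx (- \<alpha>))"

text \<open>The sign \<open>(-1)\<^bsup>j+1\<^esup>\<close> belonging to the \<open>j\<close>-th entry \<open>i\<close> of \<open>\<alpha>\<close> is
  \<open>wedge_sign {i} (\<alpha> - {i})\<close>.\<close>

definition koszul :: "('n::{finite,linorder}) form \<Rightarrow> 'n form" where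
  "koszul \<omega> x = (\<Sum>\<alpha>\<in>UNIV. \<Sum>i\<in>\<alpha>. (\<omega> x $ \<alpha> * wedge_sign {i} (\<alpha> - {i}) * x $ i) *\<^sub>R dx (\<alpha> - {i}))"


subsection \<open>Sobolev spaces of forms\<close>

definition partial_deriv :: "'n::finite \<Rightarrow> (real ^ 'n \<Rightarrow> real) \<Rightarrow> real ^ 'n \<Rightarrow> real" where
  "partial_deriv i f x = frechet_derivative f (at x) (axis i 1)"

definition smooth :: "(real ^ 'n::finite \<Rightarrow> real) \<Rightarrow> bool" where
  "smooth f \<longleftrightarrow> (\<forall>is. foldr partial_deriv is f differentiable_on UNIV)"

definition test_functions :: "(real ^ 'n::finite) set \<Rightarrow> (real ^ 'n \<Rightarrow> real) set" where
  "test_functions \<Xi> =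
     {\<phi>. smooth \<phi> \<and> compact (closure {x. \<phi> x \<noteq> 0}) \<and> closure {x. \<phi> x \<noteq> 0} \<subseteq> \<Xi>}"

definition test_forms :: "nat \<Rightarrow> (real ^ 'n::finite) set \<Rightarrow> 'n form set" where
  "test_forms k \<Xi> =
     {\<phi>. (\<forall>x. \<phi> x \<in> covectors k) \<and> (\<forall>\<alpha>. (\<lambda>x. \<phi> x $ \<alpha>) \<in> test_functions \<Xi>)}"

definition L2 :: "(real ^ 'n::finite) set \<Rightarrow> 'n form set" where
  "L2 \<Xi> = {\<omega>. \<omega> \<in> borel_measurable (lebesgue_on \<Xi>) \<and> integrable (lebesgue_on \<Xi>) (\<lambda>x. (norm (\<omega> x))\<^sup>2)}"

definition L2_forms :: "nat \<Rightarrow> (real ^ 'n::finite) set \<Rightarrow> 'n form set" where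
  "L2_forms k \<Xi> = {\<omega> \<in> L2 \<Xi>. AE x in lebesgue_on \<Xi>. \<omega> x \<in> covectors k}"

definition L2_inner :: "(real ^ 'n::finite) set \<Rightarrow> 'n form \<Rightarrow> 'n form \<Rightarrow> real" where
  "L2_inner \<Xi> \<omega> \<eta> = (LINT x|lebesgue_on \<Xi>. \<omega> x \<bullet> \<eta> x)"

definition L2_norm :: "(real ^ 'n::finite) set \<Rightarrow> 'n form \<Rightarrow> real" where
  "L2_norm \<Xi> \<omega> = sqrt (L2_inner \<Xi> \<omega> \<omega>)"

text \<open>The exterior derivative in the sense of distributions: the coefficient of \<open>dx\<^sup>\<beta>\<close> in
  \<open>\<Sum>\<^sub>\<alpha> \<Sum>\<^sub>i \<partial>\<^sub>i\<omega>\<^sub>\<alpha> dx\<^sup>i \<and> dx\<^sup>\<alpha>\<close> is \<open>\<Sum>\<^bsub>i\<in>\<beta>\<^esub> wedge_sign {i} (\<beta> - {i}) \<partial>\<^sub>i\<omega>\<^bsub>\<beta> - {i}\<^esub>\<close>.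
  The definition is meaningful for locally integrable \<open>\<omega>\<close> and \<open>\<eta>\<close>.\<close>

definition has_weak_d :: "(real ^ 'n::{finite,linorder}) set \<Rightarrow> 'n form \<Rightarrow> 'n form \<Rightarrow> bool" where
  "has_weak_d \<Xi> \<omega> \<eta> \<longleftrightarrow> (\<forall>\<phi>\<in>test_functions \<Xi>. \<forall>\<beta>.
     (LINT x|lebesgue_on \<Xi>. \<eta> x $ \<beta> * \<phi> x) =
     - (\<Sum>i\<in>\<beta>. wedge_sign {i} (\<beta> - {i}) * (LINT x|lebesgue_on \<Xi>. \<omega> x $ (\<beta> - {i}) * partial_deriv i \<phi> x)))"

definition has_weak_codiff ::
    "nat \<Rightarrow> (real ^ 'n::{finite,linorder}) set \<Rightarrow> 'n form \<Rightarrow> 'n form \<Rightarrow> bool" where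
  "has_weak_codiff k \<Xi> \<mu> \<nu> \<longleftrightarrow> (\<exists>\<eta>. has_weak_d \<Xi> (\<lambda>x. hodge (\<mu> x)) \<eta> \<and>
     \<nu> = (\<lambda>x. (-1) ^ (CARD('n) * (k + 1) + 1) *\<^sub>R hodge (\<eta> x)))"

text \<open>The square integrable \<open>d\<omega>\<close> and \<open>\<delta>\<^sub>k\<mu>\<close>, each unique up to a null set. They are used
  only where they exist.\<close>

definition weak_d :: "(real ^ 'n::{finite,linorder}) set \<Rightarrow> 'n form \<Rightarrow> 'n form" where
  "weak_d \<Xi> \<omega> = (SOME \<eta>. \<eta> \<in> L2 \<Xi> \<and> has_weak_d \<Xi> \<omega> \<eta>)"

definition weak_codiff :: "nat \<Rightarrow> (real ^ 'n::{finite,linorder}) set \<Rightarrow> 'n form \<Rightarrow> 'n form" where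
  "weak_codiff k \<Xi> \<mu> = (SOME \<nu>. \<nu> \<in> L2 \<Xi> \<and> has_weak_codiff k \<Xi> \<mu> \<nu>)"

definition H :: "nat \<Rightarrow> (real ^ 'n::{finite,linorder}) set \<Rightarrow> 'n form set" where
  "H k \<Xi> = {\<omega> \<in> L2_forms k \<Xi>. \<exists>\<eta>\<in>L2_forms (k + 1) \<Xi>. has_weak_d \<Xi> \<omega> \<eta>}"

definition H_star :: "nat \<Rightarrow> (real ^ 'n::{finite,linorder}) set \<Rightarrow> 'n form set" where
  "H_star k \<Xi> = {\<mu> \<in> L2_forms k \<Xi>. \<exists>\<nu>\<in>L2_forms (k - 1) \<Xi>. has_weak_codiff k \<Xi> \<mu> \<nu>}"

definition d_norm :: "(real ^ 'n::{finite,linorder}) set \<Rightarrow> 'n form \<Rightarrow> real" where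
  "d_norm \<Xi> \<omega> = sqrt ((L2_norm \<Xi> \<omega>)\<^sup>2 + (L2_norm \<Xi> (weak_d \<Xi> \<omega>))\<^sup>2)"

definition codiff_norm :: "nat \<Rightarrow> (real ^ 'n::{finite,linorder}) set \<Rightarrow> 'n form \<Rightarrow> real" where
  "codiff_norm k \<Xi> \<mu> = sqrt ((L2_norm \<Xi> \<mu>)\<^sup>2 + (L2_norm \<Xi> (weak_codiff k \<Xi> \<mu>))\<^sup>2)"

definition H0 :: "nat \<Rightarrow> (real ^ 'n::{finite,linorder}) set \<Rightarrow> 'n form set" where
  "H0 k \<Xi> = {\<omega> \<in> H k \<Xi>. \<forall>\<epsilon>>0. \<exists>\<phi>\<in>test_forms k \<Xi>. d_norm \<Xi> (\<lambda>x. \<omega> x - \<phi> x) < \<epsilon>}"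

definition H0_star :: "nat \<Rightarrow> (real ^ 'n::{finite,linorder}) set \<Rightarrow> 'n form set" where
  "H0_star k \<Xi> =
     {\<mu> \<in> H_star k \<Xi>. \<forall>\<epsilon>>0. \<exists>\<phi>\<in>test_forms k \<Xi>. codiff_norm k \<Xi> (\<lambda>x. \<mu> x - \<phi> x) < \<epsilon>}"


subsection \<open>Cubical meshes\<close>

definition edge_length :: "(real ^ 'n::finite) set \<Rightarrow> 'n \<Rightarrow> real" where
  "edge_length K i = interval_upperbound K $ i - interval_lowerbound K $ i"

text \<open>The cells are closed boxes with nonempty interior. The condition \<open>interior K \<subseteq> \<Omega>\<close> matters only
  if \<open>\<Omega>\<close> differs from the interior of its closure, e.g. for slit domains.\<close>

definition cubical_mesh :: "(real ^ 'n::finite) set \<Rightarrow> (real ^ 'n) set set \<Rightarrow> bool" where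
  "cubical_mesh \<Omega> G \<longleftrightarrow>
     G division_of closure \<Omega> \<and>
     (\<forall>K\<in>G. interior K \<noteq> {} \<and> interior K \<subseteq> \<Omega>) \<and>
     (\<forall>K\<in>G. \<forall>L\<in>G. (K \<inter> L) face_of K \<and> (K \<inter> L) face_of L)"

definition shape_regularity :: "(real ^ 'n::finite) set set \<Rightarrow> real" where
  "shape_regularity G = Max ((\<lambda>K. Max (range (edge_length K)) / Min (range (edge_length K))) ` G)"

text \<open>\<open>\<omega>|\<^sub>K \<in> S\<close>, for a set \<open>S\<close> of polynomial forms given by their formulas on all of
  \<open>\<real>\<^sup>n\<close>.\<close>

definition restricts_to :: "('n::finite) form \<Rightarrow> (real ^ 'n) set \<Rightarrow> 'n form set \<Rightarrow> bool" where
  "restricts_to \<omega> K S \<longleftrightarrow> (\<exists>p\<in>S. AE x in lebesgue_on (interior K). \<omega> x = p x)"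

definition broken_d_norm :: "(real ^ 'n::{finite,linorder}) set set \<Rightarrow> 'n form \<Rightarrow> real" where
  "broken_d_norm G \<omega> = sqrt (\<Sum>K\<in>G.
     (L2_norm (interior K) \<omega>)\<^sup>2 + (L2_norm (interior K) (weak_d (interior K) \<omega>))\<^sup>2)"


subsection \<open>Polynomial forms and discrete spaces\<close>

definition P0_forms :: "nat \<Rightarrow> ('n::finite) form set" where
  "P0_forms k = {\<lambda>x. c | c. c \<in> covectors k}"

definition P1m_forms :: "nat \<Rightarrow> ('n::{finite,linorder}) form set" where
  "P1m_forms k = {\<lambda>x. p x + koszul q x | p q. p \<in> P0_forms k \<and> q \<in> P0_forms (k + 1)}"

text \<open>The tensor product over \<open>i\<close> of the spaces of univariate polynomials of degree at most
  \<open>r i\<close>: finite sums of products.\<close>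

definition tensor_polys :: "('n::finite \<Rightarrow> nat) \<Rightarrow> (real ^ 'n \<Rightarrow> real) set" where
  "tensor_polys r = {\<lambda>x. \<Sum>j<m. \<Prod>i\<in>UNIV. poly (p j i) (x $ i) |
     (m::nat) (p :: nat \<Rightarrow> 'n \<Rightarrow> real poly). \<forall>j<m. \<forall>i. degree (p j i) \<le> r i}"

definition Q1m_forms :: "nat \<Rightarrow> ('n::finite) form set" where
  "Q1m_forms k = {\<omega>. (\<forall>x. \<omega> x \<in> covectors k) \<and>
     (\<forall>\<alpha>. card \<alpha> = k \<longrightarrow> (\<lambda>x. \<omega> x $ \<alpha>) \<in> tensor_polys (\<lambda>i. 1 - (if i \<in> \<alpha> then 1 else 0)))}"

text \<open>For \<open>k = n + 1\<close> the truncated \<open>n - k\<close> does not give the zero space, but then \<open>VQ_star\<close>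
  and \<open>VQ0_star\<close> below still contain only \<open>0\<close>, as subspaces of \<open>H_star (n + 1)\<close>.\<close>

definition Q1m_star_forms :: "nat \<Rightarrow> ('n::{finite,linorder}) form set" where
  "Q1m_star_forms k = (\<lambda>\<omega> x. hodge (\<omega> x)) ` Q1m_forms (CARD('n) - k)"

definition P1m_broken :: "nat \<Rightarrow> (real ^ 'n::{finite,linorder}) set set \<Rightarrow> 'n form set" where
  "P1m_broken k G = {\<omega>. \<forall>K\<in>G. restricts_to \<omega> K (P1m_forms k)}"

definition VQ :: "nat \<Rightarrow> (real ^ 'n::{finite,linorder}) set \<Rightarrow> (real, 'n) vec set set \<Rightarrow> 'n form set" where
  "VQ k \<Omega> G = {\<omega> \<in> H k \<Omega>. \<forall>K\<in>G. restricts_to \<omega> K (Q1m_forms k)}"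

definition VQ0 :: "nat \<Rightarrow> (real ^ 'n::{finite,linorder}) set \<Rightarrow> (real, 'n) vec set set \<Rightarrow> 'n form set" where
  "VQ0 k \<Omega> G = {\<omega> \<in> H0 k \<Omega>. \<forall>K\<in>G. restricts_to \<omega> K (Q1m_forms k)}"

definition VQ_star ::
    "nat \<Rightarrow> (real ^ 'n::{finite,linorder}) set \<Rightarrow> (real, 'n) vec set set \<Rightarrow> 'n form set" where
  "VQ_star k \<Omega> G = {\<mu> \<in> H_star k \<Omega>. \<forall>K\<in>G. restricts_to \<mu> K (Q1m_star_forms k)}"

definition VQ0_star ::
    "nat \<Rightarrow> (real ^ 'n::{finite,linorder}) set \<Rightarrow> (real, 'n) vec set set \<Rightarrow> 'n form set" where
  "VQ0_star k \<Omega> G = {\<mu> \<in> H0_star k \<Omega>. \<forall>K\<in>G. restricts_to \<mu> K (Q1m_star_forms k)}"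

definition adjointness_defect ::
    "nat \<Rightarrow> (real ^ 'n::{finite,linorder}) set \<Rightarrow> (real, 'n) vec set set \<Rightarrow> 'n form \<Rightarrow> 'n form \<Rightarrow> real" where
  "adjointness_defect k \<Omega> G \<omega> \<mu> = (\<Sum>K\<in>G.
     L2_inner (interior K) (weak_d (interior K) \<omega>) \<mu> -
     L2_inner (interior K) \<omega> (weak_codiff (k + 1) \<Omega> \<mu>))"

definition Wdef :: "nat \<Rightarrow> (real ^ 'n::{finite,linorder}) set \<Rightarrow> (real, 'n) vec set set \<Rightarrow> 'n form set" where
  "Wdef k \<Omega> G =
     {\<omega> \<in> P1m_broken k G. \<forall>\<mu>\<in>VQ0_star (k + 1) \<Omega> G. adjointness_defect k \<Omega> G \<omega> \<mu> = 0}"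

definition Wdef0 :: "nat \<Rightarrow> (real ^ 'n::{finite,linorder}) set \<Rightarrow> (real, 'n) vec set set \<Rightarrow> 'n form set" where
  "Wdef0 k \<Omega> G =
     {\<omega> \<in> P1m_broken k G. \<forall>\<mu>\<in>VQ_star (k + 1) \<Omega> G. adjointness_defect k \<Omega> G \<omega> \<mu> = 0}"

end

theory Submission
  imports Defs
begin

text \<open>
  On a box \<open>U\<close> let the local projection \<open>\<Pi>\<eta>\<close> of a form \<open>\<eta>\<close> be the Whitney form whose mean is
  the mean of \<open>\<eta>\<close> and whose (constant) exterior derivative is the mean of \<open>d\<eta>\<close>. Explicitly,
  \<open>\<Pi>\<eta> = mean \<eta> + (\<kappa> e - (\<kappa> e)(z)) / (k + 1)\<close> with \<open>e = mean d\<eta>\<close> and \<open>z\<close> the centroid of \<open>U\<close>.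
  Two properties of \<open>\<Pi>\<close> carry the proof.

  Stability (\<open>whitney_approximation\<close>). \<open>\<Pi>\<close> reproduces Whitney forms, and it is bounded in the graph
  norm of \<open>d\<close>: means are bounded by Jensen's inequality, and \<open>\<kappa>\<close> costs only a factor proportional
  to the radius of a ball containing \<open>\<Omega>\<close>. Hence \<open>\<parallel>p - \<Pi>\<eta>\<parallel> = \<parallel>\<Pi>(p - \<eta>)\<parallel>\<close> is controlled by
  \<open>\<parallel>\<omega> - p\<parallel> + \<parallel>\<omega> - \<eta>\<parallel>\<close> for every Whitney form \<open>p\<close>.

  Consistency (\<open>whitney_pairing\<close>). If \<open>\<eta>\<close> lies in \<open>\<Q>\<^sup>-\<^sub>1\<Lambda>\<^sup>k\<close> and \<open>\<mu>\<close> in \<open>\<Q>\<^bsup>*,-\<^esup>\<^sub>1\<Lambda>\<^bsup>k+1\<^esup>\<close>, then the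
  coefficient of \<open>dx\<^sup>\<beta>\<close> in \<open>d\<eta>\<close> depends only on the variables outside \<open>\<beta>\<close> and that of \<open>\<mu>\<close> only on
  the variables in \<open>\<beta>\<close>; the same holds for \<open>\<eta>\<close> and \<open>\<delta>\<mu>\<close>. Functions of disjoint sets of variables
  are uncorrelated on a box (\<open>tens_uncorrelated\<close>), so \<open>\<langle>d\<eta>, \<mu>\<rangle> - \<langle>\<eta>, \<delta>\<mu>\<rangle>\<close> depends on \<open>\<eta>\<close> only
  through the means of \<open>\<eta>\<close> and \<open>d\<eta>\<close>, which \<open>\<Pi>\<close> preserves.

  For conforming \<open>\<eta>\<close> the sum of these pairings over all cells vanishes, because \<open>d\<close> and \<open>\<delta>\<close> are
  adjoint when one of the two forms is a limit of test forms (\<open>duality\<close>). Therefore the cellwise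
  projection of \<open>\<eta>\<close> belongs to the adjoint-constrained space, and stability gives the estimate with
  a constant depending only on \<open>n\<close> and on the radius of a ball containing \<open>\<Omega>\<close>.

  The analytic basis is the uniqueness of weak derivatives (\<open>fundamental_lemma\<close>), for which smooth
  bump functions are constructed, and integration by parts against test functions.
\<close>

section \<open>Square integrable functions on open sets\<close>

lemma lebesgue_on_AE_measurable:
  fixes f g :: "'a::euclidean_space \<Rightarrow> 'b::euclidean_space"
  assumes "open U" "g \<in> borel_measurable (lebesgue_on U)" "AE x in lebesgue_on U. f x = g x"
  shows "f \<in> borel_measurable (lebesgue_on U)"
proof -
  have U: "U \<in> sets lebesgue" using assms(1) by simp
  have g: "(\<lambda>x. indicator U x *\<^sub>R g x) \<in> borel_measurable lebesgue"
    using assms(2) U by (simp add: borel_measurable_restrict_space_iff)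
  have "AE x in lebesgue. indicator U x *\<^sub>R g x = indicator U x *\<^sub>R f x"
    using assms(3) U by (subst (asm) AE_restrict_space_iff) (auto elim!: eventually_mono simp: indicator_def)
  then have "(\<lambda>x. indicator U x *\<^sub>R f x) \<in> borel_measurable lebesgue"
    by (rule borel_measurable_AE[OF g])
  then show ?thesis using U by (simp add: borel_measurable_restrict_space_iff)
qed

lemma lebesgue_on_AE_iff:
  assumes "open U"
  shows "(AE x in lebesgue_on U. P x) \<longleftrightarrow> (AE x in lebesgue. x \<in> U \<longrightarrow> P x)"
  using assms by (subst AE_restrict_space_iff) auto

lemma lebesgue_on_AE_subset:
  assumes "open U" "open V" "U \<subseteq> V" "AE x in lebesgue_on V. P x"
  shows "AE x in lebesgue_on U. P x"
  using assms(3,4) unfolding lebesgue_on_AE_iff[OF assms(1)] lebesgue_on_AE_iff[OF assms(2)]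
  by (auto elim!: eventually_mono)

lemma lebesgue_on_integrable_subset:
  fixes f :: "'a::euclidean_space \<Rightarrow> real"
  assumes "open U" "open V" "U \<subseteq> V" "integrable (lebesgue_on V) f"
  shows "integrable (lebesgue_on U) f"
  using assms set_integrable_subset[of lebesgue V f U]
  by (simp add: integrable_restrict_space set_integrable_def)

lemma lebesgue_on_measurable_subset:
  fixes f :: "'a::euclidean_space \<Rightarrow> 'b::euclidean_space"
  assumes "open U" "open V" "U \<subseteq> V" "f \<in> borel_measurable (lebesgue_on V)"
  shows "f \<in> borel_measurable (lebesgue_on U)"
  using assms measurable_restrict_mono by blast

lemma lebesgue_on_integral_eq:
  fixes f :: "'a::euclidean_space \<Rightarrow> real"
  assumes "open U"
  shows "(LINT x|lebesgue_on U. f x) = (LINT x|lebesgue. indicator U x * f x)"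
  using assms by (simp add: integral_restrict_space)

lemma lebesgue_on_integral_zero_outside:
  fixes f :: "'a::euclidean_space \<Rightarrow> real"
  assumes "open U" "open V" "U \<subseteq> V" "\<And>x. x \<notin> U \<Longrightarrow> f x = 0"
  shows "(LINT x|lebesgue_on U. f x) = (LINT x|lebesgue_on V. f x)"
  unfolding lebesgue_on_integral_eq[OF assms(1)] lebesgue_on_integral_eq[OF assms(2)]
  using assms(3,4) by (intro Bochner_Integration.integral_cong) (auto simp: indicator_def)

lemma lebesgue_on_finite:
  fixes U :: "'a::euclidean_space set"
  assumes "open U" "bounded U"
  shows "finite_measure (lebesgue_on U)"
proof (rule finite_measure_lebesgue_on)
  show "U \<in> lmeasurable" using assms by (simp add: lmeasurable_open)
qed

text \<open>Real functions square integrable on \<open>U\<close>.\<close>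

definition sq :: "'a::euclidean_space set \<Rightarrow> ('a \<Rightarrow> real) \<Rightarrow> bool" where
  "sq U f \<longleftrightarrow> f \<in> borel_measurable (lebesgue_on U) \<and> integrable (lebesgue_on U) (\<lambda>x. (f x)\<^sup>2)"

lemma sq_mult:
  assumes "sq U f" "sq U g"
  shows "integrable (lebesgue_on U) (\<lambda>x. f x * g x)"
proof (rule Bochner_Integration.integrable_bound)
  show "integrable (lebesgue_on U) (\<lambda>x. (f x)\<^sup>2 + (g x)\<^sup>2)" using assms by (auto simp: sq_def)
  show "(\<lambda>x. f x * g x) \<in> borel_measurable (lebesgue_on U)" using assms by (auto simp: sq_def)
  have "\<bar>a * b\<bar> \<le> a\<^sup>2 + b\<^sup>2" for a b :: real
    using sum_squares_bound[of "\<bar>a\<bar>" "\<bar>b\<bar>"] abs_mult[of a b] abs_ge_zero[of "a * b"]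
    by (simp only: power2_abs)
  then show "AE x in lebesgue_on U. norm (f x * g x) \<le> norm ((f x)\<^sup>2 + (g x)\<^sup>2)" by auto
qed

lemma sq_add: "sq U f \<Longrightarrow> sq U g \<Longrightarrow> sq U (\<lambda>x. f x + g x)"
  using sq_mult[of U f g] by (auto simp: sq_def power2_sum mult.assoc)

lemma sq_cmult: "sq U f \<Longrightarrow> sq U (\<lambda>x. c * f x)"
  by (auto simp: sq_def power_mult_distrib)

lemma sq_diff: "sq U f \<Longrightarrow> sq U g \<Longrightarrow> sq U (\<lambda>x. f x - g x)"
  using sq_add[of U f "\<lambda>x. - 1 * g x"] sq_cmult[of U g "-1"] by simp

lemma sq_continuous:
  assumes "open U" "bounded U" "continuous_on UNIV f"
  shows "sq U f"
  unfolding sq_def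
proof
  interpret finite_measure "lebesgue_on U" using assms lebesgue_on_finite by auto
  show m: "f \<in> borel_measurable (lebesgue_on U)"
    using assms continuous_imp_measurable_on_sets_lebesgue[of U f] continuous_on_subset by fastforce
  have "compact (f ` closure U)"
    using assms by (intro compact_continuous_image) (auto intro: continuous_on_subset)
  then obtain B where B: "\<And>x. x \<in> closure U \<Longrightarrow> norm (f x) \<le> B"
    by (metis bounded_iff compact_imp_bounded imageI)
  have "norm ((f x)\<^sup>2) \<le> B\<^sup>2" if "x \<in> U" for x
    using power_mono[OF B[of x], of 2] that closure_subset by auto
  then show "integrable (lebesgue_on U) (\<lambda>x. (f x)\<^sup>2)"
    using m by (intro integrable_const_bound[where B="B\<^sup>2"]) (auto intro!: AE_I2 simp: space_restrict_space)
qed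

lemma sq_const: "open U \<Longrightarrow> bounded U \<Longrightarrow> sq U (\<lambda>x. c)"
  by (intro sq_continuous) auto

lemma sq_integrable: "open U \<Longrightarrow> bounded U \<Longrightarrow> sq U f \<Longrightarrow> integrable (lebesgue_on U) f"
  using sq_mult[of U f "\<lambda>_. 1"] sq_const[of U 1] by simp

lemma sq_subset: "open U \<Longrightarrow> open V \<Longrightarrow> U \<subseteq> V \<Longrightarrow> sq V f \<Longrightarrow> sq U f"
  unfolding sq_def using lebesgue_on_integrable_subset lebesgue_on_measurable_subset by blast

lemma sq_cong_AE:
  assumes "open U" "AE x in lebesgue_on U. f x = g x" "sq U g"
  shows "sq U f"
proof -
  have m: "f \<in> borel_measurable (lebesgue_on U)"
    using lebesgue_on_AE_measurable[OF assms(1) _ assms(2)] assms(3) sq_def by auto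
  moreover have "integrable (lebesgue_on U) (\<lambda>x. (f x)\<^sup>2) \<longleftrightarrow> integrable (lebesgue_on U) (\<lambda>x. (g x)\<^sup>2)"
    using assms m by (intro integrable_cong_AE) (auto simp: sq_def)
  ultimately show ?thesis using assms(3) by (auto simp: sq_def)
qed

lemma L2_iff_sq:
  fixes \<omega> :: "(real ^ 'n::finite) \<Rightarrow> 'n covector"
  shows "\<omega> \<in> L2 U \<longleftrightarrow> (\<forall>\<alpha>. sq U (\<lambda>x. \<omega> x $ \<alpha>))"
proof
  assume L: "\<omega> \<in> L2 U"
  have m: "(\<lambda>x. \<omega> x $ \<alpha>) \<in> borel_measurable (lebesgue_on U)" for \<alpha>
    using L by (auto simp: L2_def intro!: measurable_compose[OF _ borel_measurable_nth])
  have "integrable (lebesgue_on U) (\<lambda>x. (\<omega> x $ \<alpha>)\<^sup>2)" for \<alpha>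
  proof (rule Bochner_Integration.integrable_bound)
    show "integrable (lebesgue_on U) (\<lambda>x. (norm (\<omega> x))\<^sup>2)" using L by (auto simp: L2_def)
    show "AE x in lebesgue_on U. norm ((\<omega> x $ \<alpha>)\<^sup>2) \<le> norm ((norm (\<omega> x))\<^sup>2)"
      using power_mono[OF component_le_norm_cart, of _ _ 2] by auto
  qed (use m in auto)
  then show "\<forall>\<alpha>. sq U (\<lambda>x. \<omega> x $ \<alpha>)" using m by (auto simp: sq_def)
next
  assume R: "\<forall>\<alpha>. sq U (\<lambda>x. \<omega> x $ \<alpha>)"
  have e: "(norm (\<omega> x))\<^sup>2 = (\<Sum>\<alpha>\<in>UNIV. (\<omega> x $ \<alpha>)\<^sup>2)" for x
    by (simp add: norm_vec_def L2_set_def sum_nonneg)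
  have "\<omega> \<in> borel_measurable (lebesgue_on U)"
    using R by (subst borel_measurable_euclidean_space) (auto simp: Basis_vec_def inner_axis sq_def)
  then show "\<omega> \<in> L2 U" using R by (auto simp: L2_def e sq_def)
qed

lemma L2_inner_eq_sum:
  assumes "\<omega> \<in> L2 U" "\<eta> \<in> L2 U"
  shows "L2_inner U \<omega> \<eta> = (\<Sum>\<alpha>\<in>UNIV. LINT x|lebesgue_on U. \<omega> x $ \<alpha> * \<eta> x $ \<alpha>)"
  unfolding L2_inner_def inner_vec_def inner_real_def using assms
  by (subst Bochner_Integration.integral_sum) (auto intro!: sq_mult simp: L2_iff_sq)


section \<open>Smooth bump functions\<close>

text \<open>\<open>m\<close> times differentiable functions on the real line.\<close>

primrec nsmooth :: "nat \<Rightarrow> (real \<Rightarrow> real) \<Rightarrow> bool" where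
  "nsmooth 0 f = True"
| "nsmooth (Suc m) f = (\<exists>f'. (\<forall>x. (f has_real_derivative f' x) (at x)) \<and> nsmooth m f')"

lemma nsmooth_SucD: "nsmooth (Suc m) f \<Longrightarrow> nsmooth m f"
proof (induction m arbitrary: f)
  case (Suc m)
  then show ?case unfolding nsmooth.simps(2)[of "Suc m"] nsmooth.simps(2)[of m f] by blast
qed simp

lemma nsmooth_const: "nsmooth m (\<lambda>x. c)"
proof (induction m arbitrary: c)
  case (Suc m)
  have "\<forall>x::real. ((\<lambda>x. c) has_real_derivative 0) (at x)" by simp
  then show ?case using Suc[of 0] unfolding nsmooth.simps
    by (intro exI[of _ "\<lambda>x. 0"] conjI)
qed simp

lemma nsmooth_add: "nsmooth m f \<Longrightarrow> nsmooth m g \<Longrightarrow> nsmooth m (\<lambda>x. f x + g x)"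
proof (induction m arbitrary: f g)
  case (Suc m)
  then obtain f' g' where
    "\<forall>x. (f has_real_derivative f' x) (at x)" "nsmooth m f'"
    "\<forall>x. (g has_real_derivative g' x) (at x)" "nsmooth m g'" by auto
  then show ?case using Suc.IH[of f' g'] by (auto intro!: exI[of _ "\<lambda>x. f' x + g' x"] DERIV_add)
qed simp

lemma nsmooth_mult: "nsmooth m f \<Longrightarrow> nsmooth m g \<Longrightarrow> nsmooth m (\<lambda>x. f x * g x)"
proof (induction m arbitrary: f g)
  case (Suc m)
  from Suc.prems obtain f' g' where d:
    "\<And>x. (f has_real_derivative f' x) (at x)" "nsmooth m f'"
    "\<And>x. (g has_real_derivative g' x) (at x)" "nsmooth m g'" by auto
  have "nsmooth m (\<lambda>x. f' x * g x)" "nsmooth m (\<lambda>x. g' x * f x)"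
    using Suc.IH d Suc.prems[THEN nsmooth_SucD] by auto
  then have "nsmooth m (\<lambda>x. f' x * g x + g' x * f x)" by (rule nsmooth_add)
  then show ?case using DERIV_mult[OF d(1) d(3)]
    by (auto intro!: exI[of _ "\<lambda>x. f' x * g x + g' x * f x"])
qed simp

lemma nsmooth_power: "nsmooth m f \<Longrightarrow> nsmooth m (\<lambda>x. f x ^ j)"
  by (induction j) (auto simp: nsmooth_const nsmooth_mult)

lemma nsmooth_affine: "nsmooth m f \<Longrightarrow> nsmooth m (\<lambda>x. f (a * x + b))"
proof (induction m arbitrary: f)
  case (Suc m)
  from Suc.prems obtain f' where d:
    "\<And>x. (f has_real_derivative f' x) (at x)" "nsmooth m f'" by auto
  have "nsmooth m (\<lambda>x. f' (a * x + b) * a)"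
    using nsmooth_mult[OF Suc.IH[OF d(2)] nsmooth_const] .
  moreover have "((\<lambda>x. f (a * x + b)) has_real_derivative f' (a * x + b) * a) (at x)" for x
    by (rule DERIV_chain2[OF d(1)]) (auto intro!: derivative_eq_intros)
  ultimately show ?case unfolding nsmooth.simps
    by (intro exI[of _ "\<lambda>x. f' (a * x + b) * a"] conjI allI)
qed simp

lemma poly_exp_tendsto: "((\<lambda>y. y ^ j * poly p y / exp y) \<longlongrightarrow> 0) (at_top :: real filter)"
proof (induction p arbitrary: j)
  case (pCons a p)
  have "((\<lambda>y. a * (y ^ j / exp y) + y ^ Suc j * poly p y / exp y) \<longlongrightarrow> a * 0 + 0) (at_top :: real filter)"
    by (intro tendsto_intros tendsto_power_div_exp_0 pCons.IH)
  then show ?case by (simp add: algebra_simps add_divide_distrib)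
qed simp

text \<open>The functions \<open>p(1/x) e\<^bsup>-1/x\<^esup>\<close>, extended by zero to \<open>x \<le> 0\<close>. The family is closed under
  differentiation, since with \<open>y = 1/x\<close> the derivative of \<open>p(y) e\<^bsup>-y\<^esup>\<close> is \<open>y\<^sup>2 (p(y) - p'(y)) e\<^bsup>-y\<^esup>\<close>.\<close>

definition flat :: "real poly \<Rightarrow> real \<Rightarrow> real" where
  "flat p x = (if x > 0 then poly p (1 / x) * exp (- (1 / x)) else 0)"

lemma flat_deriv: "(flat p has_real_derivative flat ([:0, 0, 1:] * (p - pderiv p)) x) (at x)"
proof -
  consider "x > 0" | "x < 0" | "x = 0" by linarith
  then show ?thesis
  proof cases
    case 1
    have "((\<lambda>x. poly p (1 / x) * exp (- (1 / x))) has_real_derivative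
            flat ([:0, 0, 1:] * (p - pderiv p)) x) (at x)"
      using 1 by (auto intro!: derivative_eq_intros DERIV_chain2[OF poly_DERIV]
          simp: flat_def field_simps power2_eq_square)
    then show ?thesis
      by (rule has_field_derivative_transform_within_open[of _ _ _ "{0<..}"]) (use 1 in \<open>auto simp: flat_def\<close>)
  next
    case 2
    have "((\<lambda>x. 0) has_real_derivative flat ([:0, 0, 1:] * (p - pderiv p)) x) (at x)"
      using 2 by (auto simp: flat_def)
    then show ?thesis
      by (rule has_field_derivative_transform_within_open[of _ _ _ "{..<0}"]) (use 2 in \<open>auto simp: flat_def\<close>)
  next
    case 3
    have l: "((\<lambda>h. flat p h / h) \<longlongrightarrow> 0) (at_left 0)"
      by (rule Lim_transform_eventually[OF tendsto_const])
         (auto simp: flat_def eventually_at_filter)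
    have "((\<lambda>y. flat p (inverse y) / inverse y) \<longlongrightarrow> 0) at_top"
    proof (rule Lim_transform_eventually[OF poly_exp_tendsto[of 1 p]])
      show "\<forall>\<^sub>F y in at_top. y ^ 1 * poly p y / exp y = flat p (inverse y) / inverse y"
        using eventually_gt_at_top[of 0]
        by eventually_elim (simp add: flat_def field_simps exp_minus)
    qed
    then have r: "((\<lambda>h. flat p h / h) \<longlongrightarrow> 0) (at_right 0)"
      by (simp add: filterlim_at_right_to_top)
    have "((\<lambda>h. flat p h / h) \<longlongrightarrow> 0) (at 0)" using filterlim_split_at[OF l r] .
    then show ?thesis using 3 by (simp add: DERIV_def flat_def)
  qed
qed

lemma nsmooth_flat: "nsmooth m (flat p)"
proof (induction m arbitrary: p)
  case (Suc m)
  then show ?case unfolding nsmooth.simps by (intro exI[of _ "flat ([:0, 0, 1:] * (p - pderiv p))"] conjI allI flat_deriv)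
qed simp

text \<open>Infinitely differentiable functions on the real line.\<close>

definition smooth1 :: "(real \<Rightarrow> real) \<Rightarrow> bool" where
  "smooth1 f \<longleftrightarrow> (\<forall>m. nsmooth m f)"

lemma smooth1_deriv:
  assumes "smooth1 f"
  shows "(f has_real_derivative deriv f x) (at x)" "smooth1 (deriv f)"
proof -
  have *: "\<exists>f'. (\<forall>x. (f has_real_derivative f' x) (at x)) \<and> nsmooth m f'" for m
    using assms[unfolded smooth1_def, rule_format, of "Suc m"] unfolding nsmooth.simps .
  show "(f has_real_derivative deriv f x) (at x)"
    using *[of 0] by (metis DERIV_imp_deriv)
  have "f' = deriv f" if "\<forall>x. (f has_real_derivative f' x) (at x)" for f'
    using that by (intro ext) (metis DERIV_imp_deriv)
  then have "nsmooth m (deriv f)" for m using *[of m] by auto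
  then show "smooth1 (deriv f)" by (simp add: smooth1_def)
qed

text \<open>For \<open>a < b\<close>: smooth functions supported in \<open>[a, b]\<close> that converge to the indicator of the open interval as
  \<open>m\<close> tends to infinity: the base \<open>1 - \<dots>\<close> lies in \<open>(0, 1)\<close> inside the interval and equals \<open>1\<close>
  outside of it.\<close>

definition bump :: "real \<Rightarrow> real \<Rightarrow> nat \<Rightarrow> real \<Rightarrow> real" where
  "bump a b m t = 1 - (1 - flat [:1:] (t - a) * flat [:1:] (b - t)) ^ m"

lemma smooth1_bump: "smooth1 (bump a b m)"
proof -
  have "nsmooth j (\<lambda>t. 1 + (-1) * (1 + (-1) * (flat [:1:] (1 * t + (-a)) * flat [:1:] (-1 * t + b))) ^ m)" for j
    by (intro nsmooth_add nsmooth_const nsmooth_mult nsmooth_power nsmooth_affine nsmooth_flat)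
  then show ?thesis by (simp add: bump_def[abs_def] smooth1_def)
qed

lemma flat1_bounds: "0 \<le> flat [:1:] t" "flat [:1:] t < 1" "0 < t \<Longrightarrow> 0 < flat [:1:] t" "t \<le> 0 \<Longrightarrow> flat [:1:] t = 0"
  by (auto simp: flat_def)

lemma bump_base: "0 \<le> 1 - flat [:1:] t * flat [:1:] s" "1 - flat [:1:] t * flat [:1:] s \<le> 1"
  using mult_le_one[of "flat [:1:] t" "flat [:1:] s"] flat1_bounds[of t] flat1_bounds[of s] by auto

lemma bump_zero: "t \<notin> {a<..<b} \<Longrightarrow> bump a b m t = 0"
  by (auto simp: bump_def flat_def not_less)

lemma bump_bounds: "0 \<le> bump a b m t" "bump a b m t \<le> 1"
  using bump_base[of "t - a" "b - t"] power_le_one[of "1 - flat [:1:] (t - a) * flat [:1:] (b - t)" m]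
    zero_le_power[of "1 - flat [:1:] (t - a) * flat [:1:] (b - t)" m]
  by (auto simp: bump_def)

lemma bump_tendsto:
  assumes "a < t" "t < b"
  shows "(\<lambda>m. bump a b m t) \<longlonglongrightarrow> 1"
proof -
  have "0 < flat [:1:] (t - a) * flat [:1:] (b - t)" using assms by (auto intro!: mult_pos_pos flat1_bounds)
  then have "(\<lambda>m. (1 - flat [:1:] (t - a) * flat [:1:] (b - t)) ^ m) \<longlonglongrightarrow> 0"
    using bump_base[of "t - a" "b - t"] by (intro LIMSEQ_realpow_zero) auto
  then have "(\<lambda>m. bump a b m t) \<longlonglongrightarrow> 1 - 0" unfolding bump_def
    by (rule tendsto_diff[OF tendsto_const])
  then show ?thesis by simp
qed


section \<open>Partial derivatives\<close>

lemma partial_derivI: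
  assumes "(f has_derivative D) (at x)"
  shows "partial_deriv i f x = D (axis i 1)"
  unfolding partial_deriv_def using frechet_derivative_at[OF assms] by metis

lemma has_partial_deriv_line:
  fixes f :: "real ^ 'n::finite \<Rightarrow> real"
  assumes "f differentiable at x"
  shows "((\<lambda>t. f (x + t *\<^sub>R axis i 1)) has_real_derivative partial_deriv i f x) (at 0)"
proof -
  let ?D = "frechet_derivative f (at x)"
  have D: "(f has_derivative ?D) (at x)" using assms frechet_derivative_works by blast
  have "((\<lambda>t. f (x + t *\<^sub>R axis i 1)) has_derivative (\<lambda>t. ?D (t *\<^sub>R axis i 1))) (at 0)"
  proof (rule has_derivative_compose[where f="\<lambda>t. x + t *\<^sub>R axis i 1"])
    show "((\<lambda>t. x + t *\<^sub>R axis i 1) has_derivative (\<lambda>t. t *\<^sub>R axis i 1)) (at 0)"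
      by (auto intro!: derivative_eq_intros)
    show "(f has_derivative ?D) (at (x + 0 *\<^sub>R axis i 1))" using D by simp
  qed
  moreover have "?D (t *\<^sub>R axis i 1) = ?D (axis i 1) * t" for t
    using linear_scale[OF has_derivative_linear[OF D]] by (simp add: mult.commute)
  ultimately show ?thesis
    by (simp add: has_field_derivative_def partial_deriv_def)
qed

text \<open>Differentiable functions on \<open>\<real>\<^sup>n\<close> with continuous partial derivatives.\<close>

definition C1 :: "(real ^ 'n::finite \<Rightarrow> real) \<Rightarrow> bool" where
  "C1 f \<longleftrightarrow> (\<forall>x. f differentiable at x) \<and> (\<forall>i. continuous_on UNIV (partial_deriv i f))"

lemma C1_continuous: "C1 f \<Longrightarrow> continuous_on UNIV f"
  by (auto simp: C1_def intro: differentiable_imp_continuous_on differentiable_at_imp_differentiable_on)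

lemma C1_continuous_partial: "C1 f \<Longrightarrow> continuous_on UNIV (partial_deriv i f)"
  by (auto simp: C1_def)

lemma partial_deriv_mult:
  assumes "f differentiable at x" "g differentiable at x"
  shows "partial_deriv i (\<lambda>x. f x * g x) x = partial_deriv i f x * g x + f x * partial_deriv i g x"
  by (subst partial_derivI[OF has_derivative_mult[OF assms[unfolded frechet_derivative_works]]])
     (simp add: partial_deriv_def)

lemma partial_deriv_add:
  assumes "f differentiable at x" "g differentiable at x"
  shows "partial_deriv i (\<lambda>x. f x + g x) x = partial_deriv i f x + partial_deriv i g x"
  by (subst partial_derivI[OF has_derivative_add[OF assms[unfolded frechet_derivative_works]]])
     (simp add: partial_deriv_def)

lemma partial_deriv_const: "partial_deriv i (\<lambda>x. c) x = 0"
  by (subst partial_derivI[OF has_derivative_const]) simp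

lemma C1_const: "C1 (\<lambda>x. c)"
  by (auto simp: C1_def partial_deriv_const)

lemma C1_mult: "C1 f \<Longrightarrow> C1 g \<Longrightarrow> C1 (\<lambda>x. f x * g x)"
  using C1_continuous[of f] C1_continuous[of g]
  by (auto simp: C1_def partial_deriv_mult intro!: continuous_intros)

lemma C1_add: "C1 f \<Longrightarrow> C1 g \<Longrightarrow> C1 (\<lambda>x. f x + g x)"
  by (auto simp: C1_def partial_deriv_add intro!: continuous_intros)

lemma prod_functions_derivative:
  fixes g g' :: "'n::finite \<Rightarrow> real \<Rightarrow> real"
  assumes "\<And>l t. (g l has_real_derivative g' l t) (at t)"
  shows "(\<lambda>x. \<Prod>l\<in>UNIV. g l (x $ l)) differentiable at (x :: real ^ 'n)"
    and "partial_deriv i (\<lambda>x. \<Prod>l\<in>UNIV. g l (x $ l)) x =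
      (\<Prod>l\<in>UNIV. (if l = i then g' l else g l) (x $ l))"
proof -
  have "((\<lambda>x. g l (x $ l)) has_derivative (\<lambda>h. g' l (x $ l) * h $ l)) (at x)" for l
  proof (rule has_derivative_compose[where f="\<lambda>x. x $ l" and f'="\<lambda>h. h $ l" and g="g l" and g'="(*) (g' l (x $ l))"])
    show "((\<lambda>x. x $ l) has_derivative (\<lambda>h. h $ l)) (at x)"
      by (simp add: bounded_linear_imp_has_derivative bounded_linear_vec_nth)
    show "(g l has_derivative (*) (g' l (x $ l))) (at (x $ l))"
      using assms[of l "x $ l"] by (simp add: has_field_derivative_def)
  qed
  then have D: "((\<lambda>x. \<Prod>l\<in>UNIV. g l (x $ l)) has_derivative
      (\<lambda>h. \<Sum>l\<in>UNIV. g' l (x $ l) * h $ l * (\<Prod>m\<in>UNIV - {l}. g m (x $ m)))) (at x)"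
    by (intro has_derivative_prod) auto
  then show "(\<lambda>x. \<Prod>l\<in>UNIV. g l (x $ l)) differentiable at x" by (rule differentiableI)
  have "partial_deriv i (\<lambda>x. \<Prod>l\<in>UNIV. g l (x $ l)) x =
      (\<Sum>l\<in>UNIV. if l = i then g' l (x $ l) * (\<Prod>m\<in>UNIV - {l}. g m (x $ m)) else 0)"
    unfolding partial_derivI[OF D] by (intro sum.cong) (auto simp: axis_def)
  also have "\<dots> = g' i (x $ i) * (\<Prod>m\<in>UNIV - {i}. g m (x $ m))" by simp
  also have "\<dots> = (\<Prod>l\<in>UNIV. (if l = i then g' l else g l) (x $ l))"
    by (subst prod.remove[of UNIV i]) auto
  finally show "partial_deriv i (\<lambda>x. \<Prod>l\<in>UNIV. g l (x $ l)) x =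
      (\<Prod>l\<in>UNIV. (if l = i then g' l else g l) (x $ l))" .
qed

lemma smooth_prod:
  fixes g :: "'n::finite \<Rightarrow> real \<Rightarrow> real"
  assumes "\<And>l. smooth1 (g l)"
  shows "smooth (\<lambda>x :: real ^ 'n. \<Prod>l\<in>UNIV. g l (x $ l))"
proof -
  have "\<exists>h. (\<forall>l. smooth1 (h l)) \<and> foldr partial_deriv is (\<lambda>x :: real ^ 'n. \<Prod>l\<in>UNIV. g l (x $ l)) =
      (\<lambda>x. \<Prod>l\<in>UNIV. h l (x $ l))" for "is"
  proof (induction "is")
    case (Cons i "is")
    then obtain h where h: "\<And>l. smooth1 (h l)"
      and e: "foldr partial_deriv is (\<lambda>x :: real ^ 'n. \<Prod>l\<in>UNIV. g l (x $ l)) = (\<lambda>x. \<Prod>l\<in>UNIV. h l (x $ l))"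
      by blast
    have "partial_deriv i (\<lambda>x :: real ^ 'n. \<Prod>l\<in>UNIV. h l (x $ l)) =
        (\<lambda>x. \<Prod>l\<in>UNIV. (if l = i then deriv (h l) else h l) (x $ l))"
      using prod_functions_derivative(2)[of h "\<lambda>l. deriv (h l)"] smooth1_deriv(1)[OF h] by (auto simp: fun_eq_iff)
    then show ?case using h smooth1_deriv(2)
      by (intro exI[of _ "\<lambda>l. if l = i then deriv (h l) else h l"]) (simp add: e)
  qed (use assms in auto)
  moreover have "(\<lambda>x :: real ^ 'n. \<Prod>l\<in>UNIV. h l (x $ l)) differentiable_on UNIV" if "\<And>l. smooth1 (h l)" for h
    using prod_functions_derivative(1)[of h "\<lambda>l. deriv (h l)"] smooth1_deriv(1)[OF that]
    by (intro differentiable_at_imp_differentiable_on) auto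
  ultimately show ?thesis unfolding smooth_def by metis
qed

lemma smooth_C1:
  assumes "smooth f" shows "C1 f"
proof -
  have "f differentiable_on UNIV" using assms[unfolded smooth_def, rule_format, of "[]"] by simp
  moreover have "partial_deriv i f differentiable_on UNIV" for i
    using assms[unfolded smooth_def, rule_format, of "[i]"] by simp
  ultimately show ?thesis
    by (auto simp: C1_def differentiable_on_def intro!: differentiable_imp_continuous_on)
qed

lemma test_C1: "\<phi> \<in> test_functions U \<Longrightarrow> C1 \<phi>"
  by (simp add: test_functions_def smooth_C1)

lemma test_zero: "\<phi> \<in> test_functions U \<Longrightarrow> x \<notin> U \<Longrightarrow> \<phi> x = 0"
  using closure_subset[of "{x. \<phi> x \<noteq> 0}"] by (auto simp: test_functions_def)

lemma test_partial_zero: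
  assumes "\<phi> \<in> test_functions U" "x \<notin> U"
  shows "partial_deriv i \<phi> x = 0"
proof -
  let ?S = "- closure {x. \<phi> x \<noteq> 0}"
  have "(\<phi> has_derivative (\<lambda>_. 0)) (at x)"
  proof (rule has_derivative_transform_within_open[of "\<lambda>_. 0"])
    show "open ?S" by auto
    show "x \<in> ?S" using assms by (auto simp: test_functions_def)
    show "\<And>y. y \<in> ?S \<Longrightarrow> 0 = \<phi> y" using closure_subset[of "{x. \<phi> x \<noteq> 0}"] by auto
  qed simp
  then show ?thesis by (rule partial_derivI)
qed

lemma test_functions_mono: "U \<subseteq> V \<Longrightarrow> test_functions U \<subseteq> test_functions V"
  by (auto simp: test_functions_def)


section \<open>The fundamental lemma and integration by parts\<close>

text \<open>Test functions converging to the indicator of an open box.\<close>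

definition box_bump :: "real ^ 'n \<Rightarrow> real ^ 'n \<Rightarrow> nat \<Rightarrow> real ^ 'n::finite \<Rightarrow> real" where
  "box_bump a b m x = (\<Prod>l\<in>UNIV. bump (a $ l) (b $ l) m (x $ l))"

lemma box_bump_zero: "x \<notin> box a b \<Longrightarrow> box_bump a b m x = 0"
  by (auto simp: box_bump_def mem_box_cart intro!: bump_zero)

lemma box_bump_bounds: "0 \<le> box_bump a b m x" "box_bump a b m x \<le> 1"
  by (auto simp: box_bump_def intro!: prod_nonneg prod_le_1 bump_bounds)

lemma box_bump_tendsto:
  fixes x :: "real ^ 'n::finite"
  shows "(\<lambda>m. box_bump a b m x) \<longlonglongrightarrow> indicator (box a b) x"
proof (cases "x \<in> box a b")
  case True
  then have "(\<lambda>m. \<Prod>l\<in>UNIV. bump (a $ l) (b $ l) m (x $ l)) \<longlonglongrightarrow> (\<Prod>l\<in>(UNIV :: 'n set). 1)"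
    by (intro tendsto_prod bump_tendsto) (auto simp: mem_box_cart)
  then show ?thesis using True by (simp add: box_bump_def[abs_def])
qed (simp add: box_bump_zero)

lemma box_bump_test:
  assumes "cbox a b \<subseteq> U"
  shows "box_bump a b m \<in> test_functions U"
proof -
  have "closure {x. box_bump a b m x \<noteq> 0} \<subseteq> cbox a b"
    using box_bump_zero box_subset_cbox by (intro closure_minimal closed_cbox) blast
  moreover have "compact (closure {x. box_bump a b m x \<noteq> 0})"
    using calculation by (meson bounded_cbox bounded_subset closed_closure compact_eq_bounded_closed)
  moreover have "smooth (box_bump a b m)"
    unfolding box_bump_def[abs_def] by (rule smooth_prod[OF smooth1_bump])
  ultimately show ?thesis using assms by (auto simp: test_functions_def)
qed

text \<open>The fundamental lemma of the calculus of variations. Testing with bump functions shows that the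
  integral over every box in \<open>U\<close> vanishes; Lebesgue differentiation along small cubes concludes.\<close>

lemma fundamental_lemma:
  fixes f :: "real ^ 'n::finite \<Rightarrow> real"
  assumes U: "open U" and f: "integrable (lebesgue_on U) f"
    and z: "\<And>\<phi>. \<phi> \<in> test_functions U \<Longrightarrow> (LINT x|lebesgue_on U. f x * \<phi> x) = 0"
  shows "AE x in lebesgue_on U. f x = 0"
proof -
  \<comment> \<open>extension by zero to the whole space\<close>
  define F where "F = (\<lambda>x. indicator U x * f x)"
  have F: "integrable lebesgue F"
    using f U by (simp add: F_def integrable_restrict_space)
  have box0: "(LINT x|lebesgue. indicator (box a b) x * F x) = 0" if ab: "cbox a b \<subseteq> U" for a b
  proof -
    have "(\<lambda>m. LINT x|lebesgue. box_bump a b m x * F x) \<longlonglongrightarrow> (LINT x|lebesgue. indicator (box a b) x * F x)"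
    proof (rule integral_dominated_convergence[where w="\<lambda>x. norm (F x)"])
      show "integrable lebesgue (\<lambda>x. norm (F x))" using F by simp
      have c: "continuous_on UNIV (box_bump a b m)" for m
        using C1_continuous[OF test_C1[OF box_bump_test[OF ab]]] .
      show "(\<lambda>x. box_bump a b m x * F x) \<in> borel_measurable lebesgue" for m
        using F borel_measurable_continuous_onI[OF c[of m]]
        by (intro borel_measurable_times) (auto intro: measurable_completion)
      show "(\<lambda>x. indicator (box a b) x * F x) \<in> borel_measurable lebesgue"
        using F by (intro borel_measurable_times borel_measurable_indicator) auto
      show "AE x in lebesgue. (\<lambda>m. box_bump a b m x * F x) \<longlonglongrightarrow> indicator (box a b) x * F x"
        by (intro AE_I2 tendsto_mult box_bump_tendsto tendsto_const)
      show "AE x in lebesgue. norm (box_bump a b m x * F x) \<le> norm (F x)" for m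
        using box_bump_bounds[of a b m] by (auto simp: abs_mult intro!: mult_left_le_one_le)
    qed
    moreover have "(LINT x|lebesgue. box_bump a b m x * F x) = 0" for m
      using z[OF box_bump_test[OF ab], of m]
      by (simp add: lebesgue_on_integral_eq[OF U] F_def mult_ac)
    ultimately show ?thesis by (simp add: LIMSEQ_const_iff)
  qed
  have cube0: "integral (cbox a b) F = 0" if "cbox a b \<subseteq> U" for a b
  proof -
    have "set_integrable lebesgue (box a b) F"
      using integrable_mult_indicator[OF _ F, of "box a b"] by (simp add: set_integrable_def)
    from set_lebesgue_integral_eq_integral(2)[OF this]
    have "integral (box a b) F = 0" using box0[OF that] by (simp add: set_lebesgue_integral_def)
    then show ?thesis by (simp add: integral_open_interval)
  qed
  have "F integrable_on cbox a b" for a b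
    using F integrable_on_lebesgue integrable_on_subcbox by blast
  then obtain N where N: "negligible N" and lim: "\<And>x e. \<lbrakk>x \<notin> N; 0 < e\<rbrakk> \<Longrightarrow>
      \<exists>d>0. \<forall>h. 0 < h \<and> h < d \<longrightarrow> norm (integral (cbox x (x + h *\<^sub>R One)) F /\<^sub>R h ^ DIM(real ^ 'n) - F x) < e"
    using integrable_ccontinuous_explicit[of F] by metis
  have "F x = 0" if x: "x \<in> U" "x \<notin> N" for x
  proof (rule ccontr)
    assume "F x \<noteq> 0"
    then obtain d where d: "d > 0" and "\<And>h. 0 < h \<Longrightarrow> h < d \<Longrightarrow>
        norm (integral (cbox x (x + h *\<^sub>R One)) F /\<^sub>R h ^ DIM(real ^ 'n) - F x) < norm (F x)"
      using lim[OF x(2), of "norm (F x)"] by auto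
    obtain e where e: "e > 0" "cball x e \<subseteq> U" using U x open_contains_cball by blast
    have ev: "((\<lambda>h. x + h *\<^sub>R (One :: real ^ 'n)) \<longlongrightarrow> x + 0 *\<^sub>R One) (at_right 0)"
      by (intro tendsto_intros)
    then have "eventually (\<lambda>h. dist (x + h *\<^sub>R (One :: real ^ 'n)) x < e) (at_right 0)"
      using tendstoD[OF ev e(1)] by simp
    moreover have "eventually (\<lambda>h. h \<in> {0<..<d}) (at_right 0)"
      using d by (auto simp: eventually_at_right_field)
    ultimately have "eventually (\<lambda>h. dist (x + h *\<^sub>R (One :: real ^ 'n)) x < e \<and> h \<in> {0<..<d}) (at_right 0)"
      by eventually_elim auto
    then obtain h where h: "dist (x + h *\<^sub>R (One :: real ^ 'n)) x < e" "0 < h" "h < d"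
      using eventually_happens[of _ "at_right (0::real)"] by auto
    have "cbox x (x + h *\<^sub>R One) \<subseteq> cball x e"
    proof
      fix y assume y: "y \<in> cbox x (x + h *\<^sub>R One)"
      have "norm (y - x) \<le> norm (h *\<^sub>R (One :: real ^ 'n))"
        using y h(2) by (intro norm_le_componentwise) (auto simp: mem_box inner_diff_left inner_add_left)
      then show "y \<in> cball x e" using h(1) by (simp add: dist_norm norm_minus_commute)
    qed
    then have "integral (cbox x (x + h *\<^sub>R One)) F = 0" using e cube0 by blast
    then show False using \<open>\<And>h. 0 < h \<Longrightarrow> h < d \<Longrightarrow> _\<close>[OF h(2,3)] by simp
  qed
  then have "AE x in lebesgue. x \<in> U \<longrightarrow> F x = 0"
    using N by (intro AE_I'[of N]) (auto simp: negligible_iff_null_sets)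
  then show ?thesis unfolding lebesgue_on_AE_iff[OF U]
    by (auto simp: F_def elim!: eventually_mono)
qed

lemma integral_translation_lborel:
  fixes f :: "'a::euclidean_space \<Rightarrow> real"
  assumes "f \<in> borel_measurable borel"
  shows "(LINT x|lborel. f (x + c)) = (LINT x|lborel. f x)"
proof -
  have "(LINT x|lborel. f x) = (LINT x|distr lborel borel ((+) c). f x)" by (simp add: lborel_distr_plus)
  also have "\<dots> = (LINT x|lborel. f (c + x))" using assms by (subst integral_distr) auto
  finally show ?thesis by (simp add: add.commute)
qed

text \<open>The integral of a difference quotient vanishes by translation invariance; dominated convergence
  carries this over to the derivative.\<close>

lemma integral_partial_deriv_zero:
  fixes \<psi> :: "real ^ 'n::finite \<Rightarrow> real"
  assumes C: "C1 \<psi>" and S: "compact S" and zero: "\<And>x. x \<notin> S \<Longrightarrow> \<psi> x = 0"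
  shows "(LINT x|lebesgue. partial_deriv i \<psi> x) = 0"
proof -
  let ?h = "partial_deriv i \<psi>" and ?e = "axis i 1 :: real ^ 'n"
  obtain R where R: "\<And>x. x \<in> S \<Longrightarrow> norm x \<le> R"
    using S by (meson bounded_iff compact_imp_bounded)
  have "compact (?h ` cball 0 (R + 2))"
    using C1_continuous_partial[OF C] by (intro compact_continuous_image) (auto intro: continuous_on_subset)
  then obtain B where B: "\<And>x. norm x \<le> R + 2 \<Longrightarrow> \<bar>?h x\<bar> \<le> B"
    by (metis bounded_iff compact_imp_bounded imageI mem_cball_0 real_norm_def)
  have m\<psi>: "\<psi> \<in> borel_measurable borel"
    using C1_continuous[OF C] by (rule borel_measurable_continuous_onI)
  have mh: "?h \<in> borel_measurable borel"
    using C1_continuous_partial[OF C] by (rule borel_measurable_continuous_onI)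
  have i\<psi>: "integrable lborel \<psi>"
  proof -
    have "integrable lborel (\<lambda>x. indicator S x *\<^sub>R \<psi> x)"
      by (rule borel_integrable_compact[OF S]) (use C1_continuous[OF C] continuous_on_subset in blast)
    moreover have "(\<lambda>x. indicator S x *\<^sub>R \<psi> x) = \<psi>" using zero by (auto simp: fun_eq_iff indicator_def)
    ultimately show ?thesis by simp
  qed
  have line: "((\<lambda>t. \<psi> (x + t *\<^sub>R ?e)) has_real_derivative ?h (x + s *\<^sub>R ?e)) (at s)" for x s
  proof -
    have "((\<lambda>t. \<psi> ((x + s *\<^sub>R ?e) + t *\<^sub>R ?e)) has_real_derivative ?h (x + s *\<^sub>R ?e)) (at 0)"
      using C by (intro has_partial_deriv_line) (auto simp: C1_def)
    then have "((\<lambda>t. \<psi> (x + (s + t) *\<^sub>R ?e)) has_real_derivative ?h (x + s *\<^sub>R ?e)) (at 0)"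
      by (simp add: algebra_simps)
    then show ?thesis
      using DERIV_shift[of "\<lambda>t. \<psi> (x + t *\<^sub>R ?e)" "?h (x + s *\<^sub>R ?e)" 0 s] by (simp add: add.commute)
  qed
  \<comment> \<open>step sizes of the difference quotients \<open>q m\<close>\<close>
  define t where "t m = inverse (real (Suc m))" for m
  have t: "0 < t m" "t m \<le> 1" for m by (auto simp: t_def divide_simps)
  define q where "q m x = (\<psi> (x + t m *\<^sub>R ?e) - \<psi> x) / t m" for m x
  have q0: "(LINT x|lborel. q m x) = 0" for m
  proof -
    have "integrable lborel (\<lambda>x. \<psi> (x + t m *\<^sub>R ?e))"
      using i\<psi> m\<psi> integrable_distr_eq[of "(+) (t m *\<^sub>R ?e)" lborel borel \<psi>]
      by (simp add: lborel_distr_plus add.commute)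
    then show ?thesis
      unfolding q_def using i\<psi> integral_translation_lborel[OF m\<psi>, of "t m *\<^sub>R ?e"] by simp
  qed
  have "(\<lambda>m. LINT x|lborel. q m x) \<longlonglongrightarrow> (LINT x|lborel. ?h x)"
  proof (rule integral_dominated_convergence[where w="\<lambda>x. B * indicator (cball 0 (R + 1)) x"])
    show "integrable lborel (\<lambda>x::real ^ 'n. B * indicator (cball 0 (R + 1)) x)"
      using emeasure_bounded_finite[of "cball (0 :: real ^ 'n) (R + 1)"]
      by (intro integrable_mult_right integrable_real_indicator) auto
    show "?h \<in> borel_measurable lborel" using mh by simp
    show "q m \<in> borel_measurable lborel" for m unfolding q_def using m\<psi> by measurable
    show "AE x in lborel. (\<lambda>m. q m x) \<longlonglongrightarrow> ?h x"
    proof (rule AE_I2)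
      fix x
      have "((\<lambda>s. (\<psi> (x + s *\<^sub>R ?e) - \<psi> x) / s) \<longlongrightarrow> ?h x) (at 0)"
        using line[of x 0] by (simp add: DERIV_def)
      moreover have "filterlim t (at 0) sequentially"
        unfolding filterlim_at using LIMSEQ_inverse_real_of_nat by (auto simp: t_def[abs_def])
      ultimately show "(\<lambda>m. q m x) \<longlonglongrightarrow> ?h x"
        unfolding q_def by (rule filterlim_compose)
    qed
    show "AE x in lborel. norm (q m x) \<le> B * indicator (cball 0 (R + 1)) x" for m
    proof (rule AE_I2)
      fix x
      show "norm (q m x) \<le> B * indicator (cball 0 (R + 1)) x"
      proof (cases "norm x \<le> R + 1")
        case True
        obtain z where z: "0 < z" "z < t m"
          "\<psi> (x + t m *\<^sub>R ?e) - \<psi> (x + 0 *\<^sub>R ?e) = (t m - 0) * ?h (x + z *\<^sub>R ?e)"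
          using MVT2[of 0 "t m" "\<lambda>t. \<psi> (x + t *\<^sub>R ?e)" "\<lambda>s. ?h (x + s *\<^sub>R ?e)"] line[of x] t[of m] by blast
        have "norm (x + z *\<^sub>R ?e) \<le> norm x + norm (z *\<^sub>R ?e)" by (rule norm_triangle_ineq)
        then have "norm (x + z *\<^sub>R ?e) \<le> R + 2" using z t[of m] True by simp
        then have "\<bar>?h (x + z *\<^sub>R ?e)\<bar> \<le> B" by (rule B)
        moreover have "q m x = ?h (x + z *\<^sub>R ?e)" using z t[of m] by (simp add: q_def)
        ultimately show ?thesis using True by (simp add: indicator_def)
      next
        case False
        have "norm (x + t m *\<^sub>R ?e) \<ge> norm x - norm (t m *\<^sub>R ?e)" by (rule norm_diff_ineq)
        then have "norm (x + t m *\<^sub>R ?e) > R" using False t[of m] by simp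
        moreover have "norm x > R" using False by simp
        ultimately have "x + t m *\<^sub>R ?e \<notin> S" "x \<notin> S"
          using R[of x] R[of "x + t m *\<^sub>R ?e"] by linarith+
        then show ?thesis using False by (simp add: q_def zero)
      qed
    qed
  qed
  then have "(LINT x|lborel. ?h x) = 0" unfolding q0 by (simp add: LIMSEQ_const_iff)
  then show ?thesis using mh by (simp add: integral_completion)
qed

lemma integration_by_parts:
  fixes f :: "real ^ 'n::finite \<Rightarrow> real"
  assumes U: "open U" and f: "C1 f" and \<phi>: "\<phi> \<in> test_functions U"
  shows "(LINT x|lebesgue_on U. partial_deriv i f x * \<phi> x) =
    - (LINT x|lebesgue_on U. f x * partial_deriv i \<phi> x)"
proof -
  obtain S where S: "compact S" and \<phi>S: "\<phi> \<in> test_functions S"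
    using \<phi> unfolding test_functions_def by blast
  have c: "continuous_on UNIV f" "continuous_on UNIV (partial_deriv i f)"
    "continuous_on UNIV \<phi>" "continuous_on UNIV (partial_deriv i \<phi>)"
    using f test_C1[OF \<phi>] C1_continuous C1_continuous_partial by auto
  have int: "integrable lebesgue g" if "continuous_on UNIV g" "\<And>x. x \<notin> S \<Longrightarrow> g x = 0" for g :: "real ^ 'n \<Rightarrow> real"
  proof -
    have "integrable lborel (\<lambda>x. indicator S x *\<^sub>R g x)"
      by (rule borel_integrable_compact[OF S]) (use that(1) continuous_on_subset in blast)
    moreover have "(\<lambda>x. indicator S x *\<^sub>R g x) = g" using that(2) by (auto simp: fun_eq_iff indicator_def)
    ultimately show ?thesis by (simp add: integrable_completion borel_measurable_integrable)
  qed
  have "(LINT x|lebesgue. partial_deriv i (\<lambda>x. f x * \<phi> x) x) = 0"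
    by (rule integral_partial_deriv_zero[OF C1_mult[OF f test_C1[OF \<phi>]] S]) (simp add: test_zero[OF \<phi>S])
  moreover have "partial_deriv i (\<lambda>x. f x * \<phi> x) x = partial_deriv i f x * \<phi> x + f x * partial_deriv i \<phi> x" for x
    using f test_C1[OF \<phi>] by (intro partial_deriv_mult) (auto simp: C1_def)
  moreover have "integrable lebesgue (\<lambda>x. partial_deriv i f x * \<phi> x)" "integrable lebesgue (\<lambda>x. f x * partial_deriv i \<phi> x)"
    using c by (auto intro!: int continuous_intros simp: test_zero[OF \<phi>S] test_partial_zero[OF \<phi>S])
  ultimately have "(LINT x|lebesgue. partial_deriv i f x * \<phi> x) = - (LINT x|lebesgue. f x * partial_deriv i \<phi> x)"
    by simp
  then show ?thesis
    using lebesgue_on_integral_zero_outside[OF U open_UNIV, of "\<lambda>x. partial_deriv i f x * \<phi> x"]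
      lebesgue_on_integral_zero_outside[OF U open_UNIV, of "\<lambda>x. f x * partial_deriv i \<phi> x"]
    by (simp add: test_zero[OF \<phi>] test_partial_zero[OF \<phi>] lebesgue_on_UNIV_eq)
qed


section \<open>The Hilbert space of square integrable forms\<close>

lemma L2_comp: "\<omega> \<in> L2 U \<Longrightarrow> sq U (\<lambda>x. \<omega> x $ \<alpha>)"
  by (simp add: L2_iff_sq)

lemma L2_diff: "\<omega> \<in> L2 U \<Longrightarrow> \<eta> \<in> L2 U \<Longrightarrow> (\<lambda>x. \<omega> x - \<eta> x) \<in> L2 U"
  by (simp add: L2_iff_sq sq_diff)

lemma L2_subset: "open U \<Longrightarrow> open V \<Longrightarrow> U \<subseteq> V \<Longrightarrow> \<omega> \<in> L2 V \<Longrightarrow> \<omega> \<in> L2 U"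
  by (auto simp: L2_iff_sq intro: sq_subset)

lemma L2_cong_AE:
  "open U \<Longrightarrow> AE x in lebesgue_on U. \<omega> x = \<eta> x \<Longrightarrow> \<eta> \<in> L2 U \<Longrightarrow> \<omega> \<in> L2 U"
proof -
  assume a: "open U" "AE x in lebesgue_on U. \<omega> x = \<eta> x" "\<eta> \<in> L2 U"
  have "AE x in lebesgue_on U. \<omega> x $ \<alpha> = \<eta> x $ \<alpha>" for \<alpha> using a(2) by eventually_elim simp
  then have "sq U (\<lambda>x. \<omega> x $ \<alpha>)" for \<alpha> by (rule sq_cong_AE[OF a(1) _ L2_comp[OF a(3)]])
  then show ?thesis by (simp add: L2_iff_sq)
qed

lemma L2_continuous:
  "open U \<Longrightarrow> bounded U \<Longrightarrow> (\<And>\<alpha>. continuous_on UNIV (\<lambda>x. \<omega> x $ \<alpha>)) \<Longrightarrow> \<omega> \<in> L2 U"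
  by (simp add: L2_iff_sq sq_continuous)

lemma L2_inner_integrable:
  assumes "\<omega> \<in> L2 U" "\<eta> \<in> L2 U"
  shows "integrable (lebesgue_on U) (\<lambda>x. \<omega> x \<bullet> \<eta> x)"
  unfolding inner_vec_def inner_real_def using assms
  by (intro Bochner_Integration.integrable_sum sq_mult L2_comp)

lemma L2_measurable: "\<omega> \<in> L2 U \<Longrightarrow> \<omega> \<in> borel_measurable (lebesgue_on U)"
  by (simp add: L2_def)

lemma L2_inner_cong_AE:
  assumes "\<omega> \<in> L2 U" "\<eta> \<in> L2 U" "\<omega>' \<in> L2 U" "\<eta>' \<in> L2 U"
    and "AE x in lebesgue_on U. \<omega> x = \<omega>' x" "AE x in lebesgue_on U. \<eta> x = \<eta>' x"
  shows "L2_inner U \<omega> \<eta> = L2_inner U \<omega>' \<eta>'"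
  unfolding L2_inner_def
proof (rule integral_cong_AE)
  show "AE x in lebesgue_on U. \<omega> x \<bullet> \<eta> x = \<omega>' x \<bullet> \<eta>' x" using assms(5,6) by eventually_elim simp
qed (use assms(1-4) L2_measurable in \<open>auto intro!: borel_measurable_inner\<close>)

lemma L2_inner_diff_left:
  "\<omega> \<in> L2 U \<Longrightarrow> \<omega>' \<in> L2 U \<Longrightarrow> \<eta> \<in> L2 U \<Longrightarrow>
    L2_inner U (\<lambda>x. \<omega> x - \<omega>' x) \<eta> = L2_inner U \<omega> \<eta> - L2_inner U \<omega>' \<eta>"
  unfolding L2_inner_def inner_diff_left by (intro Bochner_Integration.integral_diff L2_inner_integrable)

lemma L2_inner_diff_right:
  "\<omega> \<in> L2 U \<Longrightarrow> \<omega>' \<in> L2 U \<Longrightarrow> \<eta> \<in> L2 U \<Longrightarrow>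
    L2_inner U \<eta> (\<lambda>x. \<omega> x - \<omega>' x) = L2_inner U \<eta> \<omega> - L2_inner U \<eta> \<omega>'"
  unfolding L2_inner_def inner_diff_right by (intro Bochner_Integration.integral_diff L2_inner_integrable)

lemma L2_inner_nonneg: "0 \<le> L2_inner U \<omega> \<omega>"
  by (simp add: L2_inner_def)

lemma L2_norm_sq: "(L2_norm U \<omega>)\<^sup>2 = L2_inner U \<omega> \<omega>"
  by (simp add: L2_norm_def L2_inner_nonneg)

text \<open>This and the next lemma replace the triangle and Cauchy--Schwarz inequalities; sharp constants play
  no role.\<close>

lemma L2_inner_diff_le:
  assumes "\<omega> \<in> L2 U" "\<eta> \<in> L2 U"
  shows "L2_inner U (\<lambda>x. \<omega> x - \<eta> x) (\<lambda>x. \<omega> x - \<eta> x) \<le> 2 * L2_inner U \<omega> \<omega> + 2 * L2_inner U \<eta> \<eta>"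
proof -
  have "(a - b) \<bullet> (a - b) \<le> 2 * (a \<bullet> a) + 2 * (b \<bullet> b)" for a b :: "'a covector"
    using inner_ge_zero[of "a + b"] by (simp add: inner_simps inner_commute)
  then have "L2_inner U (\<lambda>x. \<omega> x - \<eta> x) (\<lambda>x. \<omega> x - \<eta> x) \<le>
      (LINT x|lebesgue_on U. 2 * (\<omega> x \<bullet> \<omega> x) + 2 * (\<eta> x \<bullet> \<eta> x))"
    unfolding L2_inner_def using assms L2_diff[OF assms]
    by (intro Bochner_Integration.integral_mono Bochner_Integration.integrable_add
        integrable_mult_right L2_inner_integrable) auto
  also have "\<dots> = 2 * L2_inner U \<omega> \<omega> + 2 * L2_inner U \<eta> \<eta>"
    unfolding L2_inner_def using assms
    by (subst Bochner_Integration.integral_add) (auto intro!: L2_inner_integrable)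
  finally show ?thesis .
qed

lemma L2_inner_young:
  assumes "\<omega> \<in> L2 U" "\<eta> \<in> L2 U" "s > 0"
  shows "\<bar>L2_inner U \<omega> \<eta>\<bar> \<le> s * L2_inner U \<omega> \<omega> + L2_inner U \<eta> \<eta> / s"
proof -
  have "\<bar>a \<bullet> b\<bar> \<le> s * (a \<bullet> a) + (b \<bullet> b) / s" for a b :: "'a covector"
  proof -
    have "0 \<le> (s *\<^sub>R a - b) \<bullet> (s *\<^sub>R a - b)" "0 \<le> (s *\<^sub>R a + b) \<bullet> (s *\<^sub>R a + b)"
      by (rule inner_ge_zero)+
    then have "2 * s * \<bar>a \<bullet> b\<bar> \<le> s * s * (a \<bullet> a) + b \<bullet> b"
      by (auto simp: inner_simps inner_commute abs_if algebra_simps)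
    moreover have "0 \<le> s * s * (a \<bullet> a) + b \<bullet> b" by simp
    ultimately have "s * \<bar>a \<bullet> b\<bar> \<le> s * s * (a \<bullet> a) + b \<bullet> b" by linarith
    then show ?thesis using assms(3) by (simp add: field_simps)
  qed
  then have "(LINT x|lebesgue_on U. \<bar>\<omega> x \<bullet> \<eta> x\<bar>) \<le> (LINT x|lebesgue_on U. s * (\<omega> x \<bullet> \<omega> x) + (\<eta> x \<bullet> \<eta> x) / s)"
    using assms by (intro Bochner_Integration.integral_mono Bochner_Integration.integrable_add
        integrable_mult_right integrable_divide integrable_abs L2_inner_integrable) auto
  also have "\<dots> = s * L2_inner U \<omega> \<omega> + L2_inner U \<eta> \<eta> / s"
    unfolding L2_inner_def using assms
    by (subst Bochner_Integration.integral_add) (auto intro!: L2_inner_integrable)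
  finally show ?thesis
    using integral_abs_bound[of "lebesgue_on U" "\<lambda>x. \<omega> x \<bullet> \<eta> x"] unfolding L2_inner_def by linarith
qed


section \<open>First order operators with constant coefficients in the weak sense\<close>

text \<open>The exterior derivative and the codifferential are both operators of the form
  \<open>(A \<omega>)\<^sub>\<beta> = \<Sum>\<^sub>\<alpha> \<Sum>\<^sub>i c \<beta> i \<alpha> \<partial>\<^sub>i \<omega>\<^sub>\<alpha>\<close>. The formal adjoint of such an operator is obtained by
  transposing the coefficients and changing their sign.

  \<open>weak_op c U \<omega> \<eta>\<close> states \<open>A \<omega> = \<eta>\<close> on \<open>U\<close> in the sense of distributions, for locally integrable
  \<open>\<omega>\<close> and \<open>\<eta>\<close>; \<open>classical_op c\<close> is \<open>A\<close> on differentiable forms.\<close>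

type_synonym 'n coeffs = "'n set \<Rightarrow> 'n \<Rightarrow> 'n set \<Rightarrow> real"

definition weak_op :: "('n::finite) coeffs \<Rightarrow> (real ^ 'n) set \<Rightarrow> 'n form \<Rightarrow> 'n form \<Rightarrow> bool" where
  "weak_op c U \<omega> \<eta> \<longleftrightarrow> (\<forall>\<phi>\<in>test_functions U. \<forall>\<beta>.
     (LINT x|lebesgue_on U. \<eta> x $ \<beta> * \<phi> x) =
     - (\<Sum>\<alpha>\<in>UNIV. \<Sum>i\<in>UNIV. c \<beta> i \<alpha> * (LINT x|lebesgue_on U. \<omega> x $ \<alpha> * partial_deriv i \<phi> x)))"

definition classical_op :: "('n::finite) coeffs \<Rightarrow> 'n form \<Rightarrow> 'n form" where
  "classical_op c \<omega> x = (\<chi> \<beta>. \<Sum>\<alpha>\<in>UNIV. \<Sum>i\<in>UNIV. c \<beta> i \<alpha> * partial_deriv i (\<lambda>x. \<omega> x $ \<alpha>) x)"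

definition adj :: "('n::finite) coeffs \<Rightarrow> 'n coeffs" where
  "adj c \<alpha> i \<beta> = - c \<beta> i \<alpha>"

text \<open>Forms on \<open>\<real>\<^sup>n\<close> with continuously differentiable coefficients.\<close>

definition C1_form :: "('n::finite) form \<Rightarrow> bool" where
  "C1_form \<omega> \<longleftrightarrow> (\<forall>\<alpha>. C1 (\<lambda>x. \<omega> x $ \<alpha>))"

text \<open>The graph space of the operator in \<open>L\<^sup>2\<close>, and the operator as a function on it. Its values are
  determined only up to null sets; outside of the graph space they have no meaning.\<close>

definition sob :: "('n::finite) coeffs \<Rightarrow> (real ^ 'n) set \<Rightarrow> 'n form \<Rightarrow> bool" where
  "sob c U \<omega> \<longleftrightarrow> \<omega> \<in> L2 U \<and> (\<exists>\<eta>\<in>L2 U. weak_op c U \<omega> \<eta>)"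

definition wop :: "('n::finite) coeffs \<Rightarrow> (real ^ 'n) set \<Rightarrow> 'n form \<Rightarrow> 'n form" where
  "wop c U \<omega> = (SOME \<eta>. \<eta> \<in> L2 U \<and> weak_op c U \<omega> \<eta>)"

lemma sob_wop:
  assumes "sob c U \<omega>"
  shows "\<omega> \<in> L2 U" "wop c U \<omega> \<in> L2 U" "weak_op c U \<omega> (wop c U \<omega>)"
  using assms someI_ex[of "\<lambda>\<eta>. \<eta> \<in> L2 U \<and> weak_op c U \<omega> \<eta>"] by (auto simp: sob_def wop_def)

lemma test_sq:
  assumes "open U" "bounded U" "\<phi> \<in> test_functions U"
  shows "sq U \<phi>" "sq U (partial_deriv i \<phi>)"
  using assms test_C1[OF assms(3)] by (auto intro!: sq_continuous C1_continuous C1_continuous_partial)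

lemma C1_form_L2: "open U \<Longrightarrow> bounded U \<Longrightarrow> C1_form \<omega> \<Longrightarrow> \<omega> \<in> L2 U"
  by (intro L2_continuous C1_continuous) (auto simp: C1_form_def)

lemma classical_op_L2:
  assumes "open U" "bounded U" "C1_form \<omega>"
  shows "classical_op c \<omega> \<in> L2 U"
  using assms by (intro L2_continuous)
    (auto simp: classical_op_def C1_form_def intro!: continuous_intros C1_continuous_partial)

lemma weak_op_classical:
  assumes U: "open U" "bounded U" and \<omega>: "C1_form \<omega>"
  shows "weak_op c U \<omega> (classical_op c \<omega>)"
  unfolding weak_op_def
proof (intro ballI allI)
  fix \<phi> \<beta> assume \<phi>: "\<phi> \<in> test_functions U"
  have C: "C1 (\<lambda>x. \<omega> x $ \<alpha>)" for \<alpha> using \<omega> by (simp add: C1_form_def)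
  have i: "integrable (lebesgue_on U) (\<lambda>x. partial_deriv i (\<lambda>x. \<omega> x $ \<alpha>) x * \<phi> x)" for i \<alpha>
    using U \<phi> by (intro sq_mult test_sq sq_continuous C1_continuous_partial C)
  have "(LINT x|lebesgue_on U. classical_op c \<omega> x $ \<beta> * \<phi> x) =
      (LINT x|lebesgue_on U. (\<Sum>\<alpha>\<in>UNIV. \<Sum>i\<in>UNIV. c \<beta> i \<alpha> * (partial_deriv i (\<lambda>x. \<omega> x $ \<alpha>) x * \<phi> x)))"
    by (simp add: classical_op_def sum_distrib_right mult.assoc)
  also have "\<dots> = (\<Sum>\<alpha>\<in>UNIV. \<Sum>i\<in>UNIV. c \<beta> i \<alpha> * (LINT x|lebesgue_on U. partial_deriv i (\<lambda>x. \<omega> x $ \<alpha>) x * \<phi> x))"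
    by (simp add: i Bochner_Integration.integral_sum)
  also have "\<dots> = - (\<Sum>\<alpha>\<in>UNIV. \<Sum>i\<in>UNIV. c \<beta> i \<alpha> * (LINT x|lebesgue_on U. \<omega> x $ \<alpha> * partial_deriv i \<phi> x))"
    by (simp add: integration_by_parts[OF U(1) C \<phi>] sum_negf)
  finally show "(LINT x|lebesgue_on U. classical_op c \<omega> x $ \<beta> * \<phi> x) =
      - (\<Sum>\<alpha>\<in>UNIV. \<Sum>i\<in>UNIV. c \<beta> i \<alpha> * (LINT x|lebesgue_on U. \<omega> x $ \<alpha> * partial_deriv i \<phi> x))" .
qed

lemma weak_op_diff:
  assumes U: "open U" "bounded U" and L: "\<omega> \<in> L2 U" "\<omega>' \<in> L2 U" "\<eta> \<in> L2 U" "\<eta>' \<in> L2 U"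
    and w: "weak_op c U \<omega> \<eta>" "weak_op c U \<omega>' \<eta>'"
  shows "weak_op c U (\<lambda>x. \<omega> x - \<omega>' x) (\<lambda>x. \<eta> x - \<eta>' x)"
  unfolding weak_op_def
proof (intro ballI allI)
  fix \<phi> \<beta> assume \<phi>: "\<phi> \<in> test_functions U"
  have i: "integrable (lebesgue_on U) (\<lambda>x. \<zeta> x $ \<alpha> * \<phi> x)"
    "integrable (lebesgue_on U) (\<lambda>x. \<zeta> x $ \<alpha> * partial_deriv i \<phi> x)" if "\<zeta> \<in> L2 U" for \<zeta> \<alpha> i
    using U \<phi> that by (auto intro!: sq_mult test_sq L2_comp)
  show "(LINT x|lebesgue_on U. (\<eta> x - \<eta>' x) $ \<beta> * \<phi> x) =
    - (\<Sum>\<alpha>\<in>UNIV. \<Sum>i\<in>UNIV. c \<beta> i \<alpha> * (LINT x|lebesgue_on U. (\<omega> x - \<omega>' x) $ \<alpha> * partial_deriv i \<phi> x))"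
    using w \<phi> unfolding weak_op_def
    by (simp add: left_diff_distrib i L right_diff_distrib sum_subtractf)
qed

lemma weak_op_subset:
  assumes "open U" "open V" "U \<subseteq> V" "weak_op c V \<omega> \<eta>"
  shows "weak_op c U \<omega> \<eta>"
  unfolding weak_op_def
proof (intro ballI allI)
  fix \<phi> \<beta> assume \<phi>: "\<phi> \<in> test_functions U"
  then have \<phi>V: "\<phi> \<in> test_functions V" using test_functions_mono[OF assms(3)] by blast
  show "(LINT x|lebesgue_on U. \<eta> x $ \<beta> * \<phi> x) =
    - (\<Sum>\<alpha>\<in>UNIV. \<Sum>i\<in>UNIV. c \<beta> i \<alpha> * (LINT x|lebesgue_on U. \<omega> x $ \<alpha> * partial_deriv i \<phi> x))"
    using assms(4) \<phi>V
      lebesgue_on_integral_zero_outside[OF assms(1-3), of "\<lambda>x. \<eta> x $ \<beta> * \<phi> x"]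
      lebesgue_on_integral_zero_outside[OF assms(1-3), of "\<lambda>x. \<omega> x $ _ * partial_deriv _ \<phi> x"]
    by (simp add: weak_op_def test_zero[OF \<phi>] test_partial_zero[OF \<phi>])
qed

lemma weak_op_cong_AE:
  assumes U: "open U" "bounded U" and L: "\<omega> \<in> L2 U" and e: "AE x in lebesgue_on U. \<omega>' x = \<omega> x"
  shows "weak_op c U \<omega>' \<eta> \<longleftrightarrow> weak_op c U \<omega> \<eta>"
proof -
  have L': "\<omega>' \<in> L2 U" using L2_cong_AE U e L by blast
  have "(LINT x|lebesgue_on U. \<omega>' x $ \<alpha> * partial_deriv i \<phi> x) = (LINT x|lebesgue_on U. \<omega> x $ \<alpha> * partial_deriv i \<phi> x)"
    if \<phi>: "\<phi> \<in> test_functions U" for \<phi> \<alpha> i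
  proof (rule integral_cong_AE)
    show "AE x in lebesgue_on U. \<omega>' x $ \<alpha> * partial_deriv i \<phi> x = \<omega> x $ \<alpha> * partial_deriv i \<phi> x"
      using e by eventually_elim simp
  qed (intro borel_measurable_integrable sq_mult L2_comp L L' test_sq(2)[OF U \<phi>])+
  then show ?thesis by (simp add: weak_op_def)
qed

lemma weak_op_unique:
  assumes U: "open U" "bounded U" and L: "\<eta> \<in> L2 U" "\<eta>' \<in> L2 U"
    and w: "weak_op c U \<omega> \<eta>" "weak_op c U \<omega> \<eta>'"
  shows "AE x in lebesgue_on U. \<eta> x = \<eta>' x"
proof -
  have "AE x in lebesgue_on U. \<eta> x $ \<beta> - \<eta>' x $ \<beta> = 0" for \<beta>
  proof (rule fundamental_lemma[OF U(1)])
    show "integrable (lebesgue_on U) (\<lambda>x. \<eta> x $ \<beta> - \<eta>' x $ \<beta>)"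
      using U L by (intro sq_integrable sq_diff L2_comp)
    fix \<phi> assume \<phi>: "\<phi> \<in> test_functions U"
    have "integrable (lebesgue_on U) (\<lambda>x. \<zeta> x $ \<beta> * \<phi> x)" if "\<zeta> \<in> L2 U" for \<zeta>
      using U \<phi> that by (intro sq_mult test_sq L2_comp)
    then show "(LINT x|lebesgue_on U. (\<eta> x $ \<beta> - \<eta>' x $ \<beta>) * \<phi> x) = 0"
      using w \<phi> L unfolding weak_op_def by (simp add: left_diff_distrib)
  qed
  then have "AE x in lebesgue_on U. \<forall>\<beta>\<in>UNIV. \<eta> x $ \<beta> - \<eta>' x $ \<beta> = 0"
    by (subst AE_finite_all) auto
  then show ?thesis by eventually_elim (simp add: vec_eq_iff)
qed

lemma wop_AE:
  assumes "open U" "bounded U" "\<eta> \<in> L2 U" "weak_op c U \<omega> \<eta>"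
  shows "AE x in lebesgue_on U. wop c U \<omega> x = \<eta> x" "wop c U \<omega> \<in> L2 U"
proof -
  have *: "wop c U \<omega> \<in> L2 U \<and> weak_op c U \<omega> (wop c U \<omega>)"
    unfolding wop_def by (rule someI[of _ \<eta>]) (use assms in auto)
  then show "wop c U \<omega> \<in> L2 U" by blast
  show "AE x in lebesgue_on U. wop c U \<omega> x = \<eta> x" using * assms weak_op_unique by blast
qed

lemma sob_diff:
  assumes "open U" "bounded U" "sob c U \<omega>" "sob c U \<eta>"
  shows "sob c U (\<lambda>x. \<omega> x - \<eta> x)"
    and "AE x in lebesgue_on U. wop c U (\<lambda>x. \<omega> x - \<eta> x) x = wop c U \<omega> x - wop c U \<eta> x"
proof -
  note L = sob_wop[OF assms(3)] sob_wop[OF assms(4)]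
  have "weak_op c U (\<lambda>x. \<omega> x - \<eta> x) (\<lambda>x. wop c U \<omega> x - wop c U \<eta> x)"
    using assms(1,2) L by (intro weak_op_diff)
  moreover have "(\<lambda>x. wop c U \<omega> x - wop c U \<eta> x) \<in> L2 U" "(\<lambda>x. \<omega> x - \<eta> x) \<in> L2 U"
    using L by (auto intro: L2_diff)
  ultimately show "sob c U (\<lambda>x. \<omega> x - \<eta> x)"
    "AE x in lebesgue_on U. wop c U (\<lambda>x. \<omega> x - \<eta> x) x = wop c U \<omega> x - wop c U \<eta> x"
    using wop_AE(1)[OF assms(1,2)] by (auto simp: sob_def)
qed

lemma sob_classical:
  assumes "open U" "bounded U" "C1_form \<omega>"
  shows "sob c U \<omega>" "AE x in lebesgue_on U. wop c U \<omega> x = classical_op c \<omega> x"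
  using weak_op_classical[OF assms] classical_op_L2[OF assms] wop_AE(1)[OF assms(1,2)] C1_form_L2[OF assms]
  unfolding sob_def by blast+

lemma sob_subset:
  assumes "open U" "open V" "bounded V" "U \<subseteq> V" "sob c V \<omega>"
  shows "sob c U \<omega>" "AE x in lebesgue_on U. wop c U \<omega> x = wop c V \<omega> x"
proof -
  have "weak_op c U \<omega> (wop c V \<omega>)" "wop c V \<omega> \<in> L2 U" "\<omega> \<in> L2 U"
    using sob_wop[OF assms(5)] weak_op_subset[OF assms(1,2,4)] L2_subset[OF assms(1,2,4)] by auto
  then show "sob c U \<omega>" "AE x in lebesgue_on U. wop c U \<omega> x = wop c V \<omega> x"
    using wop_AE(1)[OF assms(1) bounded_subset[OF assms(3,4)]] unfolding sob_def by blast+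
qed

lemma sob_cong_AE:
  assumes "open U" "bounded U" "sob c U \<omega>" "AE x in lebesgue_on U. \<omega>' x = \<omega> x"
  shows "sob c U \<omega>'" "wop c U \<omega>' = wop c U \<omega>"
proof -
  have "\<omega> \<in> L2 U" using assms(3) by (rule sob_wop)
  then show "sob c U \<omega>'" "wop c U \<omega>' = wop c U \<omega>"
    using assms(3) weak_op_cong_AE[OF assms(1,2) _ assms(4)] L2_cong_AE[OF assms(1,4)]
    unfolding sob_def wop_def by auto
qed

text \<open>The weak operator and its formal adjoint are dual as soon as one of the two forms is a limit
  of test forms in the graph norm.\<close>

lemma duality_test:
  assumes U: "open U" "bounded U" and s: "sob c U \<omega>"
    and \<phi>: "\<And>\<alpha>. (\<lambda>x. \<phi> x $ \<alpha>) \<in> test_functions U"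
  shows "L2_inner U (wop c U \<omega>) \<phi> = L2_inner U \<omega> (classical_op (adj c) \<phi>)"
proof -
  have C: "C1_form \<phi>" using \<phi> test_C1 by (auto simp: C1_form_def)
  have i: "integrable (lebesgue_on U) (\<lambda>x. \<omega> x $ \<alpha> * partial_deriv i (\<lambda>x. \<phi> x $ \<beta>) x)" for \<alpha> i \<beta>
    using U \<phi> sob_wop(1)[OF s] by (intro sq_mult test_sq L2_comp)
  have "L2_inner U (wop c U \<omega>) \<phi> = (\<Sum>\<beta>\<in>UNIV. LINT x|lebesgue_on U. wop c U \<omega> x $ \<beta> * \<phi> x $ \<beta>)"
    by (rule L2_inner_eq_sum[OF sob_wop(2)[OF s] C1_form_L2[OF U C]])
  also have "\<dots> = - (\<Sum>\<beta>\<in>UNIV. \<Sum>\<alpha>\<in>UNIV. \<Sum>i\<in>UNIV. c \<beta> i \<alpha> *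
      (LINT x|lebesgue_on U. \<omega> x $ \<alpha> * partial_deriv i (\<lambda>x. \<phi> x $ \<beta>) x))"
    using sob_wop(3)[OF s] \<phi> by (simp add: weak_op_def sum_negf)
  also have "\<dots> = (\<Sum>\<alpha>\<in>UNIV. \<Sum>\<beta>\<in>UNIV. \<Sum>i\<in>UNIV. adj c \<alpha> i \<beta> *
      (LINT x|lebesgue_on U. \<omega> x $ \<alpha> * partial_deriv i (\<lambda>x. \<phi> x $ \<beta>) x))"
    by (subst sum.swap) (simp add: adj_def sum_negf)
  also have "\<dots> = (\<Sum>\<alpha>\<in>UNIV. LINT x|lebesgue_on U. (\<Sum>\<beta>\<in>UNIV. \<Sum>i\<in>UNIV. adj c \<alpha> i \<beta> *
      (\<omega> x $ \<alpha> * partial_deriv i (\<lambda>x. \<phi> x $ \<beta>) x)))"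
    by (simp add: i Bochner_Integration.integral_sum)
  also have "\<dots> = (\<Sum>\<alpha>\<in>UNIV. LINT x|lebesgue_on U. \<omega> x $ \<alpha> * classical_op (adj c) \<phi> x $ \<alpha>)"
    by (simp add: classical_op_def sum_distrib_left mult_ac)
  also have "\<dots> = L2_inner U \<omega> (classical_op (adj c) \<phi>)"
    by (rule L2_inner_eq_sum[symmetric, OF sob_wop(1)[OF s] classical_op_L2[OF U C]])
  finally show ?thesis .
qed

lemma duality:
  assumes U: "open U" "bounded U" and s: "sob c U \<omega>" and t: "sob (adj c) U \<mu>"
    and approx: "\<And>\<epsilon>. \<epsilon> > 0 \<Longrightarrow> \<exists>\<phi>. (\<forall>\<alpha>. (\<lambda>x. \<phi> x $ \<alpha>) \<in> test_functions U) \<and>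
      L2_inner U (\<lambda>x. \<mu> x - \<phi> x) (\<lambda>x. \<mu> x - \<phi> x) +
      L2_inner U (\<lambda>x. wop (adj c) U \<mu> x - classical_op (adj c) \<phi> x)
                 (\<lambda>x. wop (adj c) U \<mu> x - classical_op (adj c) \<phi> x) < \<epsilon>"
  shows "L2_inner U (wop c U \<omega>) \<mu> = L2_inner U \<omega> (wop (adj c) U \<mu>)"
proof -
  define D where "D = \<bar>L2_inner U (wop c U \<omega>) \<mu> - L2_inner U \<omega> (wop (adj c) U \<mu>)\<bar>"
  define E where "E = L2_inner U (wop c U \<omega>) (wop c U \<omega>) + L2_inner U \<omega> \<omega> + 1"
  have E: "E > 0" using L2_inner_nonneg[of U \<omega>] L2_inner_nonneg[of U "wop c U \<omega>"] by (simp add: E_def)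
  \<comment> \<open>approximation up to \<open>s\<^sup>2\<close> and Young's inequality with weight \<open>s\<close>\<close>
  have D: "D \<le> s * E" if s0: "s > 0" for s
  proof -
    obtain \<phi> where \<phi>: "\<And>\<alpha>. (\<lambda>x. \<phi> x $ \<alpha>) \<in> test_functions U"
      and n: "L2_inner U (\<lambda>x. \<mu> x - \<phi> x) (\<lambda>x. \<mu> x - \<phi> x) +
        L2_inner U (\<lambda>x. wop (adj c) U \<mu> x - classical_op (adj c) \<phi> x)
                 (\<lambda>x. wop (adj c) U \<mu> x - classical_op (adj c) \<phi> x) < s\<^sup>2" (is "?a + ?b < _")
      using approx[of "s\<^sup>2"] s0 by auto
    have C: "C1_form \<phi>" using \<phi> test_C1 by (auto simp: C1_form_def)
    note L = sob_wop(1,2)[OF s] sob_wop(1,2)[OF t] C1_form_L2[OF U C] classical_op_L2[OF U C, of "adj c"]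
    have "D = \<bar>L2_inner U (wop c U \<omega>) (\<lambda>x. \<mu> x - \<phi> x) -
        L2_inner U \<omega> (\<lambda>x. wop (adj c) U \<mu> x - classical_op (adj c) \<phi> x)\<bar>"
      unfolding D_def using duality_test[OF U s \<phi>] by (simp add: L2_inner_diff_right L)
    also have "\<dots> \<le> \<bar>L2_inner U (wop c U \<omega>) (\<lambda>x. \<mu> x - \<phi> x)\<bar> +
        \<bar>L2_inner U \<omega> (\<lambda>x. wop (adj c) U \<mu> x - classical_op (adj c) \<phi> x)\<bar>" by (rule abs_triangle_ineq4)
    also have "\<dots> \<le> (s * L2_inner U (wop c U \<omega>) (wop c U \<omega>) + ?a / s) + (s * L2_inner U \<omega> \<omega> + ?b / s)"
      using s0 L by (intro add_mono L2_inner_young L2_diff)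
    also have "\<dots> = s * (E - 1) + (?a + ?b) / s" by (simp add: E_def algebra_simps add_divide_distrib)
    also have "\<dots> \<le> s * (E - 1) + s\<^sup>2 / s" using n s0 by (intro add_left_mono divide_right_mono) auto
    also have "\<dots> = s * E" using s0 by (simp add: power2_eq_square algebra_simps)
    finally show ?thesis .
  qed
  have "D \<le> 0"
  proof (rule ccontr)
    assume "\<not> D \<le> 0"
    then show False using D[of "D / (2 * E)"] E by (simp add: field_simps)
  qed
  then show ?thesis by (simp add: D_def)
qed


section \<open>The exterior derivative and the codifferential as weak operators\<close>

lemma wedge_sign_square: "wedge_sign A B * wedge_sign A B = 1"
  by (simp add: wedge_sign_def power_mult_distrib[symmetric])

lemma wedge_sign_Un_left:
  fixes A B C :: "('n::{finite,linorder}) set"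
  assumes "A \<inter> B = {}"
  shows "wedge_sign (A \<union> B) C = wedge_sign A C * wedge_sign B C"
proof -
  have "{(i, j). i \<in> A \<union> B \<and> j \<in> C \<and> j < i} = {(i, j). i \<in> A \<and> j \<in> C \<and> j < i} \<union> {(i, j). i \<in> B \<and> j \<in> C \<and> j < i}"
    by auto
  moreover have "{(i, j). i \<in> A \<and> j \<in> C \<and> j < i} \<inter> {(i, j). i \<in> B \<and> j \<in> C \<and> j < i} = {}" using assms by auto
  ultimately show ?thesis by (simp add: wedge_sign_def card_Un_disjoint power_add)
qed

lemma wedge_sign_swap:
  fixes A B :: "('n::{finite,linorder}) set"
  assumes "A \<inter> B = {}"
  shows "wedge_sign A B * wedge_sign B A = (-1) ^ (card A * card B)"
proof -
  let ?X = "{(i, j). i \<in> A \<and> j \<in> B \<and> j < i}" and ?Y = "{(i, j). i \<in> B \<and> j \<in> A \<and> j < i}"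
  have "A \<times> B = ?X \<union> prod.swap ` ?Y"
    using assms by (fastforce simp: image_iff not_less_iff_gr_or_eq)
  moreover have "?X \<inter> prod.swap ` ?Y = {}" by auto
  moreover have "card (prod.swap ` ?Y) = card ?Y" by (intro card_image) auto
  ultimately have "card (A \<times> B) = card ?X + card ?Y"
    using card_Un_disjoint[of ?X "prod.swap ` ?Y"] by simp
  then have "card A * card B = card ?X + card ?Y" by (simp only: card_cartesian_product)
  then show ?thesis by (simp add: wedge_sign_def power_add)
qed

text \<open>The coefficients of the exterior derivative and of the codifferential
  \<open>(-1)\<^bsup>n(m+1)+1\<^esup> \<star>d\<star>\<close>; in the latter, the three signs \<open>wedge_sign\<close> come from the outer Hodge star, from
  \<open>d\<close> and from the inner Hodge star.\<close>

definition dcoef :: "('n::{finite,linorder}) coeffs" where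
  "dcoef \<beta> i \<alpha> = (if i \<in> \<beta> \<and> \<alpha> = \<beta> - {i} then wedge_sign {i} (\<beta> - {i}) else 0)"

definition codcoef :: "nat \<Rightarrow> ('n::{finite,linorder}) coeffs" where
  "codcoef m \<alpha> i \<gamma> = (if i \<notin> \<alpha> \<and> \<gamma> = insert i \<alpha> then
     (-1) ^ (CARD('n) * (m + 1) + 1) * wedge_sign (- \<alpha>) \<alpha> * wedge_sign {i} (- \<gamma>) * wedge_sign \<gamma> (- \<gamma>)
   else 0)"

text \<open>With \<open>\<gamma> = {i} \<union> \<alpha>\<close>, multiplicativity of the signs and
  \<open>wedge_sign A B * wedge_sign B A = (-1)\<^bsup>|A||B|\<^esup>\<close> for disjoint \<open>A\<close>, \<open>B\<close> reduce the product to \<open>- wedge_sign {i} \<alpha>\<close>: this is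
  why \<open>\<delta>\<close> is the formal adjoint of \<open>d\<close>.\<close>

lemma codcoef_eq_adj:
  fixes \<gamma> :: "('n::{finite,linorder}) set"
  assumes "card \<gamma> = k + 1"
  shows "codcoef (k + 1) \<alpha> i \<gamma> = adj dcoef \<alpha> i \<gamma>"
proof (cases "i \<notin> \<alpha> \<and> \<gamma> = insert i \<alpha>")
  case True
  then have \<gamma>: "\<gamma> = insert i \<alpha>" "i \<notin> \<alpha>" by auto
  define b where "b = card (- \<gamma>)"
  have k: "card \<alpha> = k" using assms \<gamma> by simp
  have n: "CARD('n) = k + 1 + b"
    using card_Un_disjoint[of \<gamma> "- \<gamma>"] assms by (simp add: b_def Compl_partition)
  have 1: "wedge_sign (- \<alpha>) \<alpha> = wedge_sign {i} \<alpha> * wedge_sign (- \<gamma>) \<alpha>"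
  proof -
    have "- \<alpha> = {i} \<union> - \<gamma>" using \<gamma> by auto
    then show ?thesis using wedge_sign_Un_left[of "{i}" "- \<gamma>" \<alpha>] \<gamma>(1) by simp
  qed
  have 2: "wedge_sign \<gamma> (- \<gamma>) = wedge_sign {i} (- \<gamma>) * wedge_sign \<alpha> (- \<gamma>)"
    using wedge_sign_Un_left[of "{i}" \<alpha> "- \<gamma>"] \<gamma> by simp
  have 3: "wedge_sign (- \<gamma>) \<alpha> * wedge_sign \<alpha> (- \<gamma>) = (-1) ^ (b * k)"
    using wedge_sign_swap[of "- \<gamma>" \<alpha>] \<gamma> k by (auto simp: b_def)
  have "codcoef (k + 1) \<alpha> i \<gamma> = (-1) ^ (CARD('n) * (k + 2) + 1) * wedge_sign (- \<alpha>) \<alpha> *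
      wedge_sign {i} (- \<gamma>) * wedge_sign \<gamma> (- \<gamma>)"
    using True by (simp add: codcoef_def)
  also have "\<dots> = (-1) ^ (CARD('n) * (k + 2) + 1) * wedge_sign {i} \<alpha> *
      (wedge_sign (- \<gamma>) \<alpha> * wedge_sign \<alpha> (- \<gamma>)) * (wedge_sign {i} (- \<gamma>) * wedge_sign {i} (- \<gamma>))"
    unfolding 1 2 by (simp only: mult_ac)
  also have "\<dots> = (-1) ^ (CARD('n) * (k + 2) + 1 + b * k) * wedge_sign {i} \<alpha>"
    unfolding 3 wedge_sign_square by (simp add: power_add)
  also have "(-1) ^ (CARD('n) * (k + 2) + 1 + b * k) = (-1 :: real)"
  proof -
    have "odd (CARD('n) * (k + 2) + 1 + b * k)" unfolding n by (cases "even k") auto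
    then show ?thesis by simp
  qed
  finally show ?thesis using \<gamma> by (simp add: adj_def dcoef_def)
next
  case False
  then have "\<not> (i \<in> \<gamma> \<and> \<alpha> = \<gamma> - {i})" by auto
  then show ?thesis using False by (auto simp: codcoef_def adj_def dcoef_def)
qed

lemma has_weak_d_iff: "has_weak_d U \<omega> \<eta> \<longleftrightarrow> weak_op dcoef U \<omega> \<eta>"
proof -
  have "(\<Sum>\<alpha>\<in>UNIV. \<Sum>i\<in>UNIV. dcoef \<beta> i \<alpha> * X \<alpha> i) =
      (\<Sum>i\<in>\<beta>. wedge_sign {i} (\<beta> - {i}) * X (\<beta> - {i}) i)" for \<beta> :: "'a set" and X
  proof -
    have "(\<Sum>\<alpha>\<in>UNIV. \<Sum>i\<in>UNIV. dcoef \<beta> i \<alpha> * X \<alpha> i) =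
        (\<Sum>i\<in>UNIV. \<Sum>\<alpha>\<in>UNIV. if \<alpha> = \<beta> - {i} then (if i \<in> \<beta> then wedge_sign {i} (\<beta> - {i}) * X (\<beta> - {i}) i else 0) else 0)"
      by (subst sum.swap) (intro sum.cong refl, auto simp: dcoef_def)
    also have "\<dots> = (\<Sum>i\<in>UNIV. if i \<in> \<beta> then wedge_sign {i} (\<beta> - {i}) * X (\<beta> - {i}) i else 0)" by simp
    finally show ?thesis by (simp add: sum.If_cases)
  qed
  then show ?thesis unfolding has_weak_d_def weak_op_def by simp
qed

lemma hodge_nth: "hodge c $ \<beta> = wedge_sign (- \<beta>) \<beta> * c $ (- \<beta>)"
proof -
  have "hodge c $ \<beta> = (\<Sum>\<alpha>\<in>UNIV. if \<alpha> = - \<beta> then wedge_sign \<alpha> (- \<alpha>) * c $ \<alpha> else 0)"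
    unfolding hodge_def sum_component by (intro sum.cong) (auto simp: dx_def axis_def)
  then show ?thesis by simp
qed

lemma hodge_hodge_scaled:
  fixes c :: "('n::{finite,linorder}) covector"
  shows "hodge (\<chi> \<beta>. wedge_sign \<beta> (- \<beta>) * c $ (- \<beta>)) = c"
  by (simp add: vec_eq_iff hodge_nth mult.assoc[symmetric] wedge_sign_square)

text \<open>The component \<open>\<alpha>\<close> of the left-hand equation is, up to a sign, the component \<open>- \<alpha>\<close> of the
  right-hand one.\<close>

lemma weak_op_codcoef_iff:
  fixes \<mu> \<eta> :: "('n::{finite,linorder}) form"
  shows "weak_op (codcoef m) U \<mu> (\<lambda>x. (-1) ^ (CARD('n) * (m + 1) + 1) *\<^sub>R hodge (\<eta> x)) \<longleftrightarrow>
    weak_op dcoef U (\<lambda>x. hodge (\<mu> x)) \<eta>"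
proof -
  define \<epsilon> :: real where "\<epsilon> = (-1) ^ (CARD('n) * (m + 1) + 1)"
  have \<epsilon>: "\<epsilon> * \<epsilon> = 1" by (simp add: \<epsilon>_def power_mult_distrib[symmetric])
  have "(LINT x|lebesgue_on U. (\<epsilon> *\<^sub>R hodge (\<eta> x)) $ \<alpha> * \<phi> x) =
      - (\<Sum>\<gamma>\<in>UNIV. \<Sum>i\<in>UNIV. codcoef m \<alpha> i \<gamma> * (LINT x|lebesgue_on U. \<mu> x $ \<gamma> * partial_deriv i \<phi> x)) \<longleftrightarrow>
    (LINT x|lebesgue_on U. \<eta> x $ (- \<alpha>) * \<phi> x) =
      - (\<Sum>\<gamma>\<in>UNIV. \<Sum>i\<in>UNIV. dcoef (- \<alpha>) i \<gamma> * (LINT x|lebesgue_on U. hodge (\<mu> x) $ \<gamma> * partial_deriv i \<phi> x))"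
    (is "?L = - ?R \<longleftrightarrow> ?L' = - ?R'") for \<alpha> \<phi>
  proof -
    let ?s = "\<epsilon> * wedge_sign (- \<alpha>) \<alpha>"
    have s: "?s * ?s = 1" using \<epsilon> wedge_sign_square[of "- \<alpha>" \<alpha>] by (simp add: mult_ac)
    have L: "?L = ?s * ?L'" by (simp add: hodge_nth mult.assoc)
    have "?R' = (\<Sum>\<gamma>\<in>UNIV. \<Sum>i\<in>UNIV. dcoef (- \<alpha>) i (- \<gamma>) *
        (LINT x|lebesgue_on U. hodge (\<mu> x) $ (- \<gamma>) * partial_deriv i \<phi> x))"
      by (rule sum.reindex_bij_witness[of _ uminus uminus]) auto
    then have "?s * ?R' = (\<Sum>\<gamma>\<in>UNIV. \<Sum>i\<in>UNIV. ?s * (dcoef (- \<alpha>) i (- \<gamma>) * (wedge_sign \<gamma> (- \<gamma>) *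
        (LINT x|lebesgue_on U. \<mu> x $ \<gamma> * partial_deriv i \<phi> x))))"
      by (simp add: sum_distrib_left hodge_nth mult.assoc)
    also have "\<dots> = ?R"
    proof (intro sum.cong refl)
      fix \<gamma> i
      have "- \<alpha> - {i} = - insert i \<alpha>" by auto
      then have "- \<gamma> = - \<alpha> - {i} \<longleftrightarrow> \<gamma> = insert i \<alpha>" by auto
      then show "?s * (dcoef (- \<alpha>) i (- \<gamma>) * (wedge_sign \<gamma> (- \<gamma>) *
          (LINT x|lebesgue_on U. \<mu> x $ \<gamma> * partial_deriv i \<phi> x))) =
        codcoef m \<alpha> i \<gamma> * (LINT x|lebesgue_on U. \<mu> x $ \<gamma> * partial_deriv i \<phi> x)"
        using \<open>- \<alpha> - {i} = - insert i \<alpha>\<close> by (simp add: dcoef_def codcoef_def \<epsilon>_def)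
    qed
    finally have "?L = - ?R \<longleftrightarrow> ?s * ?L' = ?s * - ?R'" using L by simp
    also have "\<dots> \<longleftrightarrow> ?L' = - ?R'"
    proof -
      have "?s \<noteq> 0" using s by (metis mult_zero_left zero_neq_one)
      then show ?thesis by (simp only: mult_cancel_left simp_thms)
    qed
    finally show ?thesis .
  qed
  note eq = this
  show ?thesis
    unfolding weak_op_def \<epsilon>_def[symmetric] eq
  proof (intro iffI ballI allI, goal_cases)
    case (1 \<phi> \<beta>)
    show ?case using 1(1)[rule_format, OF 1(2), of "- \<beta>"] by (simp only: double_complement)
  next
    case (2 \<phi> \<beta>)
    show ?case using 2(1)[rule_format, OF 2(2), of "- \<beta>"] .
  qed
qed

lemma has_weak_codiff_iff:
  fixes \<mu> \<nu> :: "('n::{finite,linorder}) form"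
  shows "has_weak_codiff m U \<mu> \<nu> \<longleftrightarrow> weak_op (codcoef m) U \<mu> \<nu>"
proof
  assume "has_weak_codiff m U \<mu> \<nu>"
  then show "weak_op (codcoef m) U \<mu> \<nu>"
    unfolding has_weak_codiff_def has_weak_d_iff using weak_op_codcoef_iff[of m U \<mu>] by auto
next
  assume w: "weak_op (codcoef m) U \<mu> \<nu>"
  define \<epsilon> :: real where "\<epsilon> = (-1) ^ (CARD('n) * (m + 1) + 1)"
  define \<eta> where "\<eta> x = (\<chi> \<beta>. wedge_sign \<beta> (- \<beta>) * (\<epsilon> *\<^sub>R \<nu> x) $ (- \<beta>))" for x
  have "\<epsilon> * \<epsilon> = 1" by (simp add: \<epsilon>_def power_mult_distrib[symmetric])
  then have e: "\<nu> = (\<lambda>x. \<epsilon> *\<^sub>R hodge (\<eta> x))" unfolding \<eta>_def hodge_hodge_scaled by simp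
  then have "weak_op dcoef U (\<lambda>x. hodge (\<mu> x)) \<eta>"
    using w weak_op_codcoef_iff[of m U \<mu> \<eta>] unfolding \<epsilon>_def by simp
  then show "has_weak_codiff m U \<mu> \<nu>"
    unfolding has_weak_codiff_def has_weak_d_iff using e unfolding \<epsilon>_def by blast
qed

lemma weak_d_eq_wop: "weak_d U = wop dcoef U"
  by (simp add: weak_d_def wop_def has_weak_d_iff fun_eq_iff)

lemma weak_codiff_eq_wop: "weak_codiff m U = wop (codcoef m) U"
  by (simp add: weak_codiff_def wop_def has_weak_codiff_iff fun_eq_iff)

lemma H_sob: "\<omega> \<in> H k U \<Longrightarrow> sob dcoef U \<omega>"
  by (auto simp: H_def sob_def has_weak_d_iff L2_forms_def)

lemma H_star_sob: "\<mu> \<in> H_star k U \<Longrightarrow> sob (codcoef k) U \<mu>"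
  by (auto simp: H_star_def sob_def has_weak_codiff_iff L2_forms_def)

text \<open>On forms of degree \<open>k + 1\<close> the codifferential is the formal adjoint of \<open>d\<close>; in other degrees the
  two may differ by a sign.\<close>

lemma weak_op_codcoef_adj:
  fixes \<mu> :: "('n::{finite,linorder}) form"
  assumes "AE x in lebesgue_on U. \<mu> x \<in> covectors (k + 1)"
  shows "weak_op (codcoef (k + 1)) U \<mu> \<nu> \<longleftrightarrow> weak_op (adj dcoef) U \<mu> \<nu>"
proof -
  have "codcoef (k + 1) \<alpha> i \<gamma> * (LINT x|lebesgue_on U. \<mu> x $ \<gamma> * g x) =
      adj dcoef \<alpha> i \<gamma> * (LINT x|lebesgue_on U. \<mu> x $ \<gamma> * g x)" for \<alpha> i \<gamma> g
  proof (cases "card \<gamma> = k + 1")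
    case True
    then show ?thesis by (simp only: codcoef_eq_adj)
  next
    case False
    have "AE x in lebesgue_on U. \<mu> x $ \<gamma> * g x = 0"
      using assms by eventually_elim (use False in \<open>auto simp: covectors_def\<close>)
    then have "(LINT x|lebesgue_on U. \<mu> x $ \<gamma> * g x) = 0" by (rule integral_eq_zero_AE)
    then show ?thesis by simp
  qed
  then show ?thesis by (simp only: weak_op_def)
qed

lemma wop_codcoef_adj:
  assumes "AE x in lebesgue_on U. \<mu> x \<in> covectors (k + 1)"
  shows "wop (codcoef (k + 1)) U \<mu> = wop (adj dcoef) U \<mu>"
    "sob (codcoef (k + 1)) U \<mu> \<longleftrightarrow> sob (adj dcoef) U \<mu>"
  using weak_op_codcoef_adj[OF assms] by (auto simp: wop_def sob_def)

lemma adj_adj: "adj (adj c) = c"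
  by (simp add: adj_def fun_eq_iff)


section \<open>Tensor product polynomials on boxes\<close>

text \<open>The span of the products \<open>\<Prod>\<^sub>i p\<^sub>i(x\<^sub>i)\<close> with \<open>degree p\<^sub>i \<le> r i\<close>, generated one product at a
  time.\<close>

inductive_set tens :: "('n::finite \<Rightarrow> nat) \<Rightarrow> (real ^ 'n \<Rightarrow> real) set" for r where
  tens_zero: "(\<lambda>x. 0) \<in> tens r"
| tens_step: "f \<in> tens r \<Longrightarrow> (\<And>i. degree (p i) \<le> r i) \<Longrightarrow>
    (\<lambda>x. f x + (\<Prod>i\<in>UNIV. poly (p i) (x $ i))) \<in> tens r"

lemma tensor_polys_tens:
  assumes "f \<in> tensor_polys r"
  shows "f \<in> tens r"
proof -
  obtain m :: nat and p where f: "f = (\<lambda>x. \<Sum>j<m. \<Prod>i\<in>UNIV. poly (p j i) (x $ i))" and p: "\<forall>j<m. \<forall>i. degree (p j i) \<le> r i"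
    using assms unfolding tensor_polys_def by blast
  have "(\<lambda>x. \<Sum>j<l. \<Prod>i\<in>UNIV. poly (p j i) (x $ i)) \<in> tens r" if "l \<le> m" for l
    using that
  proof (induction l)
    case (Suc l)
    then show ?case using p by (auto intro!: tens_step simp: Suc_le_eq)
  qed (simp add: tens_zero)
  then show ?thesis using f by simp
qed

lemma tens_prod: "(\<And>i. degree (p i) \<le> r i) \<Longrightarrow> (\<lambda>x. \<Prod>i\<in>UNIV. poly (p i) (x $ i)) \<in> tens r"
  using tens_step[OF tens_zero, of p r] by simp

lemma tens_add: "g \<in> tens r \<Longrightarrow> f \<in> tens r \<Longrightarrow> (\<lambda>x. f x + g x) \<in> tens r"
proof (induction g rule: tens.induct)
  case (tens_step g p)
  have "(\<lambda>x. (f x + g x) + (\<Prod>i\<in>UNIV. poly (p i) (x $ i))) \<in> tens r"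
    by (rule tens.tens_step) (use tens_step in auto)
  then show ?case by (simp add: add.assoc)
qed simp

lemma tens_sum: "(\<And>j. j \<in> J \<Longrightarrow> f j \<in> tens r) \<Longrightarrow> (\<lambda>x. \<Sum>j\<in>J. f j x) \<in> tens r"
  by (induction J rule: infinite_finite_induct) (auto simp: tens_zero intro: tens_add)

lemma tens_cmult:
  fixes f :: "real ^ 'n::finite \<Rightarrow> real"
  assumes "f \<in> tens r" shows "(\<lambda>x. c * f x) \<in> tens r"
  using assms
proof (induction f rule: tens.induct)
  case (tens_step g p)
  define i0 :: 'n where "i0 = (SOME i. True)"
  define q where "q = p(i0 := smult c (p i0))"
  have "(\<Prod>i\<in>UNIV. poly (q i) (x $ i)) = c * (\<Prod>i\<in>UNIV. poly (p i) (x $ i))" for x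
    by (subst (1 2) prod.remove[of UNIV i0]) (auto simp: q_def intro!: prod.cong)
  moreover have "(\<lambda>x. c * g x + (\<Prod>i\<in>UNIV. poly (q i) (x $ i))) \<in> tens r"
    using tens_step by (intro tens.tens_step) (auto simp: q_def intro: order_trans[OF degree_smult_le])
  ultimately show ?case by (simp add: distrib_left)
qed (simp add: tens_zero)

lemma tens_const: "(\<lambda>x. c) \<in> tens r"
proof -
  have "(\<lambda>x. \<Prod>i\<in>UNIV. poly 1 (x $ i)) \<in> tens r" by (rule tens_prod) simp
  then show ?thesis using tens_cmult[of "\<lambda>x. 1" r c] by simp
qed

lemma tens_var:
  assumes "1 \<le> r i" shows "(\<lambda>x. x $ i) \<in> tens r"
proof -
  have "(\<lambda>x. \<Prod>l\<in>UNIV. poly (if l = i then [:0, 1:] else 1) (x $ l)) \<in> tens r"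
    using assms by (intro tens_prod) auto
  moreover have "(\<Prod>l\<in>UNIV. poly (if l = i then [:0, 1:] else 1) (x $ l)) = x $ i" for x :: "real ^ 'a"
    by (subst prod.remove[of UNIV i]) auto
  ultimately show ?thesis by simp
qed

lemma
  fixes f :: "real ^ 'n::finite \<Rightarrow> real"
  shows tens_C1: "f \<in> tens r \<Longrightarrow> C1 f"
    and tens_partial: "f \<in> tens r \<Longrightarrow> partial_deriv i f \<in> tens (r(i := r i - 1))"
proof -
  have P: "(\<lambda>x. \<Prod>l\<in>UNIV. poly (p l) (x $ l)) differentiable at x"
    "partial_deriv i (\<lambda>x. \<Prod>l\<in>UNIV. poly (p l) (x $ l)) =
      (\<lambda>x. \<Prod>l\<in>UNIV. poly (if l = i then pderiv (p l) else p l) (x $ l))"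
    for p :: "'n \<Rightarrow> real poly" and x :: "real ^ 'n" and i
    using prod_functions_derivative[of "\<lambda>l. poly (p l)" "\<lambda>l. poly (pderiv (p l))"]
    by (auto simp: fun_eq_iff poly_DERIV if_distrib[of poly] if_distribR)
  show C: "C1 f" if "f \<in> tens r" for f :: "real ^ 'n \<Rightarrow> real" and r
    using that
  proof (induction f rule: tens.induct)
    case (tens_step f p)
    have "C1 (\<lambda>x. \<Prod>l\<in>UNIV. poly (p l) (x $ l))"
      unfolding C1_def P by (auto intro!: P(1) continuous_intros)
    then show ?case using tens_step by (intro C1_add)
  qed (simp add: C1_const)
  show "partial_deriv i f \<in> tens (r(i := r i - 1))" if "f \<in> tens r" for f :: "real ^ 'n \<Rightarrow> real" and r i
    using that
  proof (induction f rule: tens.induct)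
    case tens_zero
    then show ?case by (simp add: partial_deriv_const[abs_def] tens.tens_zero)
  next
    case (tens_step f p)
    have "partial_deriv i (\<lambda>x. f x + (\<Prod>l\<in>UNIV. poly (p l) (x $ l))) =
        (\<lambda>x. partial_deriv i f x + (\<Prod>l\<in>UNIV. poly (if l = i then pderiv (p l) else p l) (x $ l)))"
      using C[OF tens_step(1)] P(1)[of p] by (intro ext, subst partial_deriv_add) (auto simp: C1_def P(2))
    moreover have "degree (if l = i then pderiv (p l) else p l) \<le> (r(i := r i - 1)) l" for l
      using tens_step(2)[of l] tens_step(2)[of i] by (auto simp: degree_pderiv)
    ultimately show ?case using tens_step.IH by (simp add: tens.tens_step)
  qed
qed

text \<open>Fubini's theorem for products of functions of one variable.\<close>

lemma integral_prod_box:
  fixes g :: "'n::finite \<Rightarrow> real \<Rightarrow> real" and a b :: "real ^ 'n"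
  assumes c: "\<And>l. continuous_on UNIV (g l)"
  shows "(LINT x|lebesgue_on (box a b). (\<Prod>l\<in>UNIV. g l (x $ l))) =
    (\<Prod>l\<in>UNIV. (LINT t|lborel. indicator {a $ l<..<b $ l} t * g l t))"
proof -
  define h where "h l t = indicator {a $ l<..<b $ l} t * g l t" for l t
  define ix :: "real ^ 'n \<Rightarrow> 'n" where "ix = the_inv (\<lambda>l. axis l 1)"
  have inj: "inj (\<lambda>l. axis l 1 :: real ^ 'n)" by (auto simp: inj_on_def axis_eq_axis)
  have ix: "ix (axis l 1) = l" for l unfolding ix_def by (rule the_inv_f_f[OF inj])
  have B: "(Basis :: (real ^ 'n) set) = range (\<lambda>l. axis l 1)" by (auto simp: Basis_vec_def)
  have prodB: "(\<Prod>e\<in>(Basis :: (real ^ 'n) set). F (ix e)) = (\<Prod>l\<in>UNIV. F l)" for F :: "'n \<Rightarrow> real"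
    unfolding B by (subst prod.reindex[OF inj]) (simp add: ix)
  have m: "h l \<in> borel_measurable borel" for l
    unfolding h_def using borel_measurable_continuous_onI[OF c[of l]]
    by (intro borel_measurable_times borel_measurable_indicator) auto
  have i: "integrable lborel (h l)" for l
  proof -
    have "integrable lborel (\<lambda>t. indicator {a $ l..b $ l} t *\<^sub>R g l t)"
      using c by (intro borel_integrable_compact) (auto intro: continuous_on_subset)
    then show ?thesis
      by (rule Bochner_Integration.integrable_bound) (use m in \<open>auto simp: h_def indicator_def intro!: AE_I2\<close>)
  qed
  interpret product_sigma_finite "\<lambda>_ :: real ^ 'n. lborel :: real measure" by standard
  have comp: "(\<Sum>e\<in>Basis. f e *\<^sub>R e) $ l = f (axis l 1)" for f and l :: 'n
    unfolding B by (subst sum.reindex[OF inj]) (simp add: axis_def if_distrib cong: if_cong)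
  have e: "indicator (box a b) x * (\<Prod>l\<in>UNIV. g l (x $ l)) = (\<Prod>l\<in>UNIV. h l (x $ l))" for x
  proof -
    have "indicator (box a b) x = (\<Prod>l\<in>UNIV. indicator {a $ l<..<b $ l} (x $ l) :: real)"
      by (auto simp: indicator_def mem_box_cart)
    then show ?thesis by (simp add: h_def prod.distrib)
  qed
  have mp: "(\<lambda>x :: real ^ 'n. \<Prod>l\<in>UNIV. h l (x $ l)) \<in> borel_measurable borel"
    using m by (intro borel_measurable_prod measurable_compose[OF borel_measurable_nth])
  have "(LINT x|lebesgue_on (box a b). (\<Prod>l\<in>UNIV. g l (x $ l))) =
      (LINT x|lebesgue. indicator (box a b) x * (\<Prod>l\<in>UNIV. g l (x $ l)))"
    by (rule lebesgue_on_integral_eq[OF open_box])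
  also have "\<dots> = (LINT x|lborel. (\<Prod>l\<in>UNIV. h l (x $ l)))"
    unfolding e by (rule integral_completion) (use mp in simp)
  also have "\<dots> = (LINT f|(\<Pi>\<^sub>M e\<in>(Basis :: (real ^ 'n) set). lborel). (\<Prod>l\<in>UNIV. h l ((\<Sum>e\<in>Basis. f e *\<^sub>R e) $ l)))"
    by (subst lborel_eq, subst integral_distr) (use mp in auto)
  also have "\<dots> = (LINT f|(\<Pi>\<^sub>M e\<in>(Basis :: (real ^ 'n) set). lborel). (\<Prod>e\<in>Basis. h (ix e) (f e)))"
  proof -
    have "(\<Prod>l\<in>UNIV. h l (f (axis l 1))) = (\<Prod>e\<in>(Basis :: (real ^ 'n) set). h (ix e) (f e))" for f
      unfolding B by (subst prod.reindex[OF inj]) (simp add: ix)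
    then show ?thesis by (simp only: comp)
  qed
  also have "\<dots> = (\<Prod>e\<in>(Basis :: (real ^ 'n) set). (LINT t|lborel. h (ix e) t))"
    by (rule product_integral_prod) (auto simp: i)
  also have "\<dots> = (\<Prod>l\<in>UNIV. (LINT t|lborel. h l t))" by (rule prodB)
  finally show ?thesis by (simp add: h_def)
qed

text \<open>On a box, polynomials in disjoint sets of variables are uncorrelated. For products of univariate
  polynomials this reduces to one variable, where one of the two factors is constant.\<close>

lemma tens_uncorrelated:
  fixes f g :: "real ^ 'n::finite \<Rightarrow> real" and a b :: "real ^ 'n"
  assumes f: "f \<in> tens r" and g: "g \<in> tens r'" and r: "\<And>i. r i = 0 \<or> r' i = 0"
  shows "(LINT x|lebesgue_on (box a b). 1) * (LINT x|lebesgue_on (box a b). f x * g x) =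
    (LINT x|lebesgue_on (box a b). f x) * (LINT x|lebesgue_on (box a b). g x)"
proof -
  let ?U = "box a b"
  let ?P = "\<lambda>p x. \<Prod>i\<in>UNIV. poly (p i) (x $ i) :: real"
  let ?I = "\<lambda>l h. (LINT t|lborel. indicator {a $ l<..<b $ l} t * h t) :: real"
  have sq: "sq ?U f" if "f \<in> tens s" for f s
    using tens_C1[OF that] by (intro sq_continuous C1_continuous) (auto simp: bounded_box)
  have int: "integrable (lebesgue_on ?U) f" if "f \<in> tens s" for f s
    using sq[OF that] by (intro sq_integrable) (auto simp: bounded_box)
  have prods: "(LINT x|lebesgue_on ?U. 1) * (LINT x|lebesgue_on ?U. ?P p x * ?P q x) =
      (LINT x|lebesgue_on ?U. ?P p x) * (LINT x|lebesgue_on ?U. ?P q x)"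
    if d: "\<And>i. degree (p i) \<le> r i" "\<And>i. degree (q i) \<le> r' i" for p q
  proof -
    have one: "?I l (\<lambda>t. 1) * ?I l (\<lambda>t. poly (p l) t * poly (q l) t) =
        ?I l (poly (p l)) * ?I l (poly (q l))" for l
    proof -
      from r[of l] d have "degree (p l) = 0 \<or> degree (q l) = 0" by (metis le_zero_eq)
      then consider c where "p l = [:c:]" | c where "q l = [:c:]" by (metis degree_eq_zeroE)
      then show ?thesis
      proof cases
        case (1 c)
        have "?I l (\<lambda>t. c * poly (q l) t) = (LINT t|lborel. c * (indicator {a $ l<..<b $ l} t * poly (q l) t))"
          "?I l (\<lambda>t. c) = (LINT t|lborel. c * (indicator {a $ l<..<b $ l} t * 1))"
          by (simp_all add: mult_ac)
        then show ?thesis using 1 by (simp add: mult_ac)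
      next
        case (2 c)
        have "?I l (\<lambda>t. poly (p l) t * c) = (LINT t|lborel. c * (indicator {a $ l<..<b $ l} t * poly (p l) t))"
          "?I l (\<lambda>t. c) = (LINT t|lborel. c * (indicator {a $ l<..<b $ l} t * 1))"
          by (simp_all add: mult_ac)
        then show ?thesis using 2 by (simp add: mult_ac)
      qed
    qed
    have "(LINT x|lebesgue_on ?U. 1) = (\<Prod>l\<in>UNIV. ?I l (\<lambda>t. 1))"
      using integral_prod_box[of "\<lambda>l t. 1" a b] by simp
    moreover have "(LINT x|lebesgue_on ?U. ?P p x * ?P q x) = (\<Prod>l\<in>UNIV. ?I l (\<lambda>t. poly (p l) t * poly (q l) t))"
      using integral_prod_box[of "\<lambda>l t. poly (p l) t * poly (q l) t" a b]
      by (simp add: prod.distrib continuous_intros)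
    moreover have "(LINT x|lebesgue_on ?U. ?P s x) = (\<Prod>l\<in>UNIV. ?I l (poly (s l)))" for s
      by (rule integral_prod_box) (intro continuous_intros)
    ultimately show ?thesis using one by (simp only: prod.distrib[symmetric])
  qed
  have step: "(LINT x|lebesgue_on ?U. 1) * (LINT x|lebesgue_on ?U. ?P p x * g x) =
      (LINT x|lebesgue_on ?U. ?P p x) * (LINT x|lebesgue_on ?U. g x)"
    if d: "\<And>i. degree (p i) \<le> r i" for p
    using g
  proof (induction g rule: tens.induct)
    case (tens_step g q)
    have "(LINT x|lebesgue_on ?U. ?P p x * (g x + ?P q x)) =
        (LINT x|lebesgue_on ?U. ?P p x * g x) + (LINT x|lebesgue_on ?U. ?P p x * ?P q x)"
      unfolding distrib_left using tens_step d
      by (intro Bochner_Integration.integral_add sq_mult sq[OF tens_prod] sq)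
    moreover have "(LINT x|lebesgue_on ?U. g x + ?P q x) =
        (LINT x|lebesgue_on ?U. g x) + (LINT x|lebesgue_on ?U. ?P q x)"
      using tens_step by (intro Bochner_Integration.integral_add int[OF tens_prod] int)
    ultimately show ?case using tens_step.IH prods[OF d tens_step.hyps(2)] by (simp only: distrib_left)
  qed simp
  show ?thesis
    using f
  proof (induction f rule: tens.induct)
    case (tens_step f p)
    have "(LINT x|lebesgue_on ?U. (f x + ?P p x) * g x) =
        (LINT x|lebesgue_on ?U. f x * g x) + (LINT x|lebesgue_on ?U. ?P p x * g x)"
      unfolding distrib_right using tens_step
      by (intro Bochner_Integration.integral_add sq_mult sq[OF tens_prod] sq[OF g] sq)
    moreover have "(LINT x|lebesgue_on ?U. f x + ?P p x) =
        (LINT x|lebesgue_on ?U. f x) + (LINT x|lebesgue_on ?U. ?P p x)"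
      using tens_step by (intro Bochner_Integration.integral_add int[OF tens_prod] int)
    ultimately show ?case using tens_step.IH step[OF tens_step.hyps(2)] by (simp only: distrib_left distrib_right)
  qed simp
qed


section \<open>Pairing of piecewise polynomial forms on a box\<close>

text \<open>The degree bounds of polynomials that are multilinear in the variables of \<open>A\<close> and free of the others.\<close>

definition ind :: "('n::finite) set \<Rightarrow> 'n \<Rightarrow> nat" where
  "ind A i = (if i \<in> A then 1 else 0)"

text \<open>The coefficient of \<open>dx\<^sup>\<alpha>\<close> is multilinear in the variables outside \<open>\<alpha>\<close>, respectively in the
  variables belonging to \<open>\<alpha>\<close>.\<close>

definition outer_form :: "('n::finite) form \<Rightarrow> bool" where
  "outer_form q \<longleftrightarrow> (\<forall>\<alpha>. (\<lambda>x. q x $ \<alpha>) \<in> tens (ind (- \<alpha>)))"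

definition inner_form :: "('n::finite) form \<Rightarrow> bool" where
  "inner_form r \<longleftrightarrow> (\<forall>\<alpha>. (\<lambda>x. r x $ \<alpha>) \<in> tens (ind \<alpha>))"

lemma outer_form_C1: "outer_form q \<Longrightarrow> C1_form q"
  by (auto simp: outer_form_def C1_form_def intro: tens_C1)

lemma inner_form_C1: "inner_form q \<Longrightarrow> C1_form q"
  by (auto simp: inner_form_def C1_form_def intro: tens_C1)

lemma Q1m_outer_form:
  assumes "q \<in> Q1m_forms k"
  shows "outer_form q"
  unfolding outer_form_def
proof
  fix \<alpha>
  show "(\<lambda>x. q x $ \<alpha>) \<in> tens (ind (- \<alpha>))"
  proof (cases "card \<alpha> = k")
    case True
    have "(\<lambda>i. 1 - (if i \<in> \<alpha> then 1 else 0)) = ind (- \<alpha>)" by (auto simp: ind_def)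
    then show ?thesis using assms True tensor_polys_tens by (fastforce simp: Q1m_forms_def)
  next
    case False
    then have "(\<lambda>x. q x $ \<alpha>) = (\<lambda>x. 0)" using assms by (auto simp: Q1m_forms_def covectors_def)
    then show ?thesis by (simp add: tens_zero)
  qed
qed

text \<open>No bound on the degree is needed: \<open>\<star>\<close> exchanges \<open>\<alpha>\<close> with its complement in every degree.\<close>

lemma Q1m_star_inner_form:
  assumes "r \<in> Q1m_star_forms k"
  shows "inner_form r"
proof -
  obtain w where w: "w \<in> Q1m_forms (CARD('a) - k)" and r: "r = (\<lambda>x. hodge (w x))"
    using assms by (auto simp: Q1m_star_forms_def)
  have "(\<lambda>x. w x $ (- \<alpha>)) \<in> tens (ind \<alpha>)" for \<alpha>
    using Q1m_outer_form[OF w] by (metis outer_form_def double_complement)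
  then show ?thesis by (simp add: inner_form_def r hodge_nth tens_cmult)
qed

text \<open>Differentiation of the coefficient of \<open>dx\<^bsup>\<beta> - {i}\<^esup>\<close> with respect to \<open>x\<^sub>i\<close> removes the dependence
  on \<open>x\<^sub>i\<close>, because the degree in each variable is at most one.\<close>

lemma classical_d_outer:
  assumes "outer_form q"
  shows "outer_form (classical_op dcoef q)"
  unfolding outer_form_def
proof
  fix \<beta>
  have "(\<lambda>x. dcoef \<beta> i \<alpha> * partial_deriv i (\<lambda>x. q x $ \<alpha>) x) \<in> tens (ind (- \<beta>))" for i \<alpha>
  proof (cases "i \<in> \<beta> \<and> \<alpha> = \<beta> - {i}")
    case True
    then have "(ind (- \<alpha>))(i := ind (- \<alpha>) i - 1) = ind (- \<beta>)" by (auto simp: ind_def fun_eq_iff)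
    then show ?thesis
      using assms tens_partial[of "\<lambda>x. q x $ \<alpha>" "ind (- \<alpha>)" i] by (intro tens_cmult) (simp add: outer_form_def)
  qed (auto simp: dcoef_def tens_zero)
  then show "(\<lambda>x. classical_op dcoef q x $ \<beta>) \<in> tens (ind (- \<beta>))"
    unfolding classical_op_def by (simp add: tens_sum)
qed

lemma classical_codiff_inner:
  assumes "inner_form r"
  shows "inner_form (classical_op (adj dcoef) r)"
  unfolding inner_form_def
proof
  fix \<alpha>
  have "(\<lambda>x. adj dcoef \<alpha> i \<beta> * partial_deriv i (\<lambda>x. r x $ \<beta>) x) \<in> tens (ind \<alpha>)" for i \<beta>
  proof (cases "i \<in> \<beta> \<and> \<alpha> = \<beta> - {i}")
    case True
    then have "(ind \<beta>)(i := ind \<beta> i - 1) = ind \<alpha>" by (auto simp: ind_def fun_eq_iff)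
    then show ?thesis
      using assms tens_partial[of "\<lambda>x. r x $ \<beta>" "ind \<beta>" i] by (intro tens_cmult) (simp add: inner_form_def)
  qed (auto simp: adj_def dcoef_def tens_zero)
  then show "(\<lambda>x. classical_op (adj dcoef) r x $ \<alpha>) \<in> tens (ind \<alpha>)"
    unfolding classical_op_def by (simp add: tens_sum)
qed

text \<open>The Lebesgue measure of \<open>U\<close>.\<close>

definition vol :: "(real ^ 'n::finite) set \<Rightarrow> real" where
  "vol U = (LINT x|lebesgue_on U. 1)"

lemma vol_box_pos:
  fixes a b :: "real ^ 'n::finite"
  assumes "box a b \<noteq> {}"
  shows "vol (box a b) > 0"
proof -
  have "vol (box a b) = measure lborel (box a b)" by (simp add: vol_def measure_restrict_space)
  also have "\<dots> > 0" using assms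
    by (auto simp: measure_lborel_box_eq box_ne_empty inner_diff_left intro!: prod_pos less_imp_le)
  finally show ?thesis .
qed

lemma pairing_means:
  fixes q r :: "('n::finite) form" and a b :: "real ^ 'n"
  assumes "outer_form q" "inner_form r"
  shows "vol (box a b) * L2_inner (box a b) q r =
    (\<Sum>\<alpha>\<in>UNIV. (LINT x|lebesgue_on (box a b). q x $ \<alpha>) * (LINT x|lebesgue_on (box a b). r x $ \<alpha>))"
proof -
  have "q \<in> L2 (box a b)" using assms(1) by (intro C1_form_L2 outer_form_C1 bounded_box open_box)
  moreover have "r \<in> L2 (box a b)" using assms(2) by (intro C1_form_L2 inner_form_C1 bounded_box open_box)
  ultimately show ?thesis
    unfolding vol_def L2_inner_eq_sum[OF \<open>q \<in> _\<close> \<open>r \<in> _\<close>] sum_distrib_left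
    using assms by (intro sum.cong refl tens_uncorrelated[where r="ind (- _)" and r'="ind _"])
      (auto simp: outer_form_def inner_form_def ind_def)
qed

text \<open>The bilinear form \<open>\<langle>dq, r\<rangle> - \<langle>q, \<delta>r\<rangle>\<close> on a box sees only the means of \<open>q\<close> and \<open>dq\<close>.\<close>

lemma pairing_cong:
  fixes a b :: "real ^ 'n::{finite,linorder}"
  assumes ne: "box a b \<noteq> {}" and q: "outer_form q" "outer_form q'" and r: "inner_form r"
    and m: "\<And>\<alpha>. (LINT x|lebesgue_on (box a b). q x $ \<alpha>) = (LINT x|lebesgue_on (box a b). q' x $ \<alpha>)"
    and dm: "\<And>\<alpha>. (LINT x|lebesgue_on (box a b). classical_op dcoef q x $ \<alpha>) =
      (LINT x|lebesgue_on (box a b). classical_op dcoef q' x $ \<alpha>)"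
  shows "L2_inner (box a b) (classical_op dcoef q) r = L2_inner (box a b) (classical_op dcoef q') r"
    "L2_inner (box a b) q (classical_op (adj dcoef) r) = L2_inner (box a b) q' (classical_op (adj dcoef) r)"
proof -
  note P = pairing_means[OF classical_d_outer[OF q(1)] r, of a b] pairing_means[OF classical_d_outer[OF q(2)] r, of a b]
    pairing_means[OF q(1) classical_codiff_inner[OF r], of a b] pairing_means[OF q(2) classical_codiff_inner[OF r], of a b]
  have v: "vol (box a b) \<noteq> 0" using vol_box_pos[OF ne] by simp
  have "vol (box a b) * L2_inner (box a b) (classical_op dcoef q) r = vol (box a b) * L2_inner (box a b) (classical_op dcoef q') r"
    unfolding P(1,2) dm ..
  then show "L2_inner (box a b) (classical_op dcoef q) r = L2_inner (box a b) (classical_op dcoef q') r"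
    using v by simp
  have "vol (box a b) * L2_inner (box a b) q (classical_op (adj dcoef) r) =
      vol (box a b) * L2_inner (box a b) q' (classical_op (adj dcoef) r)"
    unfolding P(3,4) m ..
  then show "L2_inner (box a b) q (classical_op (adj dcoef) r) = L2_inner (box a b) q' (classical_op (adj dcoef) r)"
    using v by simp
qed


section \<open>Means and Whitney forms\<close>

text \<open>The mean of a form, taken componentwise, and the centroid of \<open>U\<close>.\<close>

definition fmean :: "(real ^ 'n::finite) set \<Rightarrow> 'n form \<Rightarrow> 'n covector" where
  "fmean U \<omega> = (\<chi> \<alpha>. (LINT x|lebesgue_on U. \<omega> x $ \<alpha>) / vol U)"

definition centre :: "(real ^ 'n::finite) set \<Rightarrow> real ^ 'n" where
  "centre U = (\<chi> i. (LINT x|lebesgue_on U. x $ i) / vol U)"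

text \<open>For constant \<open>c\<close> and \<open>e\<close> of degrees \<open>k\<close> and \<open>k + 1\<close>: the Whitney form with mean \<open>c\<close> on \<open>U\<close> and
  exterior derivative \<open>e\<close>. Centring \<open>\<kappa> e\<close> at the centroid makes its mean vanish, and the factor
  \<open>1 / (k + 1)\<close> is due to \<open>d\<kappa>e = (k + 1) e\<close>.\<close>

definition whitney ::
    "(real ^ 'n::{finite,linorder}) set \<Rightarrow> nat \<Rightarrow> 'n covector \<Rightarrow> 'n covector \<Rightarrow> 'n form" where
  "whitney U k c e x = c + (1 / real (k + 1)) *\<^sub>R (koszul (\<lambda>_. e) x - koszul (\<lambda>_. e) (centre U))"

lemma koszul_nth:
  "koszul \<omega> x $ \<alpha> = (\<Sum>i\<in>UNIV. (if i \<in> \<alpha> then 0 else \<omega> x $ insert i \<alpha> * wedge_sign {i} \<alpha>) * x $ i)"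
proof -
  have "koszul \<omega> x $ \<alpha> = (\<Sum>\<gamma>\<in>UNIV. \<Sum>i\<in>UNIV. if i \<in> \<gamma> \<and> \<alpha> = \<gamma> - {i}
      then \<omega> x $ \<gamma> * wedge_sign {i} (\<gamma> - {i}) * x $ i else 0)"
    unfolding koszul_def sum_component
  proof (rule sum.cong[OF refl])
    fix \<gamma> :: "'a set"
    have "(\<Sum>i\<in>\<gamma>. ((\<omega> x $ \<gamma> * wedge_sign {i} (\<gamma> - {i}) * x $ i) *\<^sub>R dx (\<gamma> - {i})) $ \<alpha>) =
        (\<Sum>i\<in>UNIV. if i \<in> \<gamma> then ((\<omega> x $ \<gamma> * wedge_sign {i} (\<gamma> - {i}) * x $ i) *\<^sub>R dx (\<gamma> - {i})) $ \<alpha> else 0)"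
      by (simp add: sum.If_cases)
    also have "\<dots> = (\<Sum>i\<in>UNIV. if i \<in> \<gamma> \<and> \<alpha> = \<gamma> - {i}
        then \<omega> x $ \<gamma> * wedge_sign {i} (\<gamma> - {i}) * x $ i else 0)"
      by (intro sum.cong refl) (auto simp: dx_def axis_def)
    finally show "(\<Sum>i\<in>\<gamma>. ((\<omega> x $ \<gamma> * wedge_sign {i} (\<gamma> - {i}) * x $ i) *\<^sub>R dx (\<gamma> - {i})) $ \<alpha>) =
      (\<Sum>i\<in>UNIV. if i \<in> \<gamma> \<and> \<alpha> = \<gamma> - {i}
        then \<omega> x $ \<gamma> * wedge_sign {i} (\<gamma> - {i}) * x $ i else 0)" .
  qed
  also have "\<dots> = (\<Sum>i\<in>UNIV. \<Sum>\<gamma>\<in>UNIV. if \<gamma> = insert i \<alpha>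
      then (if i \<in> \<alpha> then 0 else \<omega> x $ insert i \<alpha> * wedge_sign {i} \<alpha>) * x $ i else 0)"
    by (subst sum.swap) (intro sum.cong refl, auto)
  finally show ?thesis by simp
qed

lemma koszul_const_add: "koszul (\<lambda>_. c + e) x = koszul (\<lambda>_. c) x + koszul (\<lambda>_. e) x"
  by (simp add: vec_eq_iff koszul_nth sum.distrib[symmetric] algebra_simps if_distrib cong: if_cong)
     (auto intro!: sum.cong simp: algebra_simps)

lemma koszul_const_scale: "koszul (\<lambda>_. s *\<^sub>R e) x = s *\<^sub>R koszul (\<lambda>_. e) x"
  by (simp add: vec_eq_iff koszul_nth sum_distrib_left) (auto intro!: sum.cong)

lemma whitney_nth:
  "whitney U k c e x $ \<alpha> = c $ \<alpha> + (\<Sum>i\<in>UNIV.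
    (if i \<in> \<alpha> then 0 else e $ insert i \<alpha> * wedge_sign {i} \<alpha>) / real (k + 1) * (x $ i - centre U $ i))"
proof -
  define A where "A i = (if i \<in> \<alpha> then 0 else e $ insert i \<alpha> * wedge_sign {i} \<alpha>)" for i
  have "whitney U k c e x $ \<alpha> =
      c $ \<alpha> + (1 / real (k + 1)) * ((\<Sum>i\<in>UNIV. A i * x $ i) - (\<Sum>i\<in>UNIV. A i * centre U $ i))"
    by (simp add: whitney_def koszul_nth A_def)
  also have "\<dots> = c $ \<alpha> + (\<Sum>i\<in>UNIV. A i / real (k + 1) * (x $ i - centre U $ i))"
    by (simp add: sum_subtractf[symmetric] sum_divide_distrib right_diff_distrib diff_divide_distrib)
  finally show ?thesis by (simp add: A_def)
qed

lemma whitney_diff: "whitney U k c e x - whitney U k c' e' x = whitney U k (c - c') (e - e') x"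
proof -
  have "koszul (\<lambda>_. e - e') x = koszul (\<lambda>_. e) x - koszul (\<lambda>_. e') x" for x
    using koszul_const_add[of "e - e'" e' x] by simp
  then show ?thesis by (simp only: whitney_def) (simp add: algebra_simps)
qed

lemma whitney_outer_form: "outer_form (whitney U k c e)"
  unfolding outer_form_def
proof
  fix \<alpha>
  define A where "A i = (if i \<in> \<alpha> then 0 else e $ insert i \<alpha> * wedge_sign {i} \<alpha>) / real (k + 1)" for i
  have "whitney U k c e x $ \<alpha> = (\<Sum>i\<in>UNIV. A i * x $ i) + (c $ \<alpha> - (\<Sum>i\<in>UNIV. A i * centre U $ i))" for x
    unfolding whitney_nth A_def[symmetric] by (simp add: right_diff_distrib sum_subtractf)
  moreover have "(\<lambda>x. A i * x $ i) \<in> tens (ind (- \<alpha>))" for i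
  proof (cases "i \<in> \<alpha>")
    case False
    then show ?thesis by (intro tens_cmult tens_var) (simp add: ind_def)
  qed (simp add: A_def tens_zero)
  ultimately show "(\<lambda>x. whitney U k c e x $ \<alpha>) \<in> tens (ind (- \<alpha>))"
    by (simp only:) (intro tens_add[OF tens_const tens_sum])
qed

lemma whitney_partial:
  "partial_deriv i (\<lambda>x. whitney U k c e x $ \<alpha>) x =
    (if i \<in> \<alpha> then 0 else e $ insert i \<alpha> * wedge_sign {i} \<alpha>) / real (k + 1)"
proof -
  let ?a = "\<lambda>i. (if i \<in> \<alpha> then 0 else e $ insert i \<alpha> * wedge_sign {i} \<alpha>) / real (k + 1)"
  have "((\<lambda>x. c $ \<alpha> + (\<Sum>i\<in>UNIV. ?a i * (x $ i - centre U $ i))) has_derivative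
      (\<lambda>h. \<Sum>i\<in>UNIV. ?a i * h $ i)) (at x)"
    by (auto intro!: derivative_eq_intros bounded_linear.has_derivative[OF bounded_linear_vec_nth])
  then have "partial_deriv i (\<lambda>x. whitney U k c e x $ \<alpha>) x = (\<Sum>j\<in>UNIV. ?a j * axis i 1 $ j)"
    unfolding whitney_nth by (rule partial_derivI)
  also have "\<dots> = (\<Sum>j\<in>UNIV. if j = i then ?a j else 0)" by (intro sum.cong) (auto simp: axis_def)
  finally show ?thesis by simp
qed

lemma whitney_d:
  assumes "e \<in> covectors (k + 1)"
  shows "classical_op dcoef (whitney U k c e) = (\<lambda>_. e)"
proof -
  have "(\<Sum>\<alpha>\<in>UNIV. \<Sum>i\<in>UNIV. dcoef \<beta> i \<alpha> * partial_deriv i (\<lambda>x. whitney U k c e x $ \<alpha>) x) = e $ \<beta>" for \<beta> x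
  proof -
    have "(\<Sum>\<alpha>\<in>UNIV. \<Sum>i\<in>UNIV. dcoef \<beta> i \<alpha> * partial_deriv i (\<lambda>x. whitney U k c e x $ \<alpha>) x) =
      (\<Sum>i\<in>UNIV. \<Sum>\<alpha>\<in>UNIV. if \<alpha> = \<beta> - {i} then (if i \<in> \<beta> then e $ \<beta> / real (k + 1) else 0) else 0)"
    proof (subst sum.swap, intro sum.cong refl)
      fix i \<alpha>
      show "dcoef \<beta> i \<alpha> * partial_deriv i (\<lambda>x. whitney U k c e x $ \<alpha>) x =
          (if \<alpha> = \<beta> - {i} then (if i \<in> \<beta> then e $ \<beta> / real (k + 1) else 0) else 0)"
        using wedge_sign_square[of "{i}" "\<beta> - {i}"]
        by (auto simp: dcoef_def whitney_partial insert_absorb)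
    qed
    also have "\<dots> = real (card \<beta>) * (e $ \<beta> / real (k + 1))" by (simp add: sum.If_cases)
    also have "\<dots> = e $ \<beta>" using assms by (cases "card \<beta> = k + 1") (auto simp: covectors_def)
    finally show ?thesis .
  qed
  then show ?thesis by (simp add: classical_op_def fun_eq_iff vec_eq_iff)
qed

lemma koszul_const_covectors:
  fixes e :: "('n::{finite,linorder}) covector"
  assumes "e \<in> covectors (k + 1)"
  shows "koszul (\<lambda>_. e) x \<in> covectors k"
  unfolding covectors_def
proof (intro CollectI allI impI)
  fix \<alpha> :: "'n set" assume "card \<alpha> \<noteq> k"
  then have "(if i \<in> \<alpha> then 0 else e $ insert i \<alpha> * wedge_sign {i} \<alpha>) = 0" for i
    using assms by (auto simp: covectors_def)
  then show "koszul (\<lambda>_. e) x $ \<alpha> = 0" unfolding koszul_nth by (intro sum.neutral) (metis mult_zero_left)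
qed

lemma whitney_P1m:
  fixes c e :: "('n::{finite,linorder}) covector"
  assumes "c \<in> covectors k" "e \<in> covectors (k + 1)"
  shows "whitney U k c e \<in> P1m_forms k"
proof -
  let ?s = "1 / real (k + 1)"
  define p q where "p = (\<lambda>x :: (real, 'n) vec. c - ?s *\<^sub>R koszul (\<lambda>_. e) (centre U))"
    and "q = (\<lambda>x :: (real, 'n) vec. ?s *\<^sub>R e)"
  have "p \<in> P0_forms k"
    using assms koszul_const_covectors[OF assms(2), of "centre U"] by (auto simp: p_def P0_forms_def covectors_def)
  moreover have "q \<in> P0_forms (k + 1)"
    using assms by (auto simp: q_def P0_forms_def covectors_def)
  moreover have "whitney U k c e = (\<lambda>x. p x + koszul q x)"
    unfolding p_def q_def koszul_const_scale by (simp add: whitney_def fun_eq_iff algebra_simps)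
  ultimately show ?thesis unfolding P1m_forms_def by blast
qed

lemma P1m_whitney:
  fixes U :: "(real ^ 'n::{finite,linorder}) set" and p :: "'n form"
  assumes "p \<in> P1m_forms k"
  obtains c e where "c \<in> covectors k" "e \<in> covectors (k + 1)" "p = whitney U k c e"
proof -
  obtain c0 e0 where c0: "c0 \<in> covectors k" and e0: "e0 \<in> covectors (k + 1)"
    and p: "p = (\<lambda>x. c0 + koszul (\<lambda>_. e0) x)"
    using assms by (auto simp: P1m_forms_def P0_forms_def)
  have "c0 + koszul (\<lambda>_. e0) (centre U) \<in> covectors k"
    using c0 koszul_const_covectors[OF e0, of "centre U"] by (auto simp: covectors_def)
  moreover have "real (k + 1) *\<^sub>R e0 \<in> covectors (k + 1)" using e0 by (auto simp: covectors_def)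
  moreover have "p = whitney U k (c0 + koszul (\<lambda>_. e0) (centre U)) (real (k + 1) *\<^sub>R e0)"
    unfolding p whitney_def koszul_const_scale by (simp add: fun_eq_iff scaleR_diff_right[symmetric])
  ultimately show ?thesis by (rule that)
qed

lemma whitney_mean:
  assumes U: "open U" "bounded U" and v: "vol U > 0"
  shows "fmean U (whitney U k c e) = c"
proof -
  have i: "integrable (lebesgue_on U) (\<lambda>x. x $ i)" for i
    using U by (intro sq_integrable sq_continuous) (auto intro!: continuous_intros)
  have c: "integrable (lebesgue_on U) (\<lambda>x. s)" for s :: real
    using U by (intro sq_integrable sq_const)
  have s: "(LINT x|lebesgue_on U. s) = s * vol U" for s :: real
    unfolding vol_def using integral_mult_right_zero[of "lebesgue_on U" s "\<lambda>_. 1"] by simp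
  have "(LINT x|lebesgue_on U. x $ i - centre U $ i) = 0" for i
  proof -
    have "(LINT x|lebesgue_on U. x $ i - centre U $ i) = (LINT x|lebesgue_on U. x $ i) - (LINT x|lebesgue_on U. centre U $ i)"
      by (rule Bochner_Integration.integral_diff[OF i c])
    also have "\<dots> = 0" unfolding s using v by (simp add: centre_def)
    finally show ?thesis .
  qed
  moreover have d: "integrable (lebesgue_on U) (\<lambda>x. x $ i - centre U $ i)" for i
    using i c by (rule Bochner_Integration.integrable_diff)
  ultimately have "(LINT x|lebesgue_on U. (\<Sum>i\<in>UNIV. A i * (x $ i - centre U $ i))) = 0" for A
    by (subst Bochner_Integration.integral_sum) auto
  moreover have "(LINT x|lebesgue_on U. c $ \<alpha> + (\<Sum>i\<in>UNIV. A i * (x $ i - centre U $ i))) =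
      (LINT x|lebesgue_on U. c $ \<alpha>) + (LINT x|lebesgue_on U. (\<Sum>i\<in>UNIV. A i * (x $ i - centre U $ i)))" for A \<alpha>
    by (intro Bochner_Integration.integral_add Bochner_Integration.integrable_sum integrable_mult_right c d)
  ultimately have "(LINT x|lebesgue_on U. whitney U k c e x $ \<alpha>) = c $ \<alpha> * vol U" for \<alpha>
    unfolding whitney_nth s by (simp only: add_0_right)
  then show ?thesis using v by (simp add: fmean_def vec_eq_iff)
qed

lemma fmean_diff:
  assumes "open U" "bounded U" "\<omega> \<in> L2 U" "\<eta> \<in> L2 U"
  shows "fmean U (\<lambda>x. \<omega> x - \<eta> x) = fmean U \<omega> - fmean U \<eta>"
proof -
  have i: "integrable (lebesgue_on U) (\<lambda>x. \<zeta> x $ \<alpha>)" if "\<zeta> \<in> L2 U" for \<zeta> \<alpha>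
    using assms(1,2) L2_comp[OF that] by (rule sq_integrable)
  show ?thesis using i[OF assms(3)] i[OF assms(4)]
    by (simp add: fmean_def vec_eq_iff diff_divide_distrib)
qed

lemma fmean_cong_AE:
  assumes "\<omega> \<in> L2 U" "\<eta> \<in> L2 U" "AE x in lebesgue_on U. \<omega> x = \<eta> x"
  shows "fmean U \<omega> = fmean U \<eta>"
proof -
  have "(LINT x|lebesgue_on U. \<omega> x $ \<alpha>) = (LINT x|lebesgue_on U. \<eta> x $ \<alpha>)" for \<alpha>
  proof (rule integral_cong_AE)
    show "AE x in lebesgue_on U. \<omega> x $ \<alpha> = \<eta> x $ \<alpha>" using assms(3) by eventually_elim simp
  qed (use assms(1,2) L2_comp in \<open>auto simp: sq_def\<close>)
  then show ?thesis by (simp add: fmean_def)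
qed

lemma fmean_covectors:
  assumes "AE x in lebesgue_on U. \<omega> x \<in> covectors k"
  shows "fmean U \<omega> \<in> covectors k"
proof -
  have "(LINT x|lebesgue_on U. \<omega> x $ \<alpha>) = 0" if "card \<alpha> \<noteq> k" for \<alpha>
    by (rule integral_eq_zero_AE) (use assms that in \<open>auto simp: covectors_def elim!: eventually_mono\<close>)
  then show ?thesis by (simp add: fmean_def covectors_def)
qed

text \<open>Jensen's inequality, from the orthogonality of \<open>\<omega> - fmean U \<omega>\<close> to constants.\<close>

lemma fmean_bound:
  assumes U: "open U" "bounded U" and v: "vol U > 0" and L: "\<omega> \<in> L2 U"
  shows "vol U * (fmean U \<omega> \<bullet> fmean U \<omega>) \<le> L2_inner U \<omega> \<omega>"
proof -
  let ?m = "\<lambda>_. fmean U \<omega>"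
  have m: "?m \<in> L2 U" using U by (intro L2_continuous) auto
  have vv: "L2_inner U ?m ?m = vol U * (fmean U \<omega> \<bullet> fmean U \<omega>)"
    unfolding L2_inner_def vol_def
    using integral_mult_left_zero[of "lebesgue_on U" "\<lambda>_. 1" "fmean U \<omega> \<bullet> fmean U \<omega>"] by simp
  have "L2_inner U \<omega> ?m = (\<Sum>\<alpha>\<in>UNIV. (LINT x|lebesgue_on U. \<omega> x $ \<alpha>) * fmean U \<omega> $ \<alpha>)"
    by (simp add: L2_inner_eq_sum[OF L m])
  also have "\<dots> = vol U * (fmean U \<omega> \<bullet> fmean U \<omega>)"
    using v by (simp add: fmean_def inner_vec_def sum_distrib_left)
  finally have c: "L2_inner U \<omega> ?m = vol U * (fmean U \<omega> \<bullet> fmean U \<omega>)" .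
  have c': "L2_inner U ?m \<omega> = L2_inner U \<omega> ?m" by (simp add: L2_inner_def inner_commute)
  have "0 \<le> L2_inner U (\<lambda>x. \<omega> x - ?m x) (\<lambda>x. \<omega> x - ?m x)" by (rule L2_inner_nonneg)
  also have "\<dots> = L2_inner U \<omega> \<omega> - vol U * (fmean U \<omega> \<bullet> fmean U \<omega>)"
    using L m L2_diff[OF L m] by (simp add: L2_inner_diff_left L2_inner_diff_right c c' vv)
  finally show ?thesis by simp
qed


section \<open>The local projection onto Whitney forms\<close>

text \<open>The square of the graph norm of \<open>d\<close> on \<open>U\<close>.\<close>

definition graph_sq :: "(real ^ 'n::{finite,linorder}) set \<Rightarrow> 'n form \<Rightarrow> real" where
  "graph_sq U \<omega> = L2_inner U \<omega> \<omega> + L2_inner U (wop dcoef U \<omega>) (wop dcoef U \<omega>)"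

lemma graph_sq_nonneg: "0 \<le> graph_sq U \<omega>"
  by (simp add: graph_sq_def L2_inner_nonneg)

lemma graph_sq_diff_le:
  assumes U: "open U" "bounded U" and s: "sob dcoef U f" "sob dcoef U g"
  shows "graph_sq U (\<lambda>x. f x - g x) \<le> 2 * graph_sq U f + 2 * graph_sq U g"
proof -
  note F = sob_wop[OF s(1)] and G = sob_wop[OF s(2)]
  note d = sob_diff[OF U s]
  have "L2_inner U (wop dcoef U (\<lambda>x. f x - g x)) (wop dcoef U (\<lambda>x. f x - g x)) =
      L2_inner U (\<lambda>x. wop dcoef U f x - wop dcoef U g x) (\<lambda>x. wop dcoef U f x - wop dcoef U g x)"
    using sob_wop(2)[OF d(1)] L2_diff[OF F(2) G(2)] d(2) by (intro L2_inner_cong_AE)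
  then show ?thesis
    using L2_inner_diff_le[OF F(1) G(1)] L2_inner_diff_le[OF F(2) G(2)] by (simp add: graph_sq_def)
qed

lemma graph_sq_cong_AE:
  assumes "open U" "bounded U" "sob dcoef U f" "AE x in lebesgue_on U. g x = f x"
  shows "graph_sq U g = graph_sq U f"
proof -
  have "L2_inner U g g = L2_inner U f f"
    using sob_wop(1)[OF assms(3)] sob_wop(1)[OF sob_cong_AE(1)[OF assms]] assms(4) by (intro L2_inner_cong_AE)
  then show ?thesis using sob_cong_AE(2)[OF assms] by (simp add: graph_sq_def)
qed

lemma fmean_const:
  assumes "vol U > 0" shows "fmean U (\<lambda>_. e) = e"
proof -
  have "(LINT x|lebesgue_on U. s) = s * vol U" for s :: real
    unfolding vol_def using integral_mult_right_zero[of "lebesgue_on U" s "\<lambda>_. 1"] by simp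
  then show ?thesis using assms by (simp add: fmean_def vec_eq_iff del: lebesgue_integral_const)
qed

lemma fmean_eqD:
  assumes "vol U > 0" "fmean U f = fmean U g"
  shows "(LINT x|lebesgue_on U. f x $ \<alpha>) = (LINT x|lebesgue_on U. g x $ \<alpha>)"
  using assms(1) arg_cong[OF assms(2), of "\<lambda>v. v $ \<alpha>"] by (simp add: fmean_def)

text \<open>A bound for the norm of \<open>e \<mapsto> whitney U k 0 e x\<close> when \<open>U\<close> lies in the ball of radius \<open>R\<close> around
  the origin: the covector has \<open>2\<^sup>n\<close> components, each a sum of at most \<open>n\<close> terms, and
  \<open>|x\<^sub>i - z\<^sub>i| \<le> 2 R\<close>.\<close>

definition whitney_const :: "'n::finite itself \<Rightarrow> real \<Rightarrow> real" where
  "whitney_const _ R = real (CARD('n set)) * (real (CARD('n)) * (2 * R))"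

lemma whitney_pointwise:
  fixes U :: "(real ^ 'n::{finite,linorder}) set"
  assumes U: "open U" "bounded U" and v: "vol U > 0" and R: "\<And>x. x \<in> U \<Longrightarrow> norm x \<le> R" and x: "x \<in> U"
  shows "norm (whitney U k 0 e x) \<le> whitney_const TYPE('n) R * norm e"
proof -
  have R0: "R \<ge> 0" using R[OF x] norm_ge_zero[of x] by linarith
  have z: "\<bar>centre U $ i\<bar> \<le> R" for i
  proof -
    have i: "integrable (lebesgue_on U) (\<lambda>x. x $ i)"
      using U by (intro sq_integrable sq_continuous) (auto intro!: continuous_intros)
    have c: "integrable (lebesgue_on U) (\<lambda>x. R * 1)"
      using U sq_integrable[OF U sq_const[OF U, of R]] by simp
    have "\<bar>LINT x|lebesgue_on U. x $ i\<bar> \<le> (LINT x|lebesgue_on U. \<bar>x $ i\<bar>)" by (rule integral_abs_bound)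
    also have "\<dots> \<le> (LINT x|lebesgue_on U. R * 1)"
    proof (rule Bochner_Integration.integral_mono[OF integrable_abs[OF i] c])
      fix x assume "x \<in> space (lebesgue_on U)"
      then have "x \<in> U" using U by (simp add: space_restrict_space)
      then show "\<bar>x $ i\<bar> \<le> R * 1" using R[of x] component_le_norm_cart[of x i] by simp
    qed
    also have "\<dots> = R * vol U" unfolding vol_def by (rule integral_mult_right_zero)
    finally show ?thesis using v by (simp add: centre_def pos_divide_le_eq)
  qed
  have c: "\<bar>whitney U k 0 e x $ \<alpha>\<bar> \<le> real (CARD('n)) * (2 * R) * norm e" for \<alpha>
  proof -
    define A where "A i = (if i \<in> \<alpha> then 0 else e $ insert i \<alpha> * wedge_sign {i} \<alpha>)" for i
    have T: "\<bar>A i / real (k + 1) * (x $ i - centre U $ i)\<bar> \<le> norm e * (2 * R)" for i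
    proof -
      have "\<bar>wedge_sign {i} \<alpha>\<bar> = 1" by (simp add: wedge_sign_def power_abs)
      then have A: "\<bar>A i\<bar> \<le> norm e"
        using component_le_norm_cart[of e "insert i \<alpha>"] by (simp add: A_def abs_mult)
      have "\<bar>A i\<bar> / real (k + 1) \<le> \<bar>A i\<bar> / 1" by (intro divide_left_mono) auto
      then have "\<bar>A i / real (k + 1)\<bar> \<le> norm e" using A by (simp add: abs_divide)
      moreover have "\<bar>x $ i - centre U $ i\<bar> \<le> 2 * R"
        using z[of i] R[OF x] component_le_norm_cart[of x i] by linarith
      ultimately show ?thesis unfolding abs_mult by (intro mult_mono) auto
    qed
    have "whitney U k 0 e x $ \<alpha> = (\<Sum>i\<in>UNIV. A i / real (k + 1) * (x $ i - centre U $ i))"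
      by (simp only: whitney_nth A_def zero_index add_0_left)
    then have "\<bar>whitney U k 0 e x $ \<alpha>\<bar> \<le> (\<Sum>i\<in>UNIV. \<bar>A i / real (k + 1) * (x $ i - centre U $ i)\<bar>)"
      by (simp only: sum_abs)
    also have "\<dots> \<le> real (CARD('n)) * (norm e * (2 * R))"
      using T by (intro sum_bounded_above)
    finally show ?thesis by (simp only: mult_ac)
  qed
  have "norm (whitney U k 0 e x) \<le> (\<Sum>\<alpha>\<in>UNIV. \<bar>whitney U k 0 e x $ \<alpha>\<bar>)" by (rule norm_le_l1_cart)
  also have "\<dots> \<le> real (CARD('n set)) * (real (CARD('n)) * (2 * R) * norm e)"
    using c by (intro sum_bounded_above) 
  finally show ?thesis by (simp add: whitney_const_def mult.assoc)
qed

lemma whitney_graph_sq: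
  fixes U :: "(real ^ 'n::{finite,linorder}) set"
  assumes U: "open U" "bounded U" and v: "vol U > 0" and R: "\<And>x. x \<in> U \<Longrightarrow> norm x \<le> R"
    and e: "e \<in> covectors (k + 1)"
  shows "graph_sq U (whitney U k c e) \<le>
    (3 + 2 * (whitney_const TYPE('n) R)\<^sup>2) * (vol U * (c \<bullet> c) + vol U * (e \<bullet> e))"
proof -
  let ?L = "whitney_const TYPE('n) R" and ?W = "whitney U k c e"
  have C: "C1_form ?W" by (rule outer_form_C1[OF whitney_outer_form])
  have W: "?W \<in> L2 U" by (rule C1_form_L2[OF U C])
  have s: "(LINT x|lebesgue_on U. s * 1) = s * vol U" for s :: real
    unfolding vol_def by (rule integral_mult_right_zero)
  have const: "integrable (lebesgue_on U) (\<lambda>x. s * 1)" for s :: real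
    using sq_integrable[OF U sq_const[OF U, of s]] by simp
  have "L2_inner U ?W ?W \<le> (LINT x|lebesgue_on U. (2 * (c \<bullet> c) + 2 * ?L\<^sup>2 * (e \<bullet> e)) * 1)"
    unfolding L2_inner_def
  proof (rule Bochner_Integration.integral_mono[OF L2_inner_integrable[OF W W] const])
    fix x assume "x \<in> space (lebesgue_on U)"
    then have x: "x \<in> U" using U by (simp add: space_restrict_space)
    define d where "d = whitney U k 0 e x"
    have "norm d \<le> ?L * norm e" unfolding d_def by (rule whitney_pointwise[OF U v R x])
    then have "(norm d)\<^sup>2 \<le> (?L * norm e)\<^sup>2" by (intro power_mono) auto
    then have d: "d \<bullet> d \<le> ?L\<^sup>2 * (e \<bullet> e)" by (simp add: power2_norm_eq_inner power_mult_distrib)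
    have "?W x = c + d" by (simp add: d_def whitney_def)
    moreover have "(c + d) \<bullet> (c + d) \<le> 2 * (c \<bullet> c) + 2 * (d \<bullet> d)"
      using inner_ge_zero[of "c - d"] by (simp add: inner_simps inner_commute)
    ultimately show "?W x \<bullet> ?W x \<le> (2 * (c \<bullet> c) + 2 * ?L\<^sup>2 * (e \<bullet> e)) * 1" using d by simp
  qed
  also have "\<dots> = 2 * (vol U * (c \<bullet> c)) + 2 * ?L\<^sup>2 * (vol U * (e \<bullet> e))" unfolding s by (simp add: algebra_simps)
  finally have 1: "L2_inner U ?W ?W \<le> \<dots>" .
  have "L2_inner U (wop dcoef U ?W) (wop dcoef U ?W) = L2_inner U (\<lambda>_. e) (\<lambda>_. e)"
    using sob_classical[OF U C, of dcoef] classical_op_L2[OF U C, of dcoef] sob_wop(2)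
    unfolding whitney_d[OF e] by (intro L2_inner_cong_AE) auto
  also have "\<dots> = vol U * (e \<bullet> e)" using s[of "e \<bullet> e"] by (simp add: L2_inner_def mult.commute del: lebesgue_integral_const)
  finally have 2: "L2_inner U (wop dcoef U ?W) (wop dcoef U ?W) = vol U * (e \<bullet> e)" .
  have "0 \<le> vol U * (c \<bullet> c)" "0 \<le> vol U * (e \<bullet> e)" "0 \<le> 2 * ?L\<^sup>2 * (vol U * (c \<bullet> c))" using v by auto
  then show ?thesis using 1 unfolding graph_sq_def 2 by (simp add: algebra_simps)
qed

text \<open>Stability of the local projection. The two properties used are that it reproduces the Whitney form
  \<open>w\<close> and that it is bounded in the graph norm, the latter applied to \<open>g = \<eta> - w\<close>.\<close>

lemma whitney_approximation:
  fixes U :: "(real ^ 'n::{finite,linorder}) set" and R :: real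
  defines "M \<equiv> 3 + 2 * (whitney_const TYPE('n) R)\<^sup>2"
  assumes U: "open U" "bounded U" and v: "vol U > 0" and R: "\<And>x. x \<in> U \<Longrightarrow> norm x \<le> R"
    and s: "sob dcoef U \<omega>" "sob dcoef U \<eta>" and e: "fmean U (wop dcoef U \<eta>) \<in> covectors (k + 1)"
    and p: "w \<in> P1m_forms k" "AE x in lebesgue_on U. p x = w x"
  shows "graph_sq U (\<lambda>x. \<omega> x - whitney U k (fmean U \<eta>) (fmean U (wop dcoef U \<eta>)) x) \<le>
    (2 + 4 * M) * (graph_sq U (\<lambda>x. \<omega> x - \<eta> x) + graph_sq U (\<lambda>x. \<omega> x - p x))"
proof -
  obtain c0 e0 where c0: "c0 \<in> covectors k" and e0: "e0 \<in> covectors (k + 1)" and w: "w = whitney U k c0 e0"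
    using P1m_whitney[OF p(1)] by blast
  let ?c = "fmean U \<eta>" and ?e = "fmean U (wop dcoef U \<eta>)"
  let ?W = "whitney U k ?c ?e"
  define g where "g x = \<eta> x - w x" for x
  have wC: "C1_form w" unfolding w by (rule outer_form_C1[OF whitney_outer_form])
  note sw = sob_classical[OF U wC, of dcoef]
  have sW: "sob dcoef U ?W" by (rule sob_classical(1)[OF U outer_form_C1[OF whitney_outer_form]])
  have sg: "sob dcoef U g" unfolding g_def by (rule sob_diff(1)[OF U s(2) sw(1)])
  have L: "\<eta> \<in> L2 U" "w \<in> L2 U" "wop dcoef U \<eta> \<in> L2 U" "wop dcoef U w \<in> L2 U" "wop dcoef U g \<in> L2 U" "g \<in> L2 U"
    using sob_wop(1,2) s(2) sw(1) sg by auto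
  have cg: "fmean U g = ?c - c0"
    unfolding g_def using fmean_diff[OF U L(1,2)] whitney_mean[OF U v, of k c0 e0] by (simp add: w)
  have "fmean U (wop dcoef U w) = fmean U (\<lambda>_. e0)"
    using sw(2) classical_op_L2[OF U wC, of dcoef] L(4) unfolding w whitney_d[OF e0] by (intro fmean_cong_AE)
  then have "fmean U (wop dcoef U w) = e0" using fmean_const[OF v] by simp
  moreover have "fmean U (wop dcoef U g) = fmean U (\<lambda>x. wop dcoef U \<eta> x - wop dcoef U w x)"
    using sob_diff(2)[OF U s(2) sw(1)] L2_diff[OF L(3,4)] L(5) unfolding g_def[abs_def] by (intro fmean_cong_AE)
  ultimately have eg: "fmean U (wop dcoef U g) = ?e - e0" using fmean_diff[OF U L(3,4)] by simp
  have ee: "?e - e0 \<in> covectors (k + 1)" using e e0 by (auto simp: covectors_def)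
  have M0: "M \<ge> 0" by (simp add: M_def)
  have "graph_sq U (\<lambda>x. ?W x - w x) = graph_sq U (whitney U k (?c - c0) (?e - e0))"
    by (simp add: w whitney_diff)
  also have "\<dots> \<le> M * (vol U * (fmean U g \<bullet> fmean U g) + vol U * (fmean U (wop dcoef U g) \<bullet> fmean U (wop dcoef U g)))"
    using whitney_graph_sq[OF U v R ee] unfolding M_def cg eg by blast
  also have "\<dots> \<le> M * graph_sq U g"
    unfolding graph_sq_def using M0 fmean_bound[OF U v L(6)] fmean_bound[OF U v L(5)]
    by (intro mult_left_mono add_mono)
  finally have 1: "graph_sq U (\<lambda>x. ?W x - w x) \<le> M * graph_sq U g" .
  have s\<omega>w: "sob dcoef U (\<lambda>x. \<omega> x - w x)" by (rule sob_diff(1)[OF U s(1) sw(1)])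
  have s\<omega>\<eta>: "sob dcoef U (\<lambda>x. \<omega> x - \<eta> x)" by (rule sob_diff(1)[OF U s])
  have sWw: "sob dcoef U (\<lambda>x. ?W x - w x)" by (rule sob_diff(1)[OF U sW sw(1)])
  have "g = (\<lambda>x. (\<omega> x - w x) - (\<omega> x - \<eta> x))" by (auto simp: g_def)
  then have 2: "graph_sq U g \<le> 2 * graph_sq U (\<lambda>x. \<omega> x - w x) + 2 * graph_sq U (\<lambda>x. \<omega> x - \<eta> x)"
    using graph_sq_diff_le[OF U s\<omega>w s\<omega>\<eta>] by simp
  have "(\<lambda>x. \<omega> x - ?W x) = (\<lambda>x. (\<omega> x - w x) - (?W x - w x))" by auto
  then have "graph_sq U (\<lambda>x. \<omega> x - ?W x) \<le> 2 * graph_sq U (\<lambda>x. \<omega> x - w x) + 2 * graph_sq U (\<lambda>x. ?W x - w x)"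
    using graph_sq_diff_le[OF U s\<omega>w sWw] by simp
  also have "\<dots> \<le> 2 * graph_sq U (\<lambda>x. \<omega> x - w x) +
      2 * (M * (2 * graph_sq U (\<lambda>x. \<omega> x - w x) + 2 * graph_sq U (\<lambda>x. \<omega> x - \<eta> x)))"
    using 1 mult_left_mono[OF 2 M0] by linarith
  also have "\<dots> \<le> (2 + 4 * M) * (graph_sq U (\<lambda>x. \<omega> x - \<eta> x) + graph_sq U (\<lambda>x. \<omega> x - w x))"
    using graph_sq_nonneg[of U "\<lambda>x. \<omega> x - \<eta> x"] by (simp add: algebra_simps)
  also have "graph_sq U (\<lambda>x. \<omega> x - w x) = graph_sq U (\<lambda>x. \<omega> x - p x)"
    by (rule graph_sq_cong_AE[OF U s\<omega>w, symmetric]) (use p(2) in eventually_elim, simp)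
  finally show ?thesis .
qed

text \<open>The local projection does not change the pairing with \<open>\<mu>\<close>, by \<open>pairing_cong\<close>: the projection and
  \<open>\<eta>\<close> have the same mean, and so have their exterior derivatives.\<close>

lemma whitney_pairing:
  fixes a b :: "real ^ 'n::{finite,linorder}" and \<eta> \<mu> :: "'n form" and k :: nat
  defines "U \<equiv> box a b"
  defines "W \<equiv> whitney U k (fmean U \<eta>) (fmean U (wop dcoef U \<eta>))"
  assumes ne: "U \<noteq> {}" and q: "outer_form q" "AE x in lebesgue_on U. \<eta> x = q x"
    and r: "inner_form r" "AE x in lebesgue_on U. \<mu> x = r x"
    and e: "fmean U (wop dcoef U \<eta>) \<in> covectors (k + 1)"
  shows "L2_inner U (wop dcoef U W) \<mu> = L2_inner U (wop dcoef U \<eta>) \<mu>"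
    "L2_inner U W (wop (adj dcoef) U \<mu>) = L2_inner U \<eta> (wop (adj dcoef) U \<mu>)"
proof -
  have U: "open U" "bounded U" by (simp_all add: U_def open_box bounded_box)
  have v: "vol U > 0" using vol_box_pos ne by (auto simp: U_def)
  have C: "C1_form W" "C1_form q" "C1_form r"
    using q(1) r(1) by (auto intro: outer_form_C1 inner_form_C1 whitney_outer_form simp: W_def)
  note sW = sob_classical[OF U C(1), of dcoef] and sq = sob_classical[OF U C(2), of dcoef]
    and sr = sob_classical[OF U C(3), of "adj dcoef"]
  note \<eta> = sob_cong_AE[OF U sq(1) q(2)] and \<mu> = sob_cong_AE[OF U sr(1) r(2)]
  note LC = C1_form_L2[OF U C(1)] C1_form_L2[OF U C(2)] C1_form_L2[OF U C(3)]
    classical_op_L2[OF U C(1), of dcoef] classical_op_L2[OF U C(2), of dcoef] classical_op_L2[OF U C(3), of "adj dcoef"]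
  note LW = sob_wop(2)[OF sW(1)] sob_wop(1,2)[OF \<eta>(1)] sob_wop(1,2)[OF \<mu>(1)]
  have d\<eta>: "AE x in lebesgue_on U. wop dcoef U \<eta> x = classical_op dcoef q x" using sq(2) by (simp add: \<eta>(2))
  have d\<mu>: "AE x in lebesgue_on U. wop (adj dcoef) U \<mu> x = classical_op (adj dcoef) r x" using sr(2) by (simp add: \<mu>(2))
  have oW: "outer_form W" unfolding W_def by (rule whitney_outer_form)
  have m: "fmean U W = fmean U q"
    using whitney_mean[OF U v] fmean_cong_AE[OF LW(2) LC(2) q(2)] by (simp add: W_def)
  have dm: "fmean U (classical_op dcoef W) = fmean U (classical_op dcoef q)"
    using fmean_cong_AE[OF LW(3) LC(5) d\<eta>] fmean_const[OF v] whitney_d[OF e] by (simp add: W_def)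
  note P = pairing_cong[OF ne[unfolded U_def] oW q(1) r(1) fmean_eqD[OF v m, unfolded U_def]
      fmean_eqD[OF v dm, unfolded U_def], folded U_def]
  have "L2_inner U (wop dcoef U W) \<mu> = L2_inner U (classical_op dcoef W) r"
    by (rule L2_inner_cong_AE[OF LW(1) LW(4) LC(4) LC(3) sW(2) r(2)])
  also have "\<dots> = L2_inner U (classical_op dcoef q) r" by (rule P(1))
  also have "\<dots> = L2_inner U (wop dcoef U \<eta>) \<mu>"
    by (rule L2_inner_cong_AE[OF LW(3) LW(4) LC(5) LC(3) d\<eta> r(2), symmetric])
  finally show "L2_inner U (wop dcoef U W) \<mu> = L2_inner U (wop dcoef U \<eta>) \<mu>" .
  have "L2_inner U W (wop (adj dcoef) U \<mu>) = L2_inner U W (classical_op (adj dcoef) r)"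
    by (rule L2_inner_cong_AE[OF LC(1) LW(5) LC(1) LC(6) _ d\<mu>]) simp
  also have "\<dots> = L2_inner U q (classical_op (adj dcoef) r)" by (rule P(2))
  also have "\<dots> = L2_inner U \<eta> (wop (adj dcoef) U \<mu>)"
    by (rule L2_inner_cong_AE[OF LW(2) LW(5) LC(2) LC(6) q(2) d\<mu>, symmetric])
  finally show "L2_inner U W (wop (adj dcoef) U \<mu>) = L2_inner U \<eta> (wop (adj dcoef) U \<mu>)" .
qed


section \<open>Cubical meshes\<close>

lemma mesh_cell:
  assumes "cubical_mesh \<Omega> G" "K \<in> G"
  obtains a b where "K = cbox a b" "interior K = box a b" "box a b \<noteq> {}" "box a b \<subseteq> \<Omega>"
proof -
  obtain a b where K: "K = cbox a b"
    using assms division_ofD(4) unfolding cubical_mesh_def by blast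
  then have i: "interior K = box a b" by (simp add: interior_cbox)
  have "interior K \<noteq> {}" "interior K \<subseteq> \<Omega>" using assms by (auto simp: cubical_mesh_def)
  then show ?thesis using that[OF K i] unfolding i by blast
qed

text \<open>The open cells are disjoint and exhaust \<open>\<Omega>\<close> up to the null set formed by their boundaries.\<close>

lemma mesh_integral:
  fixes f :: "real ^ 'n::finite \<Rightarrow> real"
  assumes \<Omega>: "open \<Omega>" and G: "cubical_mesh \<Omega> G" and f: "integrable (lebesgue_on \<Omega>) f"
  shows "(LINT x|lebesgue_on \<Omega>. f x) = (\<Sum>K\<in>G. LINT x|lebesgue_on (interior K). f x)"
proof -
  have div: "G division_of closure \<Omega>" using G by (simp add: cubical_mesh_def)
  then have fin: "finite G" by (rule division_ofD(1))
  have sub: "interior K \<subseteq> \<Omega>" if "K \<in> G" for K using G that by (simp add: cubical_mesh_def)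
  have iF: "integrable lebesgue (\<lambda>x. indicator \<Omega> x * f x)"
    using f \<Omega> by (simp add: integrable_restrict_space)
  have iK: "integrable lebesgue (\<lambda>x. indicator (interior K) x * f x)" if "K \<in> G" for K
    using lebesgue_on_integrable_subset[OF open_interior \<Omega> sub[OF that] f] by (simp add: integrable_restrict_space)
  define N where "N = (\<Union>K\<in>G. K - interior K)"
  have "negligible N" unfolding N_def
  proof (intro negligible_Union)
    show "finite ((\<lambda>K. K - interior K) ` G)" using fin by simp
    fix T assume "T \<in> (\<lambda>K. K - interior K) ` G"
    then obtain K where K: "K \<in> G" "T = K - interior K" by blast
    obtain a b where "K = cbox a b" "interior K = box a b" using mesh_cell[OF G K(1)] by metis
    then show "negligible T" using K(2) negligible_frontier_interval[of a b] by simp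
  qed
  then have "AE x in lebesgue. x \<notin> N" by (intro AE_not_in) (simp add: negligible_iff_null_sets)
  then have ae: "AE x in lebesgue. indicator \<Omega> x * f x = (\<Sum>K\<in>G. indicator (interior K) x * f x)"
  proof eventually_elim
    fix x assume N: "x \<notin> N"
    show "indicator \<Omega> x * f x = (\<Sum>K\<in>G. indicator (interior K) x * f x)"
    proof (cases "x \<in> \<Omega>")
      case True
      then have "x \<in> \<Union>G" using division_ofD(6)[OF div] closure_subset by blast
      then obtain K where K: "K \<in> G" "x \<in> interior K" using N by (auto simp: N_def)
      have "x \<notin> interior L" if "L \<in> G" "L \<noteq> K" for L
        using division_ofD(5)[OF div that(1) K(1) that(2)] K(2) by blast
      then have "(\<Sum>L\<in>G. indicator (interior L) x * f x) = (\<Sum>L\<in>G. if L = K then f x else 0)"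
        using K(2) by (intro sum.cong) (auto simp: indicator_def)
      then show ?thesis using True K(1) fin by simp
    next
      case False
      then have "indicator (interior K) x * f x = 0" if "K \<in> G" for K
        using sub[OF that] by (auto simp: indicator_def)
      then have "(\<Sum>K\<in>G. indicator (interior K) x * f x) = 0" by (intro sum.neutral) blast
      then show ?thesis using False by simp
    qed
  qed
  have "(LINT x|lebesgue_on \<Omega>. f x) = (LINT x|lebesgue. indicator \<Omega> x * f x)"
    by (rule lebesgue_on_integral_eq[OF \<Omega>])
  also have "\<dots> = (LINT x|lebesgue. (\<Sum>K\<in>G. indicator (interior K) x * f x))"
    using iF iK ae by (intro integral_cong_AE borel_measurable_integrable Bochner_Integration.integrable_sum)
  also have "\<dots> = (\<Sum>K\<in>G. LINT x|lebesgue. indicator (interior K) x * f x)"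
    using iK by (intro Bochner_Integration.integral_sum)
  also have "\<dots> = (\<Sum>K\<in>G. LINT x|lebesgue_on (interior K). f x)"
    by (simp only: lebesgue_on_integral_eq[OF open_interior])
  finally show ?thesis .
qed

lemma mesh_L2_inner:
  assumes "open \<Omega>" "cubical_mesh \<Omega> G" "\<omega> \<in> L2 \<Omega>" "\<eta> \<in> L2 \<Omega>"
  shows "L2_inner \<Omega> \<omega> \<eta> = (\<Sum>K\<in>G. L2_inner (interior K) \<omega> \<eta>)"
  unfolding L2_inner_def by (rule mesh_integral[OF assms(1,2) L2_inner_integrable[OF assms(3,4)]])

lemma d_norm_eq: "d_norm U \<omega> = sqrt (graph_sq U \<omega>)"
  by (simp add: d_norm_def graph_sq_def L2_norm_sq weak_d_eq_wop)

lemma broken_d_norm_eq: "broken_d_norm G \<omega> = sqrt (\<Sum>K\<in>G. graph_sq (interior K) \<omega>)"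
  by (simp add: broken_d_norm_def graph_sq_def L2_norm_sq weak_d_eq_wop)

lemma mesh_graph_sq:
  assumes \<Omega>: "open \<Omega>" "bounded \<Omega>" and G: "cubical_mesh \<Omega> G" and s: "sob dcoef \<Omega> \<omega>"
  shows "graph_sq \<Omega> \<omega> = (\<Sum>K\<in>G. graph_sq (interior K) \<omega>)"
proof -
  note L = sob_wop(1,2)[OF s]
  have "L2_inner (interior K) (wop dcoef \<Omega> \<omega>) (wop dcoef \<Omega> \<omega>) =
      L2_inner (interior K) (wop dcoef (interior K) \<omega>) (wop dcoef (interior K) \<omega>)" if "K \<in> G" for K
  proof -
    have sub: "interior K \<subseteq> \<Omega>" using G that by (simp add: cubical_mesh_def)
    note S = sob_subset[OF open_interior \<Omega>(1,2) sub s]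
    show ?thesis
      using L2_subset[OF open_interior \<Omega>(1) sub L(2)] sob_wop(2)[OF S(1)] S(2)
      by (intro L2_inner_cong_AE[symmetric])
  qed
  then show ?thesis
    by (simp add: graph_sq_def mesh_L2_inner[OF \<Omega>(1) G L(1) L(1)] mesh_L2_inner[OF \<Omega>(1) G L(2) L(2)] sum.distrib)
qed

text \<open>The form equal to \<open>P K\<close> on the interior of each cell \<open>K\<close>; its values on the null set outside of
  the open cells are arbitrary.\<close>

definition glue :: "(real ^ 'n::finite) set set \<Rightarrow> ((real ^ 'n) set \<Rightarrow> 'n form) \<Rightarrow> 'n form" where
  "glue G P x = P (THE K. K \<in> G \<and> x \<in> interior K) x"

lemma glue_eq:
  assumes "cubical_mesh \<Omega> G" "K \<in> G" "x \<in> interior K"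
  shows "glue G P x = P K x"
proof -
  have div: "G division_of closure \<Omega>" using assms(1) by (simp add: cubical_mesh_def)
  have "(THE K. K \<in> G \<and> x \<in> interior K) = K"
    using assms division_ofD(5)[OF div] by (intro the_equality) blast+
  then show ?thesis by (simp add: glue_def)
qed


section \<open>The global projection\<close>

text \<open>The cellwise projection of a conforming \<open>\<eta>\<close>. The set \<open>S\<close> of discrete forms \<open>\<mu>\<close> with which \<open>\<eta>\<close> has
  no adjointness defect is a parameter, so that the cases without and with boundary conditions are
  treated together.\<close>

lemma projection_preserving_adjointness:
  fixes \<Omega> :: "(real ^ 'n::{finite,linorder}) set" and R :: real
  defines "M \<equiv> 3 + 2 * (whitney_const TYPE('n) R)\<^sup>2"
  assumes \<Omega>: "open \<Omega>" "bounded \<Omega>" and R: "\<And>x. x \<in> \<Omega> \<Longrightarrow> norm x \<le> R" and G: "cubical_mesh \<Omega> G"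
    and \<omega>: "\<omega> \<in> H k \<Omega>" and \<eta>: "\<eta> \<in> VQ k \<Omega> G" and p: "p \<in> P1m_broken k G"
    and S: "\<And>\<mu>. \<mu> \<in> S \<Longrightarrow> \<mu> \<in> VQ_star (k + 1) \<Omega> G"
      "\<And>\<mu>. \<mu> \<in> S \<Longrightarrow> L2_inner \<Omega> (wop dcoef \<Omega> \<eta>) \<mu> = L2_inner \<Omega> \<eta> (wop (adj dcoef) \<Omega> \<mu>)"
  shows "\<exists>\<mu>h\<in>P1m_broken k G. (\<forall>\<mu>\<in>S. adjointness_defect k \<Omega> G \<mu>h \<mu> = 0) \<and>
    broken_d_norm G (\<lambda>x. \<omega> x - \<mu>h x) \<le>
      sqrt (2 + 4 * M) * (d_norm \<Omega> (\<lambda>x. \<omega> x - \<eta> x) + broken_d_norm G (\<lambda>x. \<omega> x - p x))"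
proof -
  have \<eta>H: "\<eta> \<in> H k \<Omega>" using \<eta> by (simp add: VQ_def)
  note s = H_sob[OF \<omega>] H_sob[OF \<eta>H]
  define P where "P K = whitney (interior K) k (fmean (interior K) \<eta>) (fmean (interior K) (wop dcoef (interior K) \<eta>))" for K
  define \<mu>h where "\<mu>h = glue G P"
  have M0: "M \<ge> 0" by (simp add: M_def)
  have cell: "open (interior K)" "bounded (interior K)" "vol (interior K) > 0" "interior K \<subseteq> \<Omega>"
    "\<And>x. x \<in> interior K \<Longrightarrow> norm x \<le> R"
    "sob dcoef (interior K) \<omega>" "sob dcoef (interior K) \<eta>"
    "AE x in lebesgue_on (interior K). wop dcoef (interior K) \<eta> x = wop dcoef \<Omega> \<eta> x"
    "fmean (interior K) (wop dcoef (interior K) \<eta>) \<in> covectors (k + 1)"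
    "fmean (interior K) \<eta> \<in> covectors k"
    "AE x in lebesgue_on (interior K). \<mu>h x = P K x"
    if K: "K \<in> G" for K
  proof -
    obtain a b where ab: "interior K = box a b" "box a b \<noteq> {}" "box a b \<subseteq> \<Omega>" using mesh_cell[OF G K] by metis
    show U: "open (interior K)" "bounded (interior K)" by (rule open_interior) (simp add: ab(1) bounded_box)
    show "vol (interior K) > 0" using ab vol_box_pos by simp
    show sub: "interior K \<subseteq> \<Omega>" using ab by simp
    show "\<And>x. x \<in> interior K \<Longrightarrow> norm x \<le> R" using R sub by blast
    show "sob dcoef (interior K) \<omega>" "sob dcoef (interior K) \<eta>"
      "AE x in lebesgue_on (interior K). wop dcoef (interior K) \<eta> x = wop dcoef \<Omega> \<eta> x"
      using sob_subset[OF U(1) \<Omega> sub] s by auto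
    obtain \<zeta> where \<zeta>: "\<zeta> \<in> L2_forms (k + 1) \<Omega>" "has_weak_d \<Omega> \<eta> \<zeta>" using \<eta>H by (auto simp: H_def)
    have "AE x in lebesgue_on \<Omega>. wop dcoef \<Omega> \<eta> x = \<zeta> x"
      using \<zeta> by (intro wop_AE(1)[OF \<Omega>]) (auto simp: L2_forms_def has_weak_d_iff)
    moreover have "AE x in lebesgue_on \<Omega>. \<zeta> x \<in> covectors (k + 1)" using \<zeta> by (simp add: L2_forms_def)
    ultimately have "AE x in lebesgue_on \<Omega>. wop dcoef \<Omega> \<eta> x \<in> covectors (k + 1)" by eventually_elim simp
    from lebesgue_on_AE_subset[OF U(1) \<Omega>(1) sub this]
      \<open>AE x in lebesgue_on (interior K). wop dcoef (interior K) \<eta> x = wop dcoef \<Omega> \<eta> x\<close>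
    have "AE x in lebesgue_on (interior K). wop dcoef (interior K) \<eta> x \<in> covectors (k + 1)" by eventually_elim simp
    then show "fmean (interior K) (wop dcoef (interior K) \<eta>) \<in> covectors (k + 1)" by (rule fmean_covectors)
    have "AE x in lebesgue_on \<Omega>. \<eta> x \<in> covectors k" using \<eta>H by (simp add: H_def L2_forms_def)
    from lebesgue_on_AE_subset[OF U(1) \<Omega>(1) sub this]
    show "fmean (interior K) \<eta> \<in> covectors k" by (rule fmean_covectors)
    show "AE x in lebesgue_on (interior K). \<mu>h x = P K x"
      unfolding \<mu>h_def using glue_eq[OF G K] by (intro AE_I2) (simp add: space_restrict_space)
  qed
  have "\<mu>h \<in> P1m_broken k G"
    unfolding P1m_broken_def restricts_to_def using cell(9-11) whitney_P1m unfolding P_def by blast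
  moreover have "adjointness_defect k \<Omega> G \<mu>h \<mu> = 0" if \<mu>: "\<mu> \<in> S" for \<mu>
  proof -
    have \<mu>V: "\<mu> \<in> VQ_star (k + 1) \<Omega> G" using S(1)[OF \<mu>] .
    then have \<mu>H: "\<mu> \<in> H_star (k + 1) \<Omega>" by (simp add: VQ_star_def)
    then have "AE x in lebesgue_on \<Omega>. \<mu> x \<in> covectors (k + 1)" by (simp add: H_star_def L2_forms_def)
    note w = wop_codcoef_adj[OF this]
    have s\<mu>: "sob (adj dcoef) \<Omega> \<mu>" using H_star_sob[OF \<mu>H] w by simp
    note L = sob_wop(1,2)[OF s(2)] sob_wop(1,2)[OF s\<mu>]
    have "L2_inner (interior K) (weak_d (interior K) \<mu>h) \<mu> - L2_inner (interior K) \<mu>h (weak_codiff (k + 1) \<Omega> \<mu>) =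
        L2_inner (interior K) (wop dcoef \<Omega> \<eta>) \<mu> - L2_inner (interior K) \<eta> (wop (adj dcoef) \<Omega> \<mu>)" if K: "K \<in> G" for K
    proof -
      let ?U = "interior K"
      note c = cell[OF K]
      note sub = L2_subset[OF c(1) \<Omega>(1) c(4)]
      obtain a b where ab: "?U = box a b" "box a b \<noteq> {}" using mesh_cell[OF G K] by metis
      obtain q where q: "q \<in> Q1m_forms k" "AE x in lebesgue_on ?U. \<eta> x = q x"
        using \<eta> K by (auto simp: VQ_def restricts_to_def)
      obtain r where r: "r \<in> Q1m_star_forms (k + 1)" "AE x in lebesgue_on ?U. \<mu> x = r x"
        using \<mu>V K by (auto simp: VQ_star_def restricts_to_def)
      note Pr = whitney_pairing[where a=a and b=b and \<eta>=\<eta> and \<mu>=\<mu> and k=k, folded ab(1), folded P_def,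
          OF _ Q1m_outer_form[OF q(1)] q(2) Q1m_star_inner_form[OF r(1)] r(2) c(9)]
      have ne: "?U \<noteq> {}" using ab by simp
      have C: "C1_form (P K)" unfolding P_def by (rule outer_form_C1[OF whitney_outer_form])
      have sP: "sob dcoef ?U (P K)" by (rule sob_classical(1)[OF c(1,2) C])
      note s\<mu>h = sob_cong_AE[OF c(1,2) sP c(11)]
      note sU = sob_subset[OF c(1) \<Omega> c(4) s\<mu>]
      have "L2_inner ?U (wop dcoef ?U \<mu>h) \<mu> = L2_inner ?U (wop dcoef ?U \<eta>) \<mu>"
        using Pr(1)[OF ne] by (simp add: s\<mu>h(2))
      also have "\<dots> = L2_inner ?U (wop dcoef \<Omega> \<eta>) \<mu>"
        using sob_wop(2)[OF c(7)] sub[OF L(2)] sub[OF L(3)] c(8) by (intro L2_inner_cong_AE) auto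
      finally have 1: "L2_inner ?U (wop dcoef ?U \<mu>h) \<mu> = L2_inner ?U (wop dcoef \<Omega> \<eta>) \<mu>" .
      have "L2_inner ?U \<mu>h (wop (adj dcoef) \<Omega> \<mu>) = L2_inner ?U (P K) (wop (adj dcoef) ?U \<mu>)"
        using sob_wop(1)[OF s\<mu>h(1)] sob_wop(1)[OF sP] sub[OF L(4)] sob_wop(2)[OF sU(1)] c(11) sU(2)
        by (intro L2_inner_cong_AE) (auto elim: eventually_mono)
      also have "\<dots> = L2_inner ?U \<eta> (wop (adj dcoef) ?U \<mu>)" by (rule Pr(2)[OF ne])
      also have "\<dots> = L2_inner ?U \<eta> (wop (adj dcoef) \<Omega> \<mu>)"
        using sub[OF L(1)] sub[OF L(4)] sob_wop(2)[OF sU(1)] sU(2) by (intro L2_inner_cong_AE) auto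
      finally show ?thesis by (simp only: 1 weak_d_eq_wop weak_codiff_eq_wop w(1))
    qed
    then have "adjointness_defect k \<Omega> G \<mu>h \<mu> = L2_inner \<Omega> (wop dcoef \<Omega> \<eta>) \<mu> - L2_inner \<Omega> \<eta> (wop (adj dcoef) \<Omega> \<mu>)"
      by (simp add: adjointness_defect_def mesh_L2_inner[OF \<Omega>(1) G] L sum_subtractf)
    then show ?thesis using S(2)[OF \<mu>] by simp
  qed
  moreover have "broken_d_norm G (\<lambda>x. \<omega> x - \<mu>h x) \<le>
      sqrt (2 + 4 * M) * (d_norm \<Omega> (\<lambda>x. \<omega> x - \<eta> x) + broken_d_norm G (\<lambda>x. \<omega> x - p x))"
  proof -
    have "graph_sq (interior K) (\<lambda>x. \<omega> x - \<mu>h x) \<le>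
        (2 + 4 * M) * (graph_sq (interior K) (\<lambda>x. \<omega> x - \<eta> x) + graph_sq (interior K) (\<lambda>x. \<omega> x - p x))"
      if K: "K \<in> G" for K
    proof -
      note c = cell[OF K]
      obtain w where w: "w \<in> P1m_forms k" "AE x in lebesgue_on (interior K). p x = w x"
        using p K by (auto simp: P1m_broken_def restricts_to_def)
      have sP: "sob dcoef (interior K) (P K)"
        unfolding P_def by (rule sob_classical(1)[OF c(1,2) outer_form_C1[OF whitney_outer_form]])
      have "graph_sq (interior K) (\<lambda>x. \<omega> x - \<mu>h x) = graph_sq (interior K) (\<lambda>x. \<omega> x - P K x)"
        by (rule graph_sq_cong_AE[OF c(1,2) sob_diff(1)[OF c(1,2) c(6) sP]])
          (use c(11) in eventually_elim, simp)
      then show ?thesis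
        using whitney_approximation[OF c(1,2,3) c(5) c(6,7,9) w] unfolding M_def P_def by simp
    qed
    then have "(\<Sum>K\<in>G. graph_sq (interior K) (\<lambda>x. \<omega> x - \<mu>h x)) \<le>
        (\<Sum>K\<in>G. (2 + 4 * M) * (graph_sq (interior K) (\<lambda>x. \<omega> x - \<eta> x) + graph_sq (interior K) (\<lambda>x. \<omega> x - p x)))"
      by (rule sum_mono)
    also have "\<dots> = (2 + 4 * M) * (graph_sq \<Omega> (\<lambda>x. \<omega> x - \<eta> x) + (\<Sum>K\<in>G. graph_sq (interior K) (\<lambda>x. \<omega> x - p x)))"
      using sob_diff(1)[OF \<Omega> s] by (simp only: mesh_graph_sq[OF \<Omega> G] sum_distrib_left[symmetric] sum.distrib)
    finally have "broken_d_norm G (\<lambda>x. \<omega> x - \<mu>h x) \<le>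
        sqrt ((2 + 4 * M) * (graph_sq \<Omega> (\<lambda>x. \<omega> x - \<eta> x) + (\<Sum>K\<in>G. graph_sq (interior K) (\<lambda>x. \<omega> x - p x))))"
      unfolding broken_d_norm_eq by (rule real_sqrt_le_mono)
    also have "\<dots> = sqrt (2 + 4 * M) *
        sqrt (graph_sq \<Omega> (\<lambda>x. \<omega> x - \<eta> x) + (\<Sum>K\<in>G. graph_sq (interior K) (\<lambda>x. \<omega> x - p x)))"
      by (rule real_sqrt_mult)
    also have "\<dots> \<le> sqrt (2 + 4 * M) * (d_norm \<Omega> (\<lambda>x. \<omega> x - \<eta> x) + broken_d_norm G (\<lambda>x. \<omega> x - p x))"
      unfolding d_norm_eq broken_d_norm_eq using M0
      by (intro mult_left_mono sqrt_add_le_add_sqrt graph_sq_nonneg sum_nonneg) auto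
    finally show ?thesis .
  qed
  ultimately show ?thesis by blast
qed

text \<open>Integration by parts for the two combinations of boundary conditions. The assumptions place the
  approximation by test forms in the norms of \<open>d\<close> or \<open>\<delta>\<close> applied to the difference; the weak operator
  applied to a test form is the classical one.\<close>

lemma duality_H0_star:
  assumes \<Omega>: "open \<Omega>" "bounded \<Omega>" and \<eta>: "\<eta> \<in> H k \<Omega>" and \<mu>: "\<mu> \<in> H0_star (k + 1) \<Omega>"
  shows "L2_inner \<Omega> (wop dcoef \<Omega> \<eta>) \<mu> = L2_inner \<Omega> \<eta> (wop (adj dcoef) \<Omega> \<mu>)"
proof (rule duality[OF \<Omega> H_sob[OF \<eta>]])
  have \<mu>H: "\<mu> \<in> H_star (k + 1) \<Omega>" using \<mu> by (simp add: H0_star_def)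
  then have cov: "AE x in lebesgue_on \<Omega>. \<mu> x \<in> covectors (k + 1)" by (simp add: H_star_def L2_forms_def)
  show s: "sob (adj dcoef) \<Omega> \<mu>" using H_star_sob[OF \<mu>H] wop_codcoef_adj(2)[OF cov] by simp
  fix \<epsilon> :: real assume "\<epsilon> > 0"
  then obtain \<phi> where \<phi>: "\<phi> \<in> test_forms (k + 1) \<Omega>" and n: "codiff_norm (k + 1) \<Omega> (\<lambda>x. \<mu> x - \<phi> x) < sqrt \<epsilon>"
    using \<mu> by (auto simp: H0_star_def dest!: spec[of _ "sqrt \<epsilon>"])
  have t: "(\<lambda>x. \<phi> x $ \<alpha>) \<in> test_functions \<Omega>" for \<alpha> using \<phi> by (simp add: test_forms_def)
  have C: "C1_form \<phi>" using t test_C1 by (auto simp: C1_form_def)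
  note s\<phi> = sob_classical[OF \<Omega> C, of "adj dcoef"]
  note d = sob_diff[OF \<Omega> s s\<phi>(1)]
  have "AE x in lebesgue_on \<Omega>. \<mu> x - \<phi> x \<in> covectors (k + 1)"
    using cov by eventually_elim (use \<phi> in \<open>auto simp: test_forms_def covectors_def\<close>)
  then have w: "weak_codiff (k + 1) \<Omega> (\<lambda>x. \<mu> x - \<phi> x) = wop (adj dcoef) \<Omega> (\<lambda>x. \<mu> x - \<phi> x)"
    unfolding weak_codiff_eq_wop by (rule wop_codcoef_adj(1))
  have "AE x in lebesgue_on \<Omega>. wop (adj dcoef) \<Omega> (\<lambda>x. \<mu> x - \<phi> x) x =
      wop (adj dcoef) \<Omega> \<mu> x - classical_op (adj dcoef) \<phi> x"
    using d(2) s\<phi>(2) by eventually_elim simp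
  then have "L2_inner \<Omega> (wop (adj dcoef) \<Omega> (\<lambda>x. \<mu> x - \<phi> x)) (wop (adj dcoef) \<Omega> (\<lambda>x. \<mu> x - \<phi> x)) =
      L2_inner \<Omega> (\<lambda>x. wop (adj dcoef) \<Omega> \<mu> x - classical_op (adj dcoef) \<phi> x)
        (\<lambda>x. wop (adj dcoef) \<Omega> \<mu> x - classical_op (adj dcoef) \<phi> x)"
    using sob_wop(2)[OF d(1)] L2_diff[OF sob_wop(2)[OF s] classical_op_L2[OF \<Omega> C]] by (intro L2_inner_cong_AE)
  then show "\<exists>\<phi>. (\<forall>\<alpha>. (\<lambda>x. \<phi> x $ \<alpha>) \<in> test_functions \<Omega>) \<and>
      L2_inner \<Omega> (\<lambda>x. \<mu> x - \<phi> x) (\<lambda>x. \<mu> x - \<phi> x) +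
      L2_inner \<Omega> (\<lambda>x. wop (adj dcoef) \<Omega> \<mu> x - classical_op (adj dcoef) \<phi> x)
                 (\<lambda>x. wop (adj dcoef) \<Omega> \<mu> x - classical_op (adj dcoef) \<phi> x) < \<epsilon>"
    using t n unfolding codiff_norm_def L2_norm_sq w by (intro exI[of _ \<phi>]) simp
qed

lemma duality_H0:
  assumes \<Omega>: "open \<Omega>" "bounded \<Omega>" and \<eta>: "\<eta> \<in> H0 k \<Omega>" and \<mu>: "\<mu> \<in> H_star (k + 1) \<Omega>"
  shows "L2_inner \<Omega> (wop dcoef \<Omega> \<eta>) \<mu> = L2_inner \<Omega> \<eta> (wop (adj dcoef) \<Omega> \<mu>)"
proof -
  have \<eta>H: "\<eta> \<in> H k \<Omega>" using \<eta> by (simp add: H0_def)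
  note s = H_sob[OF \<eta>H]
  have cov: "AE x in lebesgue_on \<Omega>. \<mu> x \<in> covectors (k + 1)" using \<mu> by (simp add: H_star_def L2_forms_def)
  have s\<mu>: "sob (adj dcoef) \<Omega> \<mu>" using H_star_sob[OF \<mu>] wop_codcoef_adj(2)[OF cov] by simp
  have "L2_inner \<Omega> (wop (adj dcoef) \<Omega> \<mu>) \<eta> = L2_inner \<Omega> \<mu> (wop (adj (adj dcoef)) \<Omega> \<eta>)"
  proof (rule duality[OF \<Omega> s\<mu>], unfold adj_adj)
    show "sob dcoef \<Omega> \<eta>" by (rule s)
    fix \<epsilon> :: real assume "\<epsilon> > 0"
    then obtain \<phi> where \<phi>: "\<phi> \<in> test_forms k \<Omega>" and n: "d_norm \<Omega> (\<lambda>x. \<eta> x - \<phi> x) < sqrt \<epsilon>"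
      using \<eta> by (auto simp: H0_def dest!: spec[of _ "sqrt \<epsilon>"])
    have t: "(\<lambda>x. \<phi> x $ \<alpha>) \<in> test_functions \<Omega>" for \<alpha> using \<phi> by (simp add: test_forms_def)
    have C: "C1_form \<phi>" using t test_C1 by (auto simp: C1_form_def)
    note s\<phi> = sob_classical[OF \<Omega> C, of dcoef]
    note d = sob_diff[OF \<Omega> s s\<phi>(1)]
    have "AE x in lebesgue_on \<Omega>. wop dcoef \<Omega> (\<lambda>x. \<eta> x - \<phi> x) x = wop dcoef \<Omega> \<eta> x - classical_op dcoef \<phi> x"
      using d(2) s\<phi>(2) by eventually_elim simp
    then have "L2_inner \<Omega> (wop dcoef \<Omega> (\<lambda>x. \<eta> x - \<phi> x)) (wop dcoef \<Omega> (\<lambda>x. \<eta> x - \<phi> x)) =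
        L2_inner \<Omega> (\<lambda>x. wop dcoef \<Omega> \<eta> x - classical_op dcoef \<phi> x) (\<lambda>x. wop dcoef \<Omega> \<eta> x - classical_op dcoef \<phi> x)"
      using sob_wop(2)[OF d(1)] L2_diff[OF sob_wop(2)[OF s] classical_op_L2[OF \<Omega> C]] by (intro L2_inner_cong_AE)
    then show "\<exists>\<phi>. (\<forall>\<alpha>. (\<lambda>x. \<phi> x $ \<alpha>) \<in> test_functions \<Omega>) \<and>
        L2_inner \<Omega> (\<lambda>x. \<eta> x - \<phi> x) (\<lambda>x. \<eta> x - \<phi> x) +
        L2_inner \<Omega> (\<lambda>x. wop dcoef \<Omega> \<eta> x - classical_op dcoef \<phi> x)
                   (\<lambda>x. wop dcoef \<Omega> \<eta> x - classical_op dcoef \<phi> x) < \<epsilon>"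
      using t n by (intro exI[of _ \<phi>]) (simp add: d_norm_eq graph_sq_def)
  qed
  then show ?thesis by (simp add: adj_adj L2_inner_def inner_commute)
qed

lemma zero_in_VQ0:
  fixes \<Omega> :: "(real ^ 'n::{finite,linorder}) set"
  assumes \<Omega>: "open \<Omega>" "bounded \<Omega>"
  shows "(\<lambda>_. 0) \<in> VQ0 k \<Omega> G" "(\<lambda>_. 0) \<in> VQ k \<Omega> G"
proof -
  let ?z = "\<lambda>_ :: (real, 'n) vec. 0 :: 'n covector"
  have L: "?z \<in> L2_forms j \<Omega>" for j by (auto simp: L2_forms_def L2_def covectors_def)
  have "has_weak_d \<Omega> ?z ?z" by (simp add: has_weak_d_def)
  then have zH: "?z \<in> H k \<Omega>" using L by (auto simp: H_def)
  have C: "C1_form ?z" by (simp add: C1_form_def C1_const)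
  have "classical_op dcoef ?z = ?z"
    by (simp add: classical_op_def partial_deriv_const fun_eq_iff vec_eq_iff)
  then have "graph_sq \<Omega> ?z = L2_inner \<Omega> ?z ?z + L2_inner \<Omega> ?z ?z"
    using sob_classical[OF \<Omega> C, of dcoef] sob_wop C1_form_L2[OF \<Omega> C] unfolding graph_sq_def
    by (intro arg_cong2[of _ _ _ _ "(+)"] refl L2_inner_cong_AE) auto
  then have "d_norm \<Omega> ?z = 0" by (simp add: d_norm_eq L2_inner_def)
  moreover have "smooth (\<lambda>x :: (real, 'n) vec. 0)"
    using smooth_prod[of "\<lambda>_ :: 'n. \<lambda>_. 0"] by (simp add: smooth1_def nsmooth_const power_0_left)
  then have "?z \<in> test_forms k \<Omega>" by (simp add: test_forms_def test_functions_def covectors_def)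
  ultimately have z0: "?z \<in> H0 k \<Omega>" using zH by (auto simp: H0_def intro!: bexI[of _ ?z])
  have "(\<lambda>x. 0) \<in> tensor_polys r" for r :: "'n \<Rightarrow> nat"
    unfolding tensor_polys_def by (intro CollectI exI[of _ 0]) auto
  then have "?z \<in> Q1m_forms k" by (simp add: Q1m_forms_def covectors_def)
  then have "restricts_to ?z K (Q1m_forms k)" for K unfolding restricts_to_def by (intro bexI[of _ ?z]) auto
  then show "?z \<in> VQ0 k \<Omega> G" "?z \<in> VQ k \<Omega> G" using z0 zH by (auto simp: VQ0_def VQ_def)
qed

lemma P1m_broken_nonempty: "P1m_broken k G \<noteq> {}"
proof -
  have "whitney UNIV k 0 0 \<in> P1m_forms k" by (rule whitney_P1m) (auto simp: covectors_def)
  then have "whitney UNIV k 0 0 \<in> P1m_broken k G"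
    unfolding P1m_broken_def restricts_to_def by (auto intro!: bexI[of _ "whitney UNIV k 0 0"])
  then show ?thesis by blast
qed

lemma INF_le_combination:
  fixes f :: "'a \<Rightarrow> real" and a :: "'b \<Rightarrow> real" and b :: "'c \<Rightarrow> real"
  assumes C: "C > 0" and ne: "A \<noteq> {}" "B \<noteq> {}" and f: "\<And>x. f x \<ge> 0"
    and le: "\<And>y z. y \<in> A \<Longrightarrow> z \<in> B \<Longrightarrow> \<exists>x\<in>W. f x \<le> C * (a y + b z)"
  shows "(INF x\<in>W. f x) \<le> C * ((INF y\<in>A. a y) + (INF z\<in>B. b z))"
proof -
  let ?I = "INF x\<in>W. f x"
  have 1: "?I / C - b z \<le> a y" if y: "y \<in> A" and z: "z \<in> B" for y z
  proof -
    obtain x where x: "x \<in> W" "f x \<le> C * (a y + b z)" using le[OF y z] by blast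
    have "?I \<le> f x" using f x(1) by (intro cINF_lower bdd_belowI[of _ 0]) auto
    then have "?I \<le> C * (a y + b z)" using x(2) by linarith
    then show ?thesis using C by (simp add: field_simps)
  qed
  have "?I / C - b z \<le> (INF y\<in>A. a y)" if "z \<in> B" for z
    using ne(1) 1 that by (intro cINF_greatest)
  then have "?I / C - (INF y\<in>A. a y) \<le> (INF z\<in>B. b z)"
    using ne(2) by (intro cINF_greatest) (auto simp: algebra_simps)
  then show ?thesis using C by (simp add: field_simps)
qed

theorem lemma4p2:
  fixes \<Omega> :: "(real ^ 'n::{finite,linorder}) set" and k :: nat and \<sigma>\<^sub>0 :: real
  assumes "k \<le> CARD('n)"
    and "open \<Omega>" "connected \<Omega>" "\<Omega> \<noteq> {}" "bounded \<Omega>"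
    and "\<sigma>\<^sub>0 \<ge> 1"
  shows "\<exists>C::real. \<forall>G. cubical_mesh \<Omega> G \<and> shape_regularity G \<le> \<sigma>\<^sub>0 \<longrightarrow>
    (\<forall>\<omega>\<in>H k \<Omega>.
       (INF \<mu>\<in>Wdef k \<Omega> G. broken_d_norm G (\<lambda>x. \<omega> x - \<mu> x)) \<le>
       C * ((INF \<eta>\<in>VQ k \<Omega> G. d_norm \<Omega> (\<lambda>x. \<omega> x - \<eta> x)) +
            (INF \<mu>\<in>P1m_broken k G. broken_d_norm G (\<lambda>x. \<omega> x - \<mu> x)))) \<and>
    (\<forall>\<omega>\<in>H0 k \<Omega>.
       (INF \<mu>\<in>Wdef0 k \<Omega> G. broken_d_norm G (\<lambda>x. \<omega> x - \<mu> x)) \<le>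
       C * ((INF \<eta>\<in>VQ0 k \<Omega> G. d_norm \<Omega> (\<lambda>x. \<omega> x - \<eta> x)) +
            (INF \<mu>\<in>P1m_broken k G. broken_d_norm G (\<lambda>x. \<omega> x - \<mu> x))))"
proof -
  note \<Omega> = assms(2,5)
  obtain R where R: "\<And>x. x \<in> \<Omega> \<Longrightarrow> norm x \<le> R" using assms(5) bounded_iff by metis
  define C where "C = sqrt (2 + 4 * (3 + 2 * (whitney_const TYPE('n) R)\<^sup>2))"
  have C0: "C > 0" unfolding C_def by (intro real_sqrt_gt_zero add_pos_nonneg) auto
  have nonneg: "0 \<le> broken_d_norm G \<omega>" for G and \<omega> :: "'n form"
    by (simp add: broken_d_norm_eq graph_sq_nonneg sum_nonneg)
  have 1: "(INF \<mu>\<in>Wdef k \<Omega> G. broken_d_norm G (\<lambda>x. \<omega> x - \<mu> x)) \<le>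
       C * ((INF \<eta>\<in>VQ k \<Omega> G. d_norm \<Omega> (\<lambda>x. \<omega> x - \<eta> x)) +
            (INF \<mu>\<in>P1m_broken k G. broken_d_norm G (\<lambda>x. \<omega> x - \<mu> x)))"
    if G: "cubical_mesh \<Omega> G" and \<omega>: "\<omega> \<in> H k \<Omega>" for G \<omega>
  proof (rule INF_le_combination[OF C0 _ P1m_broken_nonempty nonneg])
    show "VQ k \<Omega> G \<noteq> {}" using zero_in_VQ0[OF \<Omega>] by blast
    fix \<eta> p assume \<eta>: "\<eta> \<in> VQ k \<Omega> G" and p: "p \<in> P1m_broken k G"
    have "\<exists>\<mu>h\<in>P1m_broken k G. (\<forall>\<mu>\<in>VQ0_star (k + 1) \<Omega> G. adjointness_defect k \<Omega> G \<mu>h \<mu> = 0) \<and>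
        broken_d_norm G (\<lambda>x. \<omega> x - \<mu>h x) \<le> C * (d_norm \<Omega> (\<lambda>x. \<omega> x - \<eta> x) + broken_d_norm G (\<lambda>x. \<omega> x - p x))"
      unfolding C_def
    proof (rule projection_preserving_adjointness[OF \<Omega> R G \<omega> \<eta> p])
      fix \<mu> assume \<mu>: "\<mu> \<in> VQ0_star (k + 1) \<Omega> G"
      then show "\<mu> \<in> VQ_star (k + 1) \<Omega> G" by (simp add: VQ_star_def VQ0_star_def H0_star_def)
      show "L2_inner \<Omega> (wop dcoef \<Omega> \<eta>) \<mu> = L2_inner \<Omega> \<eta> (wop (adj dcoef) \<Omega> \<mu>)"
        using \<eta> \<mu> by (intro duality_H0_star[OF \<Omega>]) (auto simp: VQ_def VQ0_star_def)
    qed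
    then show "\<exists>\<mu>\<in>Wdef k \<Omega> G. broken_d_norm G (\<lambda>x. \<omega> x - \<mu> x) \<le>
        C * (d_norm \<Omega> (\<lambda>x. \<omega> x - \<eta> x) + broken_d_norm G (\<lambda>x. \<omega> x - p x))"
      unfolding Wdef_def by blast
  qed
  have 2: "(INF \<mu>\<in>Wdef0 k \<Omega> G. broken_d_norm G (\<lambda>x. \<omega> x - \<mu> x)) \<le>
       C * ((INF \<eta>\<in>VQ0 k \<Omega> G. d_norm \<Omega> (\<lambda>x. \<omega> x - \<eta> x)) +
            (INF \<mu>\<in>P1m_broken k G. broken_d_norm G (\<lambda>x. \<omega> x - \<mu> x)))"
    if G: "cubical_mesh \<Omega> G" and \<omega>0: "\<omega> \<in> H0 k \<Omega>" for G \<omega>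
  proof (rule INF_le_combination[OF C0 _ P1m_broken_nonempty nonneg])
    have \<omega>: "\<omega> \<in> H k \<Omega>" using \<omega>0 by (simp add: H0_def)
    show "VQ0 k \<Omega> G \<noteq> {}" using zero_in_VQ0[OF \<Omega>] by blast
    fix \<eta> p assume \<eta>0: "\<eta> \<in> VQ0 k \<Omega> G" and p: "p \<in> P1m_broken k G"
    then have \<eta>: "\<eta> \<in> VQ k \<Omega> G" by (simp add: VQ0_def VQ_def H0_def)
    have "\<exists>\<mu>h\<in>P1m_broken k G. (\<forall>\<mu>\<in>VQ_star (k + 1) \<Omega> G. adjointness_defect k \<Omega> G \<mu>h \<mu> = 0) \<and>
        broken_d_norm G (\<lambda>x. \<omega> x - \<mu>h x) \<le> C * (d_norm \<Omega> (\<lambda>x. \<omega> x - \<eta> x) + broken_d_norm G (\<lambda>x. \<omega> x - p x))"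
      unfolding C_def
    proof (rule projection_preserving_adjointness[OF \<Omega> R G \<omega> \<eta> p])
      fix \<mu> assume \<mu>: "\<mu> \<in> VQ_star (k + 1) \<Omega> G"
      then show "L2_inner \<Omega> (wop dcoef \<Omega> \<eta>) \<mu> = L2_inner \<Omega> \<eta> (wop (adj dcoef) \<Omega> \<mu>)"
        using \<eta>0 by (intro duality_H0[OF \<Omega>]) (auto simp: VQ0_def VQ_star_def)
    qed
    then show "\<exists>\<mu>\<in>Wdef0 k \<Omega> G. broken_d_norm G (\<lambda>x. \<omega> x - \<mu> x) \<le>
        C * (d_norm \<Omega> (\<lambda>x. \<omega> x - \<eta> x) + broken_d_norm G (\<lambda>x. \<omega> x - p x))"
      unfolding Wdef0_def by blast
  qed
  show ?thesis using 1 2 by blast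
qed

end
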